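(* Let $\lambda$ be a straight or skew shape with $n$ boxes and let $m\in\mathbb N=\{1,2,3,\dots\}$. Then (1) $\rho^{\lambda,\boxtimes}\oplus\rho^{\lambda,\cdot|\cdot,+}\oplus\rho^{\lambda,\div,+}\cong\rho^{\lambda,m,+}$; (2) $\rho^{\lambda,\boxtimes}\oplus\rho^{\lambda,\cdot|\cdot,-}\oplus\rho^{\lambda,\div,-}\cong\rho^{\lambda,m,-}$, where a representation indexed by an empty set of tableaux is the zero module.
   Context: $D_n$ is the group of permutations $\pi$ of $\{\pm1,\dots,\pm n\}$ with $\pi(-i)=-\pi(i)$ and an even number of $i\in\{1,\dots,n\}$ with $\pi(i)<0$; generators $s_0=(1,-2)(2,-1)$, $s_i=(i,i+1)(-i,-i-1)$ ($1\le i\le n-1$). Boxes of a diagram are indexed by (row $r$, column $j$), rows numbered downward; content of box $(r,j)$ is $j-r$. A D-Young tableau is a filling of a skew diagram by $\pm1,\dots,\pm n$, each number in exactly one box and each box containing one number, except that a box of content $0$ may contain a pair $\pm i$; with $c_k$ the content of the box containing $k$, one requires $c_{-k}=-c_k$. It is standard if entries increase along rows and down columns (a box containing $\pm i$, $i>0$, counts as $-i$ when compared with entries to its left or above and as $i$ when compared with entries to its right or below). A D-Young tableau with no box of content $0$ is regarded as determined by its positive-content part. For $\pi\in D_n$, $T^\pi$ is $T$ with each entry $k$ replaced by $\pi(k)$ (a pair $\pm i$ becomes $\pm\pi(i)$). Sets of tableaux for a shape $\lambda$ with $n$ boxes: for $m\in\mathbb N$, $T[\lambda,m,\pm]$ =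 standard D-Young tableaux with smallest nonnegative content $m$, positive-content boxes forming the shape $\lambda$, and an even ($+$)/odd ($-$) number of negative entries among positive-content boxes; $T[\lambda,\boxtimes]$ = standard D-Young tableaux with exactly one box of content $0$ whose nonnegative-content boxes form the shape $\lambda$; $T[\lambda,\cdot|\cdot,\pm]$ (resp. $T[\lambda,\div,\pm]$) = standard D-Young tableaux with exactly two boxes of content $0$ that can be divided by a vertical (resp. horizontal) straight line into two parts of $n$ boxes each, one of nonnegative and one of nonpositive contents, the nonnegative part having shape $\lambda$ and an even ($+$)/odd ($-$) number of negative entries. For a standard D-Young tableau $T$ with content vector $(c_1,\dots,c_n)$ put $f(T)=(c_1+c_2,c_2-c_1,\dots,c_n-c_{n-1})$. For each of these sets $\mathcal T$, $\rho^{\lambda,\ast}$ (with $\ast$ the corresponding index) is the representation of $D_n$ on the real vector space with basis $\mathcal T$ given by $\rho_{s_i}(T)=\frac1{f_i(T)}T+\sqrt{1-\frac1{f_i(T)^2}}\,T^{s_i}$, $i=0,\dots,n-1$ (where $f_i(T)=\pm1$ exactly when $T^{s_i}$ is not standard, and then the second term vanishes). *)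

theory Defs
  imports Complex_Main
begin

text \<open>A box is (row, column), rows numbered downward; content = column - row.\<close>
type_synonym box = "int \<times> int"

definition content :: "box \<Rightarrow> int" where
  "content b = snd b - fst b"

text \<open>Skew diagrams (straight shapes included), up to translation: finite subsets of
  the plane that are convex for the componentwise order.\<close>
definition is_skew_diagram :: "box set \<Rightarrow> bool" where
  "is_skew_diagram D \<longleftrightarrow> finite D \<and>
     (\<forall>r j r' j' a c. (r, j) \<in> D \<and> (r', j') \<in> D \<and> r \<le> a \<and> a \<le> r' \<and> j \<le> c \<and> c \<le> j'
        \<longrightarrow> (a, c) \<in> D)"

definition min_content :: "box set \<Rightarrow> int" where
  "min_content D = Min (content ` D)"

definition place :: "box set \<Rightarrow> int \<Rightarrow> box set" where
  "place D c = (\<lambda>(r, j). (r, j + (c - min_content D))) ` D"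

text \<open>A filling assigns to each box the set of entries in it (empty outside the diagram).\<close>
type_synonym filling = "box \<Rightarrow> int set"

definition diagram :: "filling \<Rightarrow> box set" where
  "diagram F = {b. F b \<noteq> {}}"

definition signed :: "nat \<Rightarrow> int set" where
  "signed n = {k. k \<noteq> 0 \<and> \<bar>k\<bar> \<le> int n}"

text \<open>Content c_k of the box containing k; for a tableau given by its positive-content
  part only, c_k = - c_{-k}.\<close>
definition cvec :: "filling \<Rightarrow> int \<Rightarrow> int" where
  "cvec F k = (if \<exists>b. k \<in> F b then content (THE b. k \<in> F b)
               else - content (THE b. - k \<in> F b))"

text \<open>Point reflection of the plane negating contents (centre (q/2,q/2)).\<close>
definition refl :: "int \<Rightarrow> box \<Rightarrow> box" where
  "refl q b = (q - fst b, q - snd b)"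

definition is_DYoung :: "nat \<Rightarrow> filling \<Rightarrow> bool" where
  "is_DYoung n F \<longleftrightarrow>
     is_skew_diagram (diagram F) \<and>
     (\<forall>b. F b \<subseteq> signed n) \<and>
     (\<forall>k\<in>signed n. \<exists>!b. k \<in> F b) \<and>
     (\<forall>b\<in>diagram F. card (F b) = 1 \<or> (content b = 0 \<and> (\<exists>i>0. F b = {i, - i}))) \<and>
     (\<forall>k\<in>signed n. cvec F (- k) = - cvec F k) \<and>
     (\<exists>q. \<forall>b. F (refl q b) = uminus ` F b)"

text \<open>Standardness: increasing along rows and down columns; a box containing \<plusminus>i counts
  as -i (its minimum) when compared with entries to its left/above and as i (its maximum)
  when compared with entries to its right/below.\<close>
definition is_standard :: "filling \<Rightarrow> bool" where
  "is_standard F \<longleftrightarrow>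
     (\<forall>b\<in>diagram F. \<forall>b'\<in>diagram F.
        ((fst b = fst b' \<and> snd b < snd b') \<or> (snd b = snd b' \<and> fst b < fst b'))
        \<longrightarrow> Max (F b) < Min (F b'))"

definition neg_count :: "filling \<Rightarrow> box set \<Rightarrow> nat" where
  "neg_count F P = card {k. k < 0 \<and> (\<exists>b\<in>P. k \<in> F b)}"

definition zero_boxes :: "filling \<Rightarrow> box set" where
  "zero_boxes F = {b\<in>diagram F. content b = 0}"

definition nonneg_part :: "filling \<Rightarrow> box set" where
  "nonneg_part F = {b\<in>diagram F. 0 \<le> content b}"

text \<open>T[\<lambda>,m,\<plusminus>]: such tableaux have no box of content 0 and are identified with their
  positive-content part, which is \<lambda> placed with smallest content m; it contains exactly
  one of \<plusminus>k for each k. The sign parameter s = True means even (+), False odd (-).\<close>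
definition T_m :: "box set \<Rightarrow> int \<Rightarrow> bool \<Rightarrow> filling set" where
  "T_m lam m s = {F. diagram F = place lam m \<and>
       (\<forall>b\<in>diagram F. \<exists>k. F b = {k}) \<and>
       (\<forall>b. F b \<subseteq> signed (card lam)) \<and>
       (\<forall>i::int. 1 \<le> i \<and> i \<le> int (card lam) \<longrightarrow> (\<exists>!b. F b \<inter> {i, - i} \<noteq> {})) \<and>
       is_standard F \<and>
       even (neg_count F (diagram F)) = s}"

definition T_box :: "box set \<Rightarrow> filling set" where
  "T_box lam = {F. is_DYoung (card lam) F \<and> is_standard F \<and>
       card (zero_boxes F) = 1 \<and> nonneg_part F = place lam 0}"

definition split_ok :: "bool \<Rightarrow> box set \<Rightarrow> bool \<Rightarrow> filling \<Rightarrow> bool" where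
  "split_ok vert lam s F \<longleftrightarrow>
     (\<exists>a::int. \<exists>P N.
        (let L = {b\<in>diagram F. (if vert then snd b else fst b) \<le> a};
             R = {b\<in>diagram F. a < (if vert then snd b else fst b)}
         in (P = L \<and> N = R) \<or> (P = R \<and> N = L)) \<and>
        card P = card lam \<and> card N = card lam \<and>
        (\<forall>b\<in>P. 0 \<le> content b) \<and> (\<forall>b\<in>N. content b \<le> 0) \<and>
        P = place lam 0 \<and> even (neg_count F P) = s)"

definition T_two :: "bool \<Rightarrow> box set \<Rightarrow> bool \<Rightarrow> filling set" where
  "T_two vert lam s = {F. is_DYoung (card lam) F \<and> is_standard F \<and>
       card (zero_boxes F) = 2 \<and> split_ok vert lam s F}"

definition gen :: "nat \<Rightarrow> int \<Rightarrow> int" where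
  "gen i k = (if i = 0 then
       (if k = 1 then -2 else if k = 2 then -1 else if k = -1 then 2 else if k = -2 then 1 else k)
     else
       (if k = int i then int i + 1 else if k = int i + 1 then int i
        else if k = - int i then - int i - 1 else if k = - int i - 1 then - int i else k))"

text \<open>Indices of the generators of D_n (D_1 and D_0 are trivial).\<close>
definition gens :: "nat \<Rightarrow> nat set" where
  "gens n = (if 2 \<le> n then {..<n} else {})"

definition act :: "(int \<Rightarrow> int) \<Rightarrow> filling \<Rightarrow> filling" where
  "act \<pi> F = (\<lambda>b. \<pi> ` F b)"

definition fval :: "filling \<Rightarrow> nat \<Rightarrow> real" where
  "fval F i = real_of_int (if i = 0 then cvec F 1 + cvec F 2
                           else cvec F (int i + 1) - cvec F (int i))"

text \<open>A representation with a distinguished finite basis S is given by matrix coefficients: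
  A i T T' is the coefficient of T' in \<rho>_{s_i}(T).\<close>
type_synonym 'a brep = "'a set \<times> (nat \<Rightarrow> 'a \<Rightarrow> 'a \<Rightarrow> real)"

definition seminormal :: "nat \<Rightarrow> filling \<Rightarrow> filling \<Rightarrow> real" where
  "seminormal i T T' =
     (if T' = T then 1 / fval T i else 0) +
     (if T' = act (gen i) T then sqrt (1 - 1 / (fval T i)\<^sup>2) else 0)"

definition rho :: "filling set \<Rightarrow> filling brep" where
  "rho S = (S, seminormal)"

definition rep_dsum :: "'a brep \<Rightarrow> 'b brep \<Rightarrow> ('a + 'b) brep" where
  "rep_dsum X Y = (Inl ` fst X \<union> Inr ` fst Y,
     (\<lambda>i x y. case (x, y) of
        (Inl a, Inl b) \<Rightarrow> snd X i a b
      | (Inr a, Inr b) \<Rightarrow> snd Y i a b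
      | _ \<Rightarrow> 0))"

definition rep_iso :: "nat \<Rightarrow> 'a brep \<Rightarrow> 'b brep \<Rightarrow> bool" where
  "rep_iso n X Y \<longleftrightarrow>
     (\<exists>(P :: 'a \<Rightarrow> 'b \<Rightarrow> real) (Q :: 'b \<Rightarrow> 'a \<Rightarrow> real).
        (\<forall>x\<in>fst X. \<forall>x'\<in>fst X. (\<Sum>y\<in>fst Y. P x y * Q y x') = (if x = x' then 1 else 0)) \<and>
        (\<forall>y\<in>fst Y. \<forall>y'\<in>fst Y. (\<Sum>x\<in>fst X. Q y x * P x y') = (if y = y' then 1 else 0)) \<and>
        (\<forall>i\<in>gens n. \<forall>x\<in>fst X. \<forall>y\<in>fst Y.
           (\<Sum>x'\<in>fst X. snd X i x x' * P x' y) = (\<Sum>y'\<in>fst Y. P x y' * snd Y i y' y)))"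

end

theory Submission
  imports "Jordan_Normal_Form.Determinant" Defs
begin

text \<open>Let S be the set of standard signed fillings of the shape with fixed parity. For every real t at least 0,
  the contents shifted by t define seminormal matrices on the space with basis S which satisfy the Coxeter
  relations of type D: each f_i keeps absolute value at least 1, because the minimal content occurs in only one
  box. For t = m this is the representation on the right-hand side. For t = 0 further matrix entries vanish, and the matrices split into
  three blocks, namely the summands on the left-hand side; a tableau with a pair in its content 0 box corresponds
  to the signed tableau whose sign in that box is dictated by the parity. Finally, a continuous family of
  representations of a finite group is constant up to isomorphism: averaging the identity matrix over the group
  gives an intertwiner between the representations at t and t' which is a multiple of the identity for t' = t,
  hence invertible for t' near t.\<close>

section \<open>Isomorphisms of based representations\<close>

text \<open>What makes shift zero special is that the corner entry k and its opposite -k both get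
  content 0 there. A generator that exchanges -k with the entry x of a box of content 1 leads to
  another standard signed filling, and its coefficient is positive for t > 0; at t = 0, however,
  |f_i| = 1 and the coefficient vanishes. Hence the order of -k relative to the entries above and to
  the right of the corner is constant on each block, and it decides where the mirror image of the
  diagram is attached.

  No explicit intertwiner between the two ends is available, and D_n itself is never built: a
  representation is known only through the matrices of its generators. This is why the Coxeter
  relations have to be proved for every real t, in a form that tolerates generators leading out of
  S, and why the average is taken over a chain of cosets. Invertibility near t follows from
  continuity of the determinant, and bisection of the interval from 0 to m glues the local
  isomorphisms.\<close>

lemma sum_mult_assoc:
  fixes a :: "'x \<Rightarrow> real"
  shows "(\<Sum>y\<in>Y. (\<Sum>x\<in>X. a x * b x y) * c y) = (\<Sum>x\<in>X. a x * (\<Sum>y\<in>Y. b x y * c y))"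
  by (simp add: sum_distrib_left sum_distrib_right mult.assoc) (rule sum.swap)

lemma rep_iso_bij:
  assumes h: "bij_betw h (fst X) (fst Y)" and fin: "finite (fst X)"
    and eq: "\<And>i x x'. i \<in> gens n \<Longrightarrow> x \<in> fst X \<Longrightarrow> x' \<in> fst X \<Longrightarrow> snd X i x x' = snd Y i (h x) (h x')"
  shows "rep_iso n X Y"
proof -
  have finY: "finite (fst Y)" using h fin bij_betw_finite by blast
  have hin: "h x \<in> fst Y" if "x \<in> fst X" for x using h that by (auto simp: bij_betw_def)
  have inj: "h x = h x' \<longleftrightarrow> x = x'" if "x \<in> fst X" "x' \<in> fst X" for x x'
    using h that by (auto simp: bij_betw_def inj_on_def)
  \<comment> \<open>The permutation matrix of \<open>h\<close>; its inverse is its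
    transpose.\<close>
  define P where "P x y = (if y = h x then 1 else 0 :: real)" for x y
  have PY: "(\<Sum>y\<in>fst Y. P x y * a y) = a (h x)" if "x \<in> fst X" for x a
    using that finY hin by (simp add: P_def if_distrib[of "\<lambda>z. z * _"] cong: if_cong)
  have PX: "(\<Sum>x\<in>fst X. a x * P x (h x0)) = a x0" if x0: "x0 \<in> fst X" for x0 a
  proof -
    have "(\<Sum>x\<in>fst X. a x * P x (h x0)) = (\<Sum>x\<in>fst X. if x = x0 then a x else 0)"
      by (rule sum.cong) (auto simp: P_def inj x0)
    then show ?thesis using fin x0 by simp
  qed
  have ex: "\<exists>x\<in>fst X. y = h x" if "y \<in> fst Y" for y
    using h that by (auto simp: bij_betw_def)
  show ?thesis
    unfolding rep_iso_def
  proof (intro exI[of _ P] exI[of _ "\<lambda>y x. P x y"] conjI ballI)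
    fix x x' assume "x \<in> fst X" "x' \<in> fst X"
    then show "(\<Sum>y\<in>fst Y. P x y * P x' y) = (if x = x' then 1 else 0)"
      by (simp add: PY) (auto simp: P_def inj)
  next
    fix y y' assume y: "y \<in> fst Y" "y' \<in> fst Y"
    then obtain x' where x': "x' \<in> fst X" "y' = h x'" using ex by blast
    show "(\<Sum>x\<in>fst X. P x y * P x y') = (if y = y' then 1 else 0)"
      using x' by (simp add: PX) (simp add: P_def)
  next
    fix i x y assume i: "i \<in> gens n" and x: "x \<in> fst X" and y: "y \<in> fst Y"
    obtain x' where x': "x' \<in> fst X" "y = h x'" using ex y by blast
    show "(\<Sum>x'\<in>fst X. snd X i x x' * P x' y) = (\<Sum>y'\<in>fst Y. P x y' * snd Y i y' y)"
      using x x' i eq by (simp add: PX PY)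
  qed
qed

text \<open>With A and B for the matrices of X and Y, the chain is Q A = Q A P Q = Q P B Q = B
  Q.\<close>

lemma rep_iso_sym:
  assumes "rep_iso n X Y" and finX: "finite (fst X)" and finY: "finite (fst Y)"
  shows "rep_iso n Y X"
proof -
  obtain P Q where
    PQ: "\<And>x x'. x \<in> fst X \<Longrightarrow> x' \<in> fst X \<Longrightarrow> (\<Sum>y\<in>fst Y. P x y * Q y x') = (if x = x' then 1 else 0)" and
    QP: "\<And>y y'. y \<in> fst Y \<Longrightarrow> y' \<in> fst Y \<Longrightarrow> (\<Sum>x\<in>fst X. Q y x * P x y') = (if y = y' then 1 else 0)" and
    tw: "\<And>i x y. i \<in> gens n \<Longrightarrow> x \<in> fst X \<Longrightarrow> y \<in> fst Y \<Longrightarrow>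
           (\<Sum>x'\<in>fst X. snd X i x x' * P x' y) = (\<Sum>y'\<in>fst Y. P x y' * snd Y i y' y)"
    using assms(1) unfolding rep_iso_def by blast
  show ?thesis
    unfolding rep_iso_def
  proof (intro exI[of _ Q] exI[of _ P] conjI ballI)
    fix i y x assume i: "i \<in> gens n" and y: "y \<in> fst Y" and x: "x \<in> fst X"
    have "(\<Sum>x'\<in>fst X. Q y x' * snd X i x' x) =
          (\<Sum>x'\<in>fst X. Q y x' * (\<Sum>z\<in>fst X. snd X i x' z * (\<Sum>w\<in>fst Y. P z w * Q w x)))"
      using finX x by (simp add: PQ if_distrib[of "\<lambda>z. _ * z"] cong: sum.cong if_cong)
    also have "\<dots> = (\<Sum>x'\<in>fst X. Q y x' * (\<Sum>w\<in>fst Y. (\<Sum>z\<in>fst X. snd X i x' z * P z w) * Q w x))"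
      by (simp only: sum_mult_assoc)
    also have "\<dots> = (\<Sum>x'\<in>fst X. Q y x' * (\<Sum>w\<in>fst Y. (\<Sum>v\<in>fst Y. P x' v * snd Y i v w) * Q w x))"
      using i by (simp add: tw)
    also have "\<dots> = (\<Sum>x'\<in>fst X. Q y x' * (\<Sum>v\<in>fst Y. P x' v * (\<Sum>w\<in>fst Y. snd Y i v w * Q w x)))"
      by (simp only: sum_mult_assoc)
    also have "\<dots> = (\<Sum>v\<in>fst Y. (\<Sum>x'\<in>fst X. Q y x' * P x' v) * (\<Sum>w\<in>fst Y. snd Y i v w * Q w x))"
      by (simp only: sum_mult_assoc)
    also have "\<dots> = (\<Sum>w\<in>fst Y. snd Y i y w * Q w x)"
      using finY y by (simp add: QP if_distrib[of "\<lambda>z. z * _"] cong: sum.cong if_cong)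
    finally show "(\<Sum>x'\<in>fst Y. snd Y i y x' * Q x' x) = (\<Sum>y'\<in>fst X. Q y y' * snd X i y' x)" ..
  qed (use PQ QP in auto)
qed

lemma rep_iso_trans:
  assumes "rep_iso n X Y" and "rep_iso n Y Z" and finY: "finite (fst Y)"
  shows "rep_iso n X Z"
proof -
  obtain P Q where
    PQ: "\<And>x x'. x \<in> fst X \<Longrightarrow> x' \<in> fst X \<Longrightarrow> (\<Sum>y\<in>fst Y. P x y * Q y x') = (if x = x' then 1 else 0)" and
    QP: "\<And>y y'. y \<in> fst Y \<Longrightarrow> y' \<in> fst Y \<Longrightarrow> (\<Sum>x\<in>fst X. Q y x * P x y') = (if y = y' then 1 else 0)" and
    tw: "\<And>i x y. i \<in> gens n \<Longrightarrow> x \<in> fst X \<Longrightarrow> y \<in> fst Y \<Longrightarrow>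
           (\<Sum>x'\<in>fst X. snd X i x x' * P x' y) = (\<Sum>y'\<in>fst Y. P x y' * snd Y i y' y)"
    using assms(1) unfolding rep_iso_def by blast
  obtain P' Q' where
    PQ': "\<And>x x'. x \<in> fst Y \<Longrightarrow> x' \<in> fst Y \<Longrightarrow> (\<Sum>y\<in>fst Z. P' x y * Q' y x') = (if x = x' then 1 else 0)" and
    QP': "\<And>y y'. y \<in> fst Z \<Longrightarrow> y' \<in> fst Z \<Longrightarrow> (\<Sum>x\<in>fst Y. Q' y x * P' x y') = (if y = y' then 1 else 0)" and
    tw': "\<And>i x y. i \<in> gens n \<Longrightarrow> x \<in> fst Y \<Longrightarrow> y \<in> fst Z \<Longrightarrow>
           (\<Sum>x'\<in>fst Y. snd Y i x x' * P' x' y) = (\<Sum>y'\<in>fst Z. P' x y' * snd Z i y' y)"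
    using assms(2) unfolding rep_iso_def by blast
  have delta: "(\<Sum>w\<in>fst Y. (if v = w then 1 else 0) * c w) = c v" if "v \<in> fst Y" for v and c :: "_ \<Rightarrow> real"
    using that finY by (simp add: if_distrib[of "\<lambda>z. z * _"] cong: if_cong)
  show ?thesis
    unfolding rep_iso_def
  proof (intro exI[of _ "\<lambda>x z. \<Sum>y\<in>fst Y. P x y * P' y z"] exI[of _ "\<lambda>z x. \<Sum>y\<in>fst Y. Q' z y * Q y x"] conjI ballI)
    fix x x' assume x: "x \<in> fst X" "x' \<in> fst X"
    have "(\<Sum>z\<in>fst Z. (\<Sum>y\<in>fst Y. P x y * P' y z) * (\<Sum>w\<in>fst Y. Q' z w * Q w x')) =
          (\<Sum>y\<in>fst Y. P x y * (\<Sum>w\<in>fst Y. (\<Sum>z\<in>fst Z. P' y z * Q' z w) * Q w x'))"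
      by (simp only: sum_mult_assoc)
    also have "\<dots> = (\<Sum>y\<in>fst Y. P x y * Q y x')"
      by (rule sum.cong) (simp_all add: PQ' delta cong: sum.cong)
    finally show "(\<Sum>z\<in>fst Z. (\<Sum>y\<in>fst Y. P x y * P' y z) * (\<Sum>w\<in>fst Y. Q' z w * Q w x')) =
        (if x = x' then 1 else 0)"
      using x by (simp add: PQ)
  next
    fix x x' assume x: "x \<in> fst Z" "x' \<in> fst Z"
    have "(\<Sum>z\<in>fst X. (\<Sum>y\<in>fst Y. Q' x y * Q y z) * (\<Sum>w\<in>fst Y. P z w * P' w x')) =
          (\<Sum>y\<in>fst Y. Q' x y * (\<Sum>w\<in>fst Y. (\<Sum>z\<in>fst X. Q y z * P z w) * P' w x'))"
      by (simp only: sum_mult_assoc)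
    also have "\<dots> = (\<Sum>y\<in>fst Y. Q' x y * P' y x')"
      by (rule sum.cong) (simp_all add: QP delta cong: sum.cong)
    finally show "(\<Sum>z\<in>fst X. (\<Sum>y\<in>fst Y. Q' x y * Q y z) * (\<Sum>w\<in>fst Y. P z w * P' w x')) =
        (if x = x' then 1 else 0)"
      using x by (simp add: QP')
  next
    fix i x z assume i: "i \<in> gens n" and x: "x \<in> fst X" and z: "z \<in> fst Z"
    have "(\<Sum>x'\<in>fst X. snd X i x x' * (\<Sum>y\<in>fst Y. P x' y * P' y z)) =
          (\<Sum>y\<in>fst Y. (\<Sum>x'\<in>fst X. snd X i x x' * P x' y) * P' y z)"
      by (simp only: sum_mult_assoc)
    also have "\<dots> = (\<Sum>y\<in>fst Y. (\<Sum>y'\<in>fst Y. P x y' * snd Y i y' y) * P' y z)"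
      using i x by (simp add: tw)
    also have "\<dots> = (\<Sum>y\<in>fst Y. P x y * (\<Sum>y'\<in>fst Y. snd Y i y y' * P' y' z))"
      by (simp only: sum_mult_assoc)
    also have "\<dots> = (\<Sum>y\<in>fst Y. P x y * (\<Sum>z'\<in>fst Z. P' y z' * snd Z i z' z))"
      using i z by (simp add: tw')
    also have "\<dots> = (\<Sum>z'\<in>fst Z. (\<Sum>y\<in>fst Y. P x y * P' y z') * snd Z i z' z)"
      by (simp only: sum_mult_assoc)
    finally show "(\<Sum>x'\<in>fst X. snd X i x x' * (\<Sum>y\<in>fst Y. P x' y * P' y z)) =
       (\<Sum>z'\<in>fst Z. (\<Sum>y\<in>fst Y. P x y * P' y z') * snd Z i z' z)" .
  qed
qed

section \<open>Averaging over the Coxeter group of type D\<close>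

text \<open>Adjacency in the Coxeter diagram of type D: the chain 1 - 2 - 3 - ..., with the node 0
  attached to 2, so that 0 and 1 are the two commuting ends of the fork.\<close>

definition linked :: "nat \<Rightarrow> nat \<Rightarrow> bool" where
  "linked i j \<longleftrightarrow> (1 \<le> i \<and> j = Suc i) \<or> (1 \<le> j \<and> i = Suc j) \<or> (i = 0 \<and> j = 2) \<or> (i = 2 \<and> j = 0)"

lemma linked_sym: "linked i j \<longleftrightarrow> linked j i"
  by (auto simp: linked_def)

text \<open>The carrier is a bare type without linear structure: the locale serves for the action on
  fillings, for operators on functions and for conjugation of matrices alike.\<close>

locale D_relations =
  fixes n :: nat and C :: "nat \<Rightarrow> 'v \<Rightarrow> 'v"
  assumes invol: "i \<in> gens n \<Longrightarrow> C i (C i v) = v"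
    and comm: "i \<in> gens n \<Longrightarrow> j \<in> gens n \<Longrightarrow> \<not> linked i j \<Longrightarrow> C i (C j v) = C j (C i v)"
    and braid: "i \<in> gens n \<Longrightarrow> j \<in> gens n \<Longrightarrow> linked i j \<Longrightarrow> C i (C j (C i v)) = C j (C i (C j v))"

lemma gens_mono: "m \<le> n \<Longrightarrow> i \<in> gens m \<Longrightarrow> i \<in> gens n"
  by (auto simp: gens_def split: if_splits)

lemma D_relations_mono:
  assumes "D_relations n C" "m \<le> n"
  shows "D_relations m C"
proof -
  interpret D_relations n C by fact
  note g = gens_mono[OF assms(2)]
  show ?thesis by unfold_locales (rule invol comm braid; simp add: g)+
qed

text \<open>For a vector v fixed by the parabolic subgroup D_{n-1}, coset_vec C n v k is the translate of v by the
  minimal coset representative of D_n/D_{n-1} that sends n to k; coset_pos C n v d belongs to k = n - d and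
  coset_neg C x j to k = - (j + 1), where x is the translate for k = 2.\<close>

primrec coset_pos :: "(nat \<Rightarrow> 'v \<Rightarrow> 'v) \<Rightarrow> nat \<Rightarrow> 'v \<Rightarrow> nat \<Rightarrow> 'v" where
  "coset_pos C n v 0 = v"
| "coset_pos C n v (Suc d) = C (n - Suc d) (coset_pos C n v d)"

primrec coset_neg :: "(nat \<Rightarrow> 'v \<Rightarrow> 'v) \<Rightarrow> 'v \<Rightarrow> nat \<Rightarrow> 'v" where
  "coset_neg C v 0 = C 0 v"
| "coset_neg C v (Suc j) = C (Suc j) (coset_neg C v j)"

definition coset_vec :: "(nat \<Rightarrow> 'v \<Rightarrow> 'v) \<Rightarrow> nat \<Rightarrow> 'v \<Rightarrow> int \<Rightarrow> 'v" where
  "coset_vec C n v k = (if 0 < k then coset_pos C n v (n - nat k)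
     else coset_neg C (coset_pos C n v (n - 2)) (nat (- k) - 1))"

section \<open>Translates of a vector fixed by D_{n-1} are permuted like the numbers +-1, ...,
  +-n\<close>

context D_relations
begin

text \<open>\<open>X k\<close> and \<open>Y k\<close> are the translates belonging to k and to -k.
  The chain from \<open>X n\<close> down to \<open>X 2\<close> forks: the generator 1 leads to
  \<open>X 1\<close> and 0 leads to \<open>Y 1\<close>; both branches meet again in
  \<open>Y 2\<close>, from where the chain continues to \<open>Y n\<close>.\<close>

context
  fixes v X Y
  assumes n2: "2 \<le> n"
    and fixed: "\<And>i. i \<in> gens (n - 1) \<Longrightarrow> C i v = v"
    and Xn: "X n = v"
    and X: "\<And>k. 1 \<le> k \<Longrightarrow> k < n \<Longrightarrow> X k = C k (X (Suc k))"
    and Y1: "Y 1 = C 0 (X 2)"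
    and Y: "\<And>k. 1 \<le> k \<Longrightarrow> k < n \<Longrightarrow> Y (Suc k) = C k (Y k)"
begin

lemma gens_iff: "i \<in> gens n \<longleftrightarrow> i < n"
  using n2 by (auto simp: gens_def)

text \<open>Downward induction from \<open>X n\<close>, which D_{n-1} fixes: \<open>C i\<close>
  commutes with every \<open>C k\<close> that is passed. For i = 0 the bound is 3 because the
  generator 0 moves 1 and 2.\<close>

lemma X_low:
  assumes "k \<le> n" "Suc i < k" "i = 0 \<longrightarrow> 3 \<le> k"
  shows "C i (X k) = X k"
  using assms(1) assms(2-)
proof (induction k rule: inc_induct)
  case base
  then have "i \<in> gens (n - 1)" by (auto simp: gens_def)
  then show ?case using Xn fixed by simp
next
  case (step k)
  have "C i (X k) = C i (C k (X (Suc k)))" using X[of k] step by simp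
  also have "\<dots> = C k (C i (X (Suc k)))"
    by (rule comm) (use step in \<open>auto simp: gens_iff linked_def\<close>)
  finally show ?case using X[of k] step by simp
qed

text \<open>Only i = k + 1 is critical. There \<open>X k\<close> is C_k C_i applied to
  \<open>X (k + 2)\<close>; the braid relation moves \<open>C i\<close> to the middle and produces
  an inner C_k, which \<open>X_low\<close> absorbs.\<close>

lemma X_high:
  assumes "k < n" "1 \<le> k" "k < i" "i < n"
  shows "C i (X k) = X k"
proof -
  have "k \<le> n" using assms by simp
  then show ?thesis using assms(2-)
  proof (induction k rule: inc_induct)
    case base
    then show ?case by simp
  next
    case (step k)
    show ?case
    proof (cases "i = Suc k")
      case True
      have kk: "X k = C k (C i (X (Suc (Suc k))))" using X[of k] X[of "Suc k"] step True by simp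
      have "C i (X k) = C k (C i (C k (X (Suc (Suc k)))))"
        unfolding kk by (rule braid) (use step True in \<open>auto simp: gens_iff linked_def\<close>)
      also have "C k (X (Suc (Suc k))) = X (Suc (Suc k))"
        by (rule X_low) (use step True in auto)
      finally show ?thesis using kk by simp
    next
      case False
      have "C i (X k) = C i (C k (X (Suc k)))" using X[of k] step by simp
      also have "\<dots> = C k (C i (X (Suc k)))"
        by (rule comm) (use step False in \<open>auto simp: gens_iff linked_def\<close>)
      finally show ?thesis using X[of k] step False by simp
    qed
  qed
qed

text \<open>The fork closes because the generators 0 and 1 commute.\<close>

lemma Y2: "Y 2 = C 0 (X 1)"
proof -
  have "Y 2 = C 1 (C 0 (X 2))" using Y[of 1] Y1 n2 by (simp add: numeral_2_eq_2)
  also have "\<dots> = C 0 (C 1 (X 2))"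
    by (rule comm) (use n2 in \<open>auto simp: gens_iff linked_def\<close>)
  finally show ?thesis using X[of 1] n2 by (simp add: numeral_2_eq_2)
qed

text \<open>At the start k = 1 the critical index is 2, the neighbour of the node 0; the braid
  relation of 0 and 2 works there as in \<open>X_high\<close>.\<close>

lemma Y_high:
  assumes "1 \<le> k" "k < i" "i < n"
  shows "C i (Y k) = Y k"
  using assms(1) assms(2-)
proof (induction k rule: dec_induct)
  case base
  show ?case
  proof (cases "i = 2")
    case True
    have x2: "X 2 = C 2 (X 3)" using X[of 2] base True by (simp add: numeral_3_eq_3)
    have "C i (Y 1) = C 2 (C 0 (C 2 (X 3)))" using Y1 True x2 by simp
    also have "\<dots> = C 0 (C 2 (C 0 (X 3)))"
      by (rule braid) (use base True in \<open>auto simp: gens_iff linked_def\<close>)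
    also have "C 0 (X 3) = X 3" by (rule X_low) (use base True in auto)
    finally show ?thesis using Y1 x2 by simp
  next
    case False
    have "C i (Y 1) = C 0 (C i (X 2))" 
      unfolding Y1 by (rule comm) (use base False in \<open>auto simp: gens_iff linked_def\<close>)
    also have "C i (X 2) = X 2" by (rule X_high) (use base False in auto)
    finally show ?thesis using Y1 by simp
  qed
next
  case (step k)
  have "C i (Y (Suc k)) = C i (C k (Y k))" using Y[of k] step by simp
  also have "\<dots> = C k (C i (Y k))"
    by (rule comm) (use step in \<open>auto simp: gens_iff linked_def\<close>)
  finally show ?case using Y[of k] step by simp
qed

lemma Y_low:
  assumes "k \<le> n" "1 \<le> i" "Suc i < k"
  shows "C i (Y k) = Y k"
  using assms
proof (induction k)
  case 0
  then show ?case by simp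
next
  case (Suc k)
  show ?case
  proof (cases "Suc i = k")
    case True
    have yk: "Y (Suc k) = C k (C i (Y i))" using Y[of k] Y[of i] Suc.prems True by auto
    have "C i (Y (Suc k)) = C k (C i (C k (Y i)))"
      unfolding yk by (rule braid) (use Suc.prems True in \<open>auto simp: gens_iff linked_def\<close>)
    also have "C k (Y i) = Y i" by (rule Y_high) (use Suc.prems True in auto)
    finally show ?thesis using yk by simp
  next
    case False
    have "C i (Y (Suc k)) = C i (C k (Y k))" using Y[of k] Suc.prems by simp
    also have "\<dots> = C k (C i (Y k))"
      by (rule comm) (use Suc.prems False in \<open>auto simp: gens_iff linked_def\<close>)
    finally show ?thesis using Y[of k] Suc False by simp
  qed
qed

text \<open>The induction can start at 3 because \<open>Y2\<close> rewrites \<open>Y 3\<close> as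
  C_2 C_0 applied to \<open>X 1\<close>; the braid relation of 0 and 2 then leaves a C_2 for
  \<open>X_high\<close> to absorb.\<close>

lemma Y_zero:
  assumes "3 \<le> k" "k \<le> n"
  shows "C 0 (Y k) = Y k"
  using assms
proof (induction k rule: dec_induct)
  case base
  have y3: "Y 3 = C 2 (C 0 (X 1))" using Y[of 2] Y2 base by (simp add: numeral_3_eq_3)
  have "C 0 (Y 3) = C 2 (C 0 (C 2 (X 1)))"
    unfolding y3 by (rule braid) (use base in \<open>auto simp: gens_iff linked_def\<close>)
  also have "C 2 (X 1) = X 1" by (rule X_high) (use base in auto)
  finally show ?case using y3 by simp
next
  case (step k)
  have "C 0 (Y (Suc k)) = C 0 (C k (Y k))" using Y[of k] step by simp
  also have "\<dots> = C k (C 0 (Y k))"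
    by (rule comm) (use step in \<open>auto simp: gens_iff linked_def\<close>)
  finally show ?case using Y[of k] step by simp
qed

text \<open>If \<open>gen i\<close> moves k, one of the recursions or its inverse applies; otherwise
  one of the stabiliser lemmas from \<open>X_low\<close> to \<open>Y_zero\<close> does.\<close>

lemma coset_action:
  fixes x :: "int \<Rightarrow> 'v"
  assumes x: "\<And>k. 1 \<le> k \<Longrightarrow> x (int k) = X k" "\<And>k. 1 \<le> k \<Longrightarrow> x (- int k) = Y k"
    and i: "i < n" and k: "k \<in> signed n"
  shows "C i (x k) = x (gen i k)"
proof -
  have inv: "C i (C i w) = w" for w using i by (intro invol) (simp add: gens_iff)
  have X1: "X i = C i (X (Suc i))" if "i \<noteq> 0" using X[of i] that i by simp
  have YS: "x (- int i - 1) = Y (Suc i)" 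
  proof -
    have "- int i - 1 = - int (Suc i)" by simp
    moreover have "x (- int (Suc i)) = Y (Suc i)" by (rule x(2)) simp
    ultimately show ?thesis by (simp only:)
  qed
  have Y1': "Y (Suc i) = C i (Y i)" if "i \<noteq> 0" using Y[of i] that i by simp
  show ?thesis
  proof (cases "0 < k")
    case True
    then obtain l where l: "k = int l" "1 \<le> l" "l \<le> n"
      using k by (auto simp: signed_def intro!: that[of "nat k"])
    consider "i = 0" "l = 1" | "i = 0" "l = 2" | "i = 0" "3 \<le> l" | "i \<noteq> 0" "l = i" | "i \<noteq> 0" "l = Suc i"
      | "i \<noteq> 0" "l < i" | "i \<noteq> 0" "Suc i < l" using l by linarith
    then show ?thesis
    proof cases
      case 1
      then show ?thesis using x(1)[of 1] x(2)[of 2] Y2 l by (simp add: gen_def)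
    next
      case 2
      then show ?thesis using x(1)[of 2] x(2)[of 1] Y1 l by (simp add: gen_def)
    next
      case 3
      then show ?thesis using x(1)[of l] X_low[of l 0] l by (simp add: gen_def)
    next
      case 4
      then show ?thesis using x(1)[of l] x(1)[of "Suc l"] X1 inv l
        by (simp add: gen_def add.commute)
    next
      case 5
      then show ?thesis using x(1)[of i] x(1)[of "Suc i"] X1 inv l
        by (simp add: gen_def add.commute)
    next
      case 6
      then show ?thesis using x(1)[of l] X_high[of l i] l i by (simp add: gen_def)
    next
      case 7
      then show ?thesis using x(1)[of l] X_low[of l i] l i by (simp add: gen_def)
    qed
  next
    case False
    then obtain l where l: "k = - int l" "1 \<le> l" "l \<le> n"
      using k by (auto simp: signed_def intro!: that[of "nat (- k)"])
    consider "i = 0" "l = 1" | "i = 0" "l = 2" | "i = 0" "3 \<le> l" | "i \<noteq> 0" "l = i" | "i \<noteq> 0" "l = Suc i"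
      | "i \<noteq> 0" "l < i" | "i \<noteq> 0" "Suc i < l" using l by linarith
    then show ?thesis
    proof cases
      case 1
      then show ?thesis using x(2)[of 1] x(1)[of 2] Y1 inv l by (simp add: gen_def)
    next
      case 2
      then show ?thesis using x(2)[of 2] x(1)[of 1] Y2 inv l by (simp add: gen_def)
    next
      case 3
      then show ?thesis using x(2)[of l] Y_zero[of l] l by (simp add: gen_def)
    next
      case 4
      then show ?thesis using x(2)[of l] YS Y1' inv l
        by (simp add: gen_def)
    next
      case 5
      then have "k = - int i - 1" using l by simp
      then show ?thesis using 5 x(2)[of i] YS Y1' inv by (simp add: gen_def)
    next
      case 6
      then show ?thesis using x(2)[of l] Y_high[of l i] l i by (simp add: gen_def)
    next
      case 7
      then show ?thesis using x(2)[of l] Y_low[of l i] l i by (simp add: gen_def)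
    qed
  qed
qed

end

lemma coset_vec_action:
  assumes n2: "2 \<le> n" and fixed: "\<And>i. i \<in> gens (n - 1) \<Longrightarrow> C i v = v"
    and i: "i < n" and k: "k \<in> signed n"
  shows "C i (coset_vec C n v k) = coset_vec C n v (gen i k)"
proof -
  define X where "X k = coset_pos C n v (n - k)" for k
  define Y where "Y k = coset_neg C (coset_pos C n v (n - 2)) (k - 1)" for k
  show ?thesis
  proof (rule coset_action[where v = v and X = X and Y = Y])
    fix k assume k: "1 \<le> k" "k < n"
    then have "n - k = Suc (n - Suc k)" by simp
    then show "X k = C k (X (Suc k))" using k by (simp add: X_def)
    show "Y (Suc k) = C k (Y k)" using k by (cases k) (auto simp: Y_def)
  qed (use assms in \<open>auto simp: X_def Y_def coset_vec_def\<close>)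
qed

end

text \<open>The generator i exchanges lo i with hi i and - lo i with - hi i, and f_i = c_{hi i} - c_{lo i}; with
  lo 0 = -1 and hi 0 = 2 this covers the generator 0 as well.\<close>

definition lo :: "nat \<Rightarrow> int" where "lo i = (if i = 0 then -1 else int i)"
definition hi :: "nat \<Rightarrow> int" where "hi i = (if i = 0 then 2 else int i + 1)"

lemma gen_swap:
  "gen i k = (if k = lo i then hi i else if k = hi i then lo i
     else if k = - lo i then - hi i else if k = - hi i then - lo i else k)"
  by (cases "i = 0") (simp_all add: gen_def lo_def hi_def)

lemma lo_hi: "lo i < hi i" "lo i \<noteq> 0" "hi i \<noteq> 0" "lo i \<noteq> - hi i" "- lo i \<noteq> hi i" "0 < hi i"
  by (auto simp: lo_def hi_def)

lemma gen_invol: "gen i (gen i k) = k"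
  using lo_hi[of i] by (simp add: gen_swap)

lemma lo_hi_signed: "i \<in> gens n \<Longrightarrow> lo i \<in> signed n" "i \<in> gens n \<Longrightarrow> hi i \<in> signed n"
  by (auto simp: lo_def hi_def gens_def signed_def split: if_splits)

lemma signed_minus: "- k \<in> signed n \<longleftrightarrow> k \<in> signed n"
  by (simp add: signed_def)

lemma gen_signed: "i \<in> gens n \<Longrightarrow> k \<in> signed n \<Longrightarrow> gen i k \<in> signed n"
  by (simp add: gen_swap lo_hi_signed signed_minus)

lemma bij_betw_gen: "i \<in> gens n \<Longrightarrow> bij_betw (gen i) (signed n) (signed n)"
  by (rule bij_betw_byWitness[where f' = "gen i"]) (auto simp: gen_invol gen_signed)

lemma finite_signed: "finite (signed n)"
  by (rule finite_subset[of _ "{- int n..int n}"]) (auto simp: signed_def)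

text \<open>Summing over the cosets of the chain D_1, D_2, ..., D_n amounts to summing over the whole group; only the
  Coxeter relations of the operators C i enter, not a presentation theorem for D_n.\<close>

primrec average :: "(nat \<Rightarrow> ('b \<Rightarrow> real) \<Rightarrow> 'b \<Rightarrow> real) \<Rightarrow> nat \<Rightarrow> ('b \<Rightarrow> real) \<Rightarrow> 'b \<Rightarrow> real" where
  "average C 0 v = v"
| "average C (Suc n) v = (if n = 0 then v
     else (\<lambda>x. \<Sum>k\<in>signed (Suc n). coset_vec C (Suc n) (average C n v) k x))"

text \<open>By induction the inner average is fixed by the smaller group, so
  \<open>coset_vec_action\<close> shows that a generator merely permutes the summands, along the
  bijection \<open>gen i\<close> of the index set.\<close>

lemma average_invariant:
  assumes "D_relations n C"
    and add: "\<And>i \<phi> K. i \<in> gens n \<Longrightarrow> C i (\<lambda>x. \<Sum>k\<in>K. \<phi> k x) = (\<lambda>x. \<Sum>k\<in>(K :: int set). C i (\<phi> k) x)"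
    and "i \<in> gens n"
  shows "C i (average C n v) = average C n v"
  using assms
proof (induction n arbitrary: i)
  case 0
  then show ?case by (simp add: gens_def)
next
  case (Suc n)
  then have n: "2 \<le> Suc n" and i: "i < Suc n" by (auto simp: gens_def split: if_splits)
  have fixed: "C j (average C n v) = average C n v" if "j \<in> gens n" for j
    by (rule Suc.IH) (use that gens_mono[of n "Suc n"] in \<open>auto intro: D_relations_mono[OF Suc.prems(1)] Suc.prems(2)\<close>)
  let ?x = "coset_vec C (Suc n) (average C n v)"
  have act: "C i (?x k) = ?x (gen i k)" if "k \<in> signed (Suc n)" for k
    by (rule D_relations.coset_vec_action[OF Suc.prems(1)]) (use n i fixed that in auto)
  have "C i (average C (Suc n) v) = (\<lambda>x. \<Sum>k\<in>signed (Suc n). C i (?x k) x)"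
    using n Suc.prems by simp
  also have "\<dots> = (\<lambda>x. \<Sum>k\<in>signed (Suc n). ?x (gen i k) x)"
    by (simp add: act)
  also have "\<dots> = (\<lambda>x. \<Sum>k\<in>signed (Suc n). ?x k x)"
    by (rule ext, rule sum.reindex_bij_betw[OF bij_betw_gen]) (rule Suc.prems)
  finally show ?case using n by simp
qed

lemma coset_pos_induct:
  assumes "P v" and "\<And>i w. i < n \<Longrightarrow> P w \<Longrightarrow> P (C i w)" and "d < n"
  shows "P (coset_pos C n v d)"
  using assms(3)
proof (induction d)
  case 0
  show ?case using assms(1) by simp
next
  case (Suc d)
  then show ?case using assms(2)[of "n - Suc d" "coset_pos C n v d"] by simp
qed

lemma coset_neg_induct:
  assumes "P v" and "\<And>i w. i < n \<Longrightarrow> P w \<Longrightarrow> P (C i w)" and "j < n"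
  shows "P (coset_neg C v j)"
  using assms(3)
proof (induction j)
  case 0
  then show ?case using assms(2)[of 0 v] assms(1) by simp
next
  case (Suc j)
  then show ?case using assms(2)[of "Suc j" "coset_neg C v j"] by simp
qed

text \<open>Used twice: with \<open>P\<close> = being equal to a fixed vector, and with
  \<open>P\<close> = being continuous in a parameter.\<close>

lemma coset_vec_induct:
  assumes "P v" and "\<And>i w. i \<in> gens n \<Longrightarrow> P w \<Longrightarrow> P (C i w)" and "k \<in> signed n" and "2 \<le> n"
  shows "P (coset_vec C n v k)"
proof -
  have g: "P (C i w)" if "i < n" "P w" for i w using assms(2,4) that by (simp add: gens_def)
  show ?thesis
    unfolding coset_vec_def using assms(1,3,4)
    by (auto simp: signed_def intro!: coset_pos_induct[where P = P] coset_neg_induct[where P = P and n = n] g)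
qed

text \<open>On a fixed vector each coset sum multiplies by its number of terms. The factor is thus
  the product of 2 k for k from 2 to n, the order of D_n; only its positivity is kept, which makes
  the average of the identity matrix invertible.\<close>

lemma average_fixed:
  assumes fixed: "\<And>i. i \<in> gens n \<Longrightarrow> C i v = v"
    and scale: "\<And>i c \<phi>. i \<in> gens n \<Longrightarrow> C i (\<lambda>x. c * \<phi> x) = (\<lambda>x. c * C i \<phi> x)"
  shows "\<exists>c>0. average C n v = (\<lambda>x. c * v x)"
  using assms
proof (induction n)
  case 0
  show ?case by (auto intro: exI[of _ 1])
next
  case (Suc n)
  have "\<exists>c>0. average C n v = (\<lambda>x. c * v x)"
    by (rule Suc.IH) (use Suc.prems gens_mono[of n "Suc n"] in auto)
  then obtain c where c: "c > 0" "average C n v = (\<lambda>x. c * v x)" by blast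
  show ?case
  proof (cases "n = 0")
    case True
    then show ?thesis by (auto intro: exI[of _ 1])
  next
    case False
    have vec: "coset_vec C (Suc n) (average C n v) k = average C n v" if "k \<in> signed (Suc n)" for k
      by (rule coset_vec_induct[where P = "\<lambda>w. w = average C n v"])
        (use False that c(2) Suc.prems in auto)
    have "card (signed (Suc n)) \<noteq> 0" using finite_signed[of "Suc n"]
      by (auto simp: signed_def card_eq_0_iff intro: exI[of _ 1])
    moreover have "average C (Suc n) v = (\<lambda>x. (card (signed (Suc n)) * c) * v x)"
      using False vec by (simp add: c(2) mult.assoc)
    ultimately show ?thesis using c(1) by (intro exI[of _ "card (signed (Suc n)) * c"]) auto
  qed
qed

text \<open>Running the construction on whole functions of t is what lets
  \<open>coset_vec_induct\<close> carry a statement about continuity in t.\<close>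

lemma coset_vec_family:
  "coset_vec (\<lambda>i W t. C t i (W t)) n V k t = coset_vec (C t) n (V t) k"
proof -
  have pos: "coset_pos (\<lambda>i W t. C t i (W t)) n V d t = coset_pos (C t) n (V t) d" for d
    by (induction d) auto
  have neg: "coset_neg (\<lambda>i W t. C t i (W t)) W d t = coset_neg (C t) (W t) d" for W d
    by (induction d) auto
  show ?thesis by (simp add: coset_vec_def pos neg)
qed

lemma average_continuous:
  assumes "\<And>i W x. i \<in> gens n \<Longrightarrow> (\<And>x. continuous_on I (\<lambda>t. W t x)) \<Longrightarrow> continuous_on I (\<lambda>t. C t i (W t) x)"
    and "\<And>x. continuous_on I (\<lambda>t. V t x)"
  shows "continuous_on I (\<lambda>t. average (C t) n (V t) x)"
  using assms
proof (induction n arbitrary: x)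
  case 0
  then show ?case by simp
next
  case (Suc n)
  have IH: "continuous_on I (\<lambda>t. average (C t) n (V t) x)" for x
    by (rule Suc.IH) (use Suc.prems gens_mono[of n "Suc n"] in auto)
  show ?case
  proof (cases "n = 0")
    case True
    then show ?thesis using Suc.prems by simp
  next
    case False
    let ?C = "\<lambda>i W t. C t i (W t)"
    have "\<forall>x. continuous_on I (\<lambda>t. coset_vec ?C (Suc n) (\<lambda>t. average (C t) n (V t)) k t x)"
      if "k \<in> signed (Suc n)" for k
      by (rule coset_vec_induct[where P = "\<lambda>W. \<forall>x. continuous_on I (\<lambda>t. W t x)"])
        (use IH Suc.prems that False in auto)
    then have "continuous_on I (\<lambda>t. coset_vec (C t) (Suc n) (average (C t) n (V t)) k x)"
      if "k \<in> signed (Suc n)" for k x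
      using that by (simp add: coset_vec_family)
    then show ?thesis using False by (auto intro!: continuous_on_sum)
  qed
qed

section \<open>Seminormal matrices\<close>

definition off_diag :: "real \<Rightarrow> real" where
  "off_diag x = sqrt (1 - 1 / x\<^sup>2)"

lemma off_diag_minus [simp]: "off_diag (- x) = off_diag x"
  by (simp add: off_diag_def)

lemma off_diag_sq: "1 \<le> \<bar>x\<bar> \<Longrightarrow> off_diag x * off_diag x = 1 - (1 / x) * (1 / x)"
proof -
  assume "1 \<le> \<bar>x\<bar>"
  then have "1 \<le> x\<^sup>2" by (metis one_le_power power2_abs)
  then have "0 \<le> 1 - 1 / x\<^sup>2" by (simp add: divide_le_eq_1)
  then show ?thesis by (simp add: off_diag_def power2_eq_square)
qed

lemma off_diag_one: "\<bar>x\<bar> = 1 \<Longrightarrow> off_diag x = 0"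
  by (auto simp: off_diag_def abs_if split: if_splits)

text \<open>Outside S the operator is the identity, so that the Coxeter relations hold for all functions.\<close>

definition sn_op :: "'a set \<Rightarrow> (nat \<Rightarrow> 'a \<Rightarrow> 'a) \<Rightarrow> (nat \<Rightarrow> 'a \<Rightarrow> real) \<Rightarrow> nat \<Rightarrow> ('a \<Rightarrow> real) \<Rightarrow> 'a \<Rightarrow> real" where
  "sn_op S g f i \<phi> T = (if T \<in> S then \<phi> T / f i T + off_diag (f i T) * \<phi> (g i T) else \<phi> T)"

definition sn_mat :: "(nat \<Rightarrow> 'a \<Rightarrow> 'a) \<Rightarrow> (nat \<Rightarrow> 'a \<Rightarrow> real) \<Rightarrow> nat \<Rightarrow> 'a \<Rightarrow> 'a \<Rightarrow> real" where
  "sn_mat g f i T T' = (if T' = T then 1 / f i T else 0) + (if T' = g i T then off_diag (f i T) else 0)"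

text \<open>\<open>g\<close> satisfies the relations on the whole type, while \<open>S\<close> has
  to be closed only where the coefficient \<open>off_diag (f i T)\<close> can be nonzero. Since
  \<open>g i T\<close> may lie outside \<open>S\<close>, \<open>f_linked_nonzero\<close> is not a
  consequence of \<open>f_ge_1\<close>, yet 1 / (f i T + f j T) enters the braid relation.\<close>

locale seminormal_system =
  fixes n :: nat and S :: "'a set" and g :: "nat \<Rightarrow> 'a \<Rightarrow> 'a" and f :: "nat \<Rightarrow> 'a \<Rightarrow> real"
  assumes finite_S: "finite S"
    and f_ge_1: "i \<in> gens n \<Longrightarrow> T \<in> S \<Longrightarrow> 1 \<le> \<bar>f i T\<bar>"
    and g_closed: "i \<in> gens n \<Longrightarrow> T \<in> S \<Longrightarrow> \<bar>f i T\<bar> \<noteq> 1 \<Longrightarrow> g i T \<in> S"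
    and g_relations: "D_relations n g"
    and f_self: "i \<in> gens n \<Longrightarrow> T \<in> S \<Longrightarrow> f i (g i T) = - f i T"
    and f_comm: "i \<in> gens n \<Longrightarrow> j \<in> gens n \<Longrightarrow> i \<noteq> j \<Longrightarrow> \<not> linked i j \<Longrightarrow> T \<in> S \<Longrightarrow> f j (g i T) = f j T"
    and f_linked: "i \<in> gens n \<Longrightarrow> j \<in> gens n \<Longrightarrow> linked i j \<Longrightarrow> T \<in> S \<Longrightarrow> f j (g i T) = f i T + f j T"
    and f_linked_nonzero: "i \<in> gens n \<Longrightarrow> j \<in> gens n \<Longrightarrow> linked i j \<Longrightarrow> T \<in> S \<Longrightarrow> f i T + f j T \<noteq> 0"
begin

interpretation G: D_relations n g by (rule g_relations)

abbreviation "A \<equiv> sn_op S g f"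

text \<open>If \<open>g i T\<close> lies outside \<open>S\<close>, where \<open>A j\<close> is the
  identity, then the prefactor is 0; under this prefactor the formula for \<open>A j\<close> may
  therefore always be used.\<close>

lemma off_diag_op:
  assumes "i \<in> gens n" "T \<in> S"
  shows "off_diag (f i T) * A j \<phi> (g i T) =
     off_diag (f i T) * (\<phi> (g i T) / f j (g i T) + off_diag (f j (g i T)) * \<phi> (g j (g i T)))"
proof (cases "\<bar>f i T\<bar> = 1")
  case True
  then show ?thesis by (simp add: off_diag_one)
next
  case False
  then show ?thesis using g_closed[OF assms] by (simp add: sn_op_def)
qed

lemma op_invol:
  assumes i: "i \<in> gens n"
  shows "A i (A i \<phi>) = \<phi>"
proof
  fix T
  show "A i (A i \<phi>) T = \<phi> T"
  proof (cases "T \<in> S")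
    case False
    then show ?thesis by (simp add: sn_op_def)
  next
    case T: True
    \<comment> \<open>On T and \<open>g i T\<close> the operator is the reflection with rows (x, s)
      and (s, -x), where x^2 + s^2 = 1.\<close>
    define x where "x = 1 / f i T"
    define s where "s = off_diag (f i T)"
    have "A i (A i \<phi>) T = A i \<phi> T * x + s * A i \<phi> (g i T)"
      using T by (simp add: sn_op_def x_def s_def)
    also have "s * A i \<phi> (g i T) = s * (- \<phi> (g i T) * x + s * \<phi> T)"
      unfolding s_def off_diag_op[OF i T] by (simp add: f_self[OF i T] G.invol[OF i] x_def)
    also have "A i \<phi> T = \<phi> T * x + s * \<phi> (g i T)" 
      using T by (simp add: sn_op_def x_def s_def)
    also have "(\<phi> T * x + s * \<phi> (g i T)) * x + s * (- \<phi> (g i T) * x + s * \<phi> T) = (x * x + s * s) * \<phi> T"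
      by (simp add: algebra_simps)
    also have "s * s = 1 - x * x" unfolding s_def x_def by (rule off_diag_sq[OF f_ge_1[OF i T]])
    finally show ?thesis by simp
  qed
qed

lemma op_op:
  assumes i: "i \<in> gens n" and j: "j \<in> gens n" and T: "T \<in> S" and ij: "i \<noteq> j" "\<not> linked i j"
  shows "A i (A j \<phi>) T = \<phi> T / f i T / f j T + off_diag (f j T) / f i T * \<phi> (g j T) 
    + off_diag (f i T) / f j T * \<phi> (g i T) + off_diag (f i T) * off_diag (f j T) * \<phi> (g j (g i T))"
proof -
  have "A i (A j \<phi>) T = A j \<phi> T / f i T + off_diag (f i T) * A j \<phi> (g i T)"
    using T by (simp add: sn_op_def)
  also have "off_diag (f i T) * A j \<phi> (g i T) = off_diag (f i T) * (\<phi> (g i T) / f j T + off_diag (f j T) * \<phi> (g j (g i T)))"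
    unfolding off_diag_op[OF i T] by (simp add: f_comm[OF i j ij T])
  also have "A j \<phi> T = \<phi> T / f j T + off_diag (f j T) * \<phi> (g j T)"
    using T by (simp add: sn_op_def)
  finally show ?thesis by (simp add: algebra_simps add_divide_distrib)
qed

lemma op_comm:
  assumes i: "i \<in> gens n" and j: "j \<in> gens n" and ij: "\<not> linked i j"
  shows "A i (A j \<phi>) = A j (A i \<phi>)"
proof (cases "i = j")
  case False
  have ji: "\<not> linked j i" using ij linked_sym by blast
  show ?thesis
  proof
    fix T
    show "A i (A j \<phi>) T = A j (A i \<phi>) T"
    proof (cases "T \<in> S")
      case True
      then show ?thesis
        unfolding op_op[OF i j True False ij] op_op[OF j i True False[symmetric] ji] G.comm[OF i j ij]
        by (simp add: algebra_simps)
    qed (simp add: sn_op_def)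
  qed
qed simp

text \<open>One coefficient for each of the six elements of the group generated by i and j. The
  values of f met on the way are, up to sign, a, b and a + b, like the positive roots of type
  A_2.\<close>

lemma op_op_op:
  assumes i: "i \<in> gens n" and j: "j \<in> gens n" and T: "T \<in> S" and ij: "linked i j"
  defines "a \<equiv> f i T" and "b \<equiv> f j T"
  shows "A i (A j (A i \<phi>)) T =
      \<phi> T * ((1/a) * (1/a) * (1/b) + off_diag a * off_diag a * (1/(a+b)))
    + \<phi> (g i T) * (off_diag a * ((1/a) * (1/b) - (1/a) * (1/(a+b))))
    + \<phi> (g j T) * (off_diag b * ((1/a) * (1/(a+b))))
    + \<phi> (g i (g j T)) * ((1/a) * off_diag b * off_diag (a+b))
    + \<phi> (g j (g i T)) * ((1/b) * off_diag a * off_diag (a+b))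
    + \<phi> (g i (g j (g i T))) * (off_diag a * off_diag b * off_diag (a+b))"
proof -
  have ji: "linked j i" using ij linked_sym by blast
  have fj: "f j (g i T) = a + b" using f_linked[OF i j ij T] by (simp add: a_def b_def)
  have fi: "f i (g j T) = a + b" using f_linked[OF j i ji T] by (simp add: a_def b_def)
  \<comment> \<open>\<open>off_diag_op\<close> at \<open>g i T\<close> requires \<open>g i T\<close>
    to be in \<open>S\<close>; if |a| = 1, both sides vanish anyway.\<close>
  have far: "off_diag a * (off_diag (a+b) * A i \<phi> (g j (g i T)))
      = off_diag a * (off_diag (a+b) * (\<phi> (g j (g i T)) / b + off_diag b * \<phi> (g i (g j (g i T)))))"
  proof (cases "\<bar>a\<bar> = 1")
    case True
    then show ?thesis by (simp add: off_diag_one)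
  next
    case False
    then have gT: "g i T \<in> S" using g_closed[OF i T] by (simp add: a_def)
    have "f i (g j (g i T)) = b"
      using f_linked[OF j i ji gT] fj f_self[OF i T] by (simp add: a_def)
    then show ?thesis using off_diag_op[OF j gT, of i \<phi>] by (simp add: fj)
  qed
  have "A i (A j (A i \<phi>)) T = A j (A i \<phi>) T / a + off_diag a * A j (A i \<phi>) (g i T)"
    using T by (simp add: sn_op_def a_def)
  also have "off_diag a * A j (A i \<phi>) (g i T) = 
      off_diag a * A i \<phi> (g i T) / (a+b) + off_diag a * (off_diag (a+b) * A i \<phi> (g j (g i T)))"
    using off_diag_op[OF i T, of j "A i \<phi>"] unfolding fj a_def[symmetric] by (simp add: algebra_simps)
  also have "off_diag a * A i \<phi> (g i T) = off_diag a * (\<phi> (g i T) / (-a) + off_diag a * \<phi> T)"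
    unfolding a_def off_diag_op[OF i T] f_self[OF i T] by (simp add: G.invol[OF i])
  also have "A j (A i \<phi>) T = A i \<phi> T / b + off_diag b * A i \<phi> (g j T)"
    using T by (simp add: sn_op_def b_def)
  also have "off_diag b * A i \<phi> (g j T) = off_diag b * (\<phi> (g j T) / (a+b) + off_diag (a+b) * \<phi> (g i (g j T)))"
    unfolding b_def off_diag_op[OF j T] fi[unfolded b_def] ..
  also have "A i \<phi> T = \<phi> T / a + off_diag a * \<phi> (g i T)"
    using T by (simp add: sn_op_def a_def)
  finally show ?thesis unfolding far by (simp add: algebra_simps add_divide_distrib diff_divide_distrib)
qed

lemma op_braid:
  assumes i: "i \<in> gens n" and j: "j \<in> gens n" and ij: "linked i j"
  shows "A i (A j (A i \<phi>)) = A j (A i (A j \<phi>))"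
proof
  have ji: "linked j i" using ij linked_sym by blast
  fix T
  show "A i (A j (A i \<phi>)) T = A j (A i (A j \<phi>)) T"
  proof (cases "T \<in> S")
    case T: True
    define a b where "a = f i T" and "b = f j T"
    define x y z where "x = 1 / a" and "y = 1 / b" and "z = 1 / (a + b)"
    have nz: "a \<noteq> 0" "b \<noteq> 0" "a + b \<noteq> 0"
      using f_ge_1[OF i T] f_ge_1[OF j T] f_linked_nonzero[OF i j ij T] by (auto simp: a_def b_def)
    \<comment> \<open>The partial fraction identity 1/(a b) = (1/a + 1/b) / (a + b); together with
      the squares of the off-diagonal coefficients it settles the comparison of
      coefficients.\<close>
    then have xyz: "x * y = x * z + y * z"
      by (simp add: x_def y_def z_def divide_simps)
    have sa: "off_diag a * off_diag a = 1 - x * x" and sb: "off_diag b * off_diag b = 1 - y * y"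
      using off_diag_sq f_ge_1[OF i T] f_ge_1[OF j T] by (auto simp: a_def b_def x_def y_def)
    have c0: "x * x * y + (1 - x * x) * z = y * y * x + (1 - y * y) * z"
    proof -
      have "x * x * y - y * y * x = (x - y) * (x * y)" by (simp add: algebra_simps)
      also have "\<dots> = (x * x - y * y) * z" unfolding xyz by (simp add: algebra_simps)
      finally show ?thesis by (simp add: algebra_simps)
    qed
    have c1: "x * y - x * z = y * z" and c2: "y * x - y * z = x * z"
      using xyz by (simp_all add: algebra_simps)
    have b: "g i (g j (g i T)) = g j (g i (g j T))" by (rule G.braid[OF i j ij])
    have "A i (A j (A i \<phi>)) T =
      \<phi> T * (x * x * y + (1 - x * x) * z) + \<phi> (g i T) * (off_diag a * (x * y - x * z))
    + \<phi> (g j T) * (off_diag b * (x * z))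
    + \<phi> (g i (g j T)) * (x * off_diag b * off_diag (a+b))
    + \<phi> (g j (g i T)) * (y * off_diag a * off_diag (a+b))
    + \<phi> (g i (g j (g i T))) * (off_diag a * off_diag b * off_diag (a+b))"
      using op_op_op[OF i j T ij, of \<phi>, folded a_def b_def, folded x_def y_def z_def] unfolding sa .
    moreover have "A j (A i (A j \<phi>)) T =
      \<phi> T * (y * y * x + (1 - y * y) * z) + \<phi> (g j T) * (off_diag b * (y * x - y * z))
    + \<phi> (g i T) * (off_diag a * (y * z))
    + \<phi> (g j (g i T)) * (y * off_diag a * off_diag (a+b))
    + \<phi> (g i (g j T)) * (x * off_diag b * off_diag (a+b))
    + \<phi> (g j (g i (g j T))) * (off_diag b * off_diag a * off_diag (a+b))"
      using op_op_op[OF j i T ji, of \<phi>, folded a_def b_def, unfolded add.commute[of b a], folded x_def y_def z_def]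
      unfolding sb .
    ultimately show ?thesis unfolding c0 c1 c2 b by (simp add: algebra_simps)
  qed (simp add: sn_op_def)
qed

lemma op_relations: "D_relations n A"
  by unfold_locales (simp add: op_invol, erule (2) op_comm, erule (2) op_braid)

lemma sum_mat_left:
  assumes i: "i \<in> gens n" and T: "T \<in> S"
  shows "(\<Sum>x\<in>S. sn_mat g f i T x * \<phi> x) = A i \<phi> T"
proof -
  have "(\<Sum>x\<in>S. sn_mat g f i T x * \<phi> x) =
      (\<Sum>x\<in>S. if x = T then \<phi> x / f i T else 0) + (\<Sum>x\<in>S. if x = g i T then off_diag (f i T) * \<phi> x else 0)"
    unfolding sum.distrib[symmetric] by (rule sum.cong) (auto simp: sn_mat_def algebra_simps)
  also have "\<dots> = A i \<phi> T"
    using finite_S T off_diag_one g_closed[OF i T] by (auto simp: sn_op_def)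
  finally show ?thesis .
qed

text \<open>The matrix is symmetric, since \<open>g i\<close> is an involution that only changes the
  sign of f; hence columns give the same operator as rows.\<close>

lemma sum_mat_right:
  assumes i: "i \<in> gens n" and T: "T \<in> S"
  shows "(\<Sum>x\<in>S. \<phi> x * sn_mat g f i x T) = A i \<phi> T"
proof -
  have "\<phi> x * sn_mat g f i x T = (if x = T then \<phi> x / f i T else 0) + (if x = g i T then off_diag (f i T) * \<phi> x else 0)"
    if "x \<in> S" for x
  proof -
    have "T = g i x \<longleftrightarrow> x = g i T" using G.invol[OF i] by metis
    moreover have "off_diag (f i x) = off_diag (f i T)" if "x = g i T" using f_self[OF i T] that by simp
    ultimately show ?thesis by (auto simp: sn_mat_def algebra_simps)
  qed
  then have "(\<Sum>x\<in>S. \<phi> x * sn_mat g f i x T) =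
      (\<Sum>x\<in>S. if x = T then \<phi> x / f i T else 0) + (\<Sum>x\<in>S. if x = g i T then off_diag (f i T) * \<phi> x else 0)"
    unfolding sum.distrib[symmetric] by (rule sum.cong[OF refl])
  also have "\<dots> = A i \<phi> T"
    using finite_S T off_diag_one g_closed[OF i T] by (auto simp: sn_op_def)
  finally show ?thesis .
qed

end

section \<open>Continuous families of seminormal representations\<close>

definition left_op :: "(('a \<Rightarrow> real) \<Rightarrow> 'a \<Rightarrow> real) \<Rightarrow> ('a \<times> 'b \<Rightarrow> real) \<Rightarrow> 'a \<times> 'b \<Rightarrow> real" where
  "left_op A \<phi> = (\<lambda>(x, y). A (\<lambda>x'. \<phi> (x', y)) x)"

definition right_op :: "(('b \<Rightarrow> real) \<Rightarrow> 'b \<Rightarrow> real) \<Rightarrow> ('a \<times> 'b \<Rightarrow> real) \<Rightarrow> 'a \<times> 'b \<Rightarrow> real" where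
  "right_op B \<phi> = (\<lambda>(x, y). B (\<lambda>y'. \<phi> (x, y')) y)"

lemma left_op_relations:
  assumes "D_relations n A"
  shows "D_relations n (\<lambda>i. left_op (A i))"
proof -
  interpret D_relations n A by fact
  show ?thesis
    by unfold_locales (auto simp: left_op_def invol comm braid fun_eq_iff intro!: fun_cong[OF comm] fun_cong[OF braid])
qed

lemma right_op_relations:
  assumes "D_relations n A"
  shows "D_relations n (\<lambda>i. right_op (A i))"
proof -
  interpret D_relations n A by fact
  show ?thesis
    by unfold_locales (auto simp: right_op_def invol comm braid fun_eq_iff intro!: fun_cong[OF comm] fun_cong[OF braid])
qed

lemma left_right_commute:
  "left_op (sn_op S g f i) (right_op (sn_op S g f' j) \<phi>) = right_op (sn_op S g f' j) (left_op (sn_op S g f i) \<phi>)"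
  by (auto simp: fun_eq_iff left_op_def right_op_def sn_op_def algebra_simps add_divide_distrib)

text \<open>All L can be moved in front of all R, after which each relation holds in both halves
  separately.\<close>

lemma D_relations_comp:
  assumes "D_relations n L" "D_relations n R" and c: "\<And>i j v. L i (R j v) = R j (L i v)"
  shows "D_relations n (\<lambda>i v. L i (R i v))"
proof -
  interpret L: D_relations n L by fact
  interpret R: D_relations n R by fact
  show ?thesis
  proof
    fix i v assume i: "i \<in> gens n"
    show "L i (R i (L i (R i v))) = v" unfolding c[symmetric, of i i] by (simp add: L.invol[OF i] R.invol[OF i])
  next
    fix i j v assume i: "i \<in> gens n" and j: "j \<in> gens n" and ij: "\<not> linked i j"
    have "L i (R i (L j (R j v))) = L i (L j (R i (R j v)))" by (simp only: c)
    also have "\<dots> = L j (L i (R j (R i v)))" unfolding L.comm[OF i j ij] R.comm[OF i j ij] ..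
    finally show "L i (R i (L j (R j v))) = L j (R j (L i (R i v)))" by (simp only: c)
  next
    fix i j v assume i: "i \<in> gens n" and j: "j \<in> gens n" and ij: "linked i j"
    have "L i (R i (L j (R j (L i (R i v))))) = L i (L j (L i (R i (R j (R i v)))))" by (simp only: c)
    also have "\<dots> = L j (L i (L j (R j (R i (R j v)))))" unfolding L.braid[OF i j ij] R.braid[OF i j ij] ..
    finally show "L i (R i (L j (R j (L i (R i v))))) = L j (R j (L i (R i (L j (R j v)))))" by (simp only: c)
  qed
qed

text \<open>conj_op conjugates a matrix by the generator i in the representations given by f (from the left) and f'
  (from the right); its invariants are the intertwiners.\<close>

definition conj_op :: "'a set \<Rightarrow> (nat \<Rightarrow> 'a \<Rightarrow> 'a) \<Rightarrow> (nat \<Rightarrow> 'a \<Rightarrow> real) \<Rightarrow> (nat \<Rightarrow> 'a \<Rightarrow> real)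
    \<Rightarrow> nat \<Rightarrow> ('a \<times> 'a \<Rightarrow> real) \<Rightarrow> 'a \<times> 'a \<Rightarrow> real" where
  "conj_op S g f f' i \<phi> = left_op (sn_op S g f i) (right_op (sn_op S g f' i) \<phi>)"

lemma conj_op_sum:
  "conj_op S g f f' i (\<lambda>x. \<Sum>k\<in>K. \<phi> k x) = (\<lambda>x. \<Sum>k\<in>K. conj_op S g f f' i (\<phi> k) x)"
proof -
  have A: "sn_op S g f i (\<lambda>x. \<Sum>k\<in>K. \<phi> k x) T = (\<Sum>k\<in>K. sn_op S g f i (\<phi> k) T)" for f T and \<phi> :: "_ \<Rightarrow> 'a \<Rightarrow> real"
    by (simp add: sn_op_def sum.distrib sum_divide_distrib sum_distrib_left)
  show ?thesis by (auto simp: conj_op_def left_op_def right_op_def A fun_eq_iff)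
qed

lemma conj_op_scale:
  "conj_op S g f f' i (\<lambda>x. c * \<phi> x) = (\<lambda>x. c * conj_op S g f f' i \<phi> x)"
proof -
  have A: "sn_op S g f i (\<lambda>x. c * \<phi> x) T = c * sn_op S g f i \<phi> T" for f T and \<phi> :: "'a \<Rightarrow> real"
    by (simp add: sn_op_def algebra_simps)
  show ?thesis by (auto simp: conj_op_def left_op_def right_op_def A fun_eq_iff)
qed

text \<open>By symmetry of the matrix, acting on the second index of the identity matrix is the same
  as acting on the first, and acting twice on the first index gives it back.\<close>

lemma (in seminormal_system) conj_op_delta:
  assumes i: "i \<in> gens n"
  shows "conj_op S g f f i (\<lambda>(x, y). if x = y then 1 else 0) = (\<lambda>(x, y). if x = y then 1 else 0)"
proof -
  interpret G: D_relations n g by (rule g_relations)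
  have "sn_op S g f i (\<lambda>y'. if x = y' then 1 else 0) y = sn_op S g f i (\<lambda>x'. if x' = y then 1 else 0) x" for x y
  proof -
    have eq: "x = g i y \<longleftrightarrow> g i x = y" using G.invol[OF i] by metis
    \<comment> \<open>Covers the case that exactly one of two tableaux exchanged by
      \<open>g i\<close> lies in \<open>S\<close>.\<close>
    have "off_diag (f i y) = 0" if "y \<in> S" "g i y \<notin> S" for y
      using that g_closed[OF i] off_diag_one by blast
    moreover have "off_diag (f i (g i y)) = off_diag (f i y)" if "y \<in> S" for y
      using f_self[OF i that] by simp
    ultimately show ?thesis using eq by (auto simp: sn_op_def)
  qed
  then show ?thesis
    by (auto simp: conj_op_def left_op_def right_op_def fun_eq_iff op_invol[OF i])
qed

text \<open>Passage from matrices indexed by 0, ..., N - 1, for which determinants are available, to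
  matrices indexed by \<open>S\<close>.\<close>

lemma inverse_on_finite_set:
  fixes M :: "'a \<Rightarrow> 'a \<Rightarrow> real"
  assumes e: "bij_betw e {0..<N} S" and det: "det (mat N N (\<lambda>(p, q). M (e p) (e q))) \<noteq> 0"
  shows "\<exists>Q. (\<forall>x\<in>S. \<forall>x'\<in>S. (\<Sum>y\<in>S. M x y * Q y x') = (if x = x' then 1 else 0)) \<and>
             (\<forall>x\<in>S. \<forall>x'\<in>S. (\<Sum>y\<in>S. Q x y * M y x') = (if x = x' then 1 else 0))"
proof -
  define A where "A = mat N N (\<lambda>(p, q). M (e p) (e q))"
  have A: "A \<in> carrier_mat N N" by (simp add: A_def)
  from det_non_zero_imp_unit[OF A, of "()"] det
  obtain B where B: "B \<in> carrier_mat N N" "A * B = 1\<^sub>m N" "B * A = 1\<^sub>m N"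
    unfolding A_def[symmetric] Units_def ring_mat_def by auto
  define h where "h = the_inv_into {0..<N} e"
  have he: "h (e p) = p" if "p < N" for p
    using e that by (simp add: h_def bij_betw_def the_inv_into_f_f)
  have eh: "\<exists>p<N. x = e p" if "x \<in> S" for x using e that by (auto simp: bij_betw_def)
  have re: "(\<Sum>y\<in>S. F y) = (\<Sum>p = 0..<N. F (e p))" for F :: "'a \<Rightarrow> real"
    using sum.reindex_bij_betw[OF e] by metis
  have inj: "e p = e q \<longleftrightarrow> p = q" if "p < N" "q < N" for p q using he that by metis
  have 1: "(\<Sum>p = 0..<N. M (e a) (e p) * B $$ (p, b)) = (if a = b then 1 else 0)" if "a < N" "b < N" for a b
  proof -
    have "(A * B) $$ (a, b) = (\<Sum>p = 0..<N. M (e a) (e p) * B $$ (p, b))"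
      using that B(1) A by (simp add: scalar_prod_def) (simp add: A_def)
    then show ?thesis using that B(2) by simp
  qed
  have 2: "(\<Sum>p = 0..<N. B $$ (a, p) * M (e p) (e b)) = (if a = b then 1 else 0)" if "a < N" "b < N" for a b
  proof -
    have "(B * A) $$ (a, b) = (\<Sum>p = 0..<N. B $$ (a, p) * M (e p) (e b))"
      using that B(1) A by (simp add: scalar_prod_def) (simp add: A_def)
    then show ?thesis using that B(3) by simp
  qed
  show ?thesis
  proof (intro exI[of _ "\<lambda>x y. B $$ (h x, h y)"] conjI ballI)
    fix x x' assume "x \<in> S" "x' \<in> S"
    then obtain p q where "p < N" "x = e p" "q < N" "x' = e q" using eh by metis
    then show "(\<Sum>y\<in>S. M x y * B $$ (h y, h x')) = (if x = x' then 1 else 0)"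
      "(\<Sum>y\<in>S. B $$ (h x, h y) * M y x') = (if x = x' then 1 else 0)"
      unfolding re using 1[of p q] 2[of p q] by (simp_all add: he inj)
  qed
qed

locale seminormal_family =
  fixes n :: nat and S :: "'a set" and g :: "nat \<Rightarrow> 'a \<Rightarrow> 'a" and f :: "real \<Rightarrow> nat \<Rightarrow> 'a \<Rightarrow> real" and I :: "real set"
  assumes system: "t \<in> I \<Longrightarrow> seminormal_system n S g (f t)"
    and f_cont: "i \<in> gens n \<Longrightarrow> T \<in> S \<Longrightarrow> continuous_on I (\<lambda>t. f t i T)"
begin

lemma op_continuous:
  assumes i: "i \<in> gens n" and W: "\<And>T. continuous_on I (\<lambda>t. W t T)"
  shows "continuous_on I (\<lambda>t. sn_op S g (f t) i (W t) T)"
proof (cases "T \<in> S")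
  case True
  have "f t i T \<noteq> 0" if "t \<in> I" for t
    using seminormal_system.f_ge_1[OF system[OF that] i True] by auto
  then show ?thesis
    using True by (auto simp: sn_op_def off_diag_def intro!: continuous_intros W f_cont[OF i])
qed (simp add: sn_op_def W)

lemma locally_iso:
  assumes t: "t \<in> I"
  shows "\<exists>d>0. \<forall>t'\<in>I. \<bar>t' - t\<bar> < d \<longrightarrow> rep_iso n (S, sn_mat g (f t)) (S, sn_mat g (f t'))"
proof -
  interpret T: seminormal_system n S g "f t" by (rule system[OF t])
  \<comment> \<open>The average of the identity matrix, with the representation at t acting from the
    left and the one at t' from the right.\<close>
  define M where "M t' = average (conj_op S g (f t) (f t')) n (\<lambda>(x, y). if x = y then 1 else 0)" for t'
  obtain e where e: "bij_betw e {0..<card S} S" using ex_bij_betw_nat_finite[OF T.finite_S] by blast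
  define N where "N = card S"
  have e: "bij_betw e {0..<N} S" using e by (simp add: N_def)
  define B where "B t' = mat N N (\<lambda>(p, q). M t' (e p, e q))" for t'
  have B: "B t' \<in> carrier_mat N N" for t' by (simp add: B_def)
  have contM: "continuous_on I (\<lambda>t'. M t' z)" for z
    unfolding M_def
  proof (rule average_continuous)
    fix i and z :: "'a \<times> 'a" and W :: "real \<Rightarrow> 'a \<times> 'a \<Rightarrow> real"
    assume i: "i \<in> gens n" and W: "\<And>x. continuous_on I (\<lambda>t. W t x)"
    have R: "continuous_on I (\<lambda>t'. right_op (sn_op S g (f t') i) (W t') z)" for z
      by (cases z) (simp add: right_op_def op_continuous[OF i] W)
    have L: "continuous_on I (\<lambda>t'. left_op (sn_op S g (f t) i) (V t') z)"
      if "\<And>z. continuous_on I (\<lambda>t'. V t' z)" for V :: "real \<Rightarrow> 'a \<times> 'a \<Rightarrow> real"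
    proof (cases z)
      case (Pair x y)
      have "f t i x \<noteq> 0" if "x \<in> S" using T.f_ge_1[OF i that] by auto
      then show ?thesis
        using Pair that by (cases "x \<in> S") (auto simp: left_op_def sn_op_def intro!: continuous_intros)
    qed
    show "continuous_on I (\<lambda>t'. conj_op S g (f t) (f t') i (W t') z)"
      unfolding conj_op_def by (rule L[OF R])
  qed simp
  have "continuous_on I (\<lambda>t'. B t' $$ (i, p i))" if "p permutes {0..<N}" "i \<in> {0..<N}" for p i
    using permutes_in_image[OF that(1), of i] that(2) by (simp add: B_def contM)
  \<comment> \<open>By the Leibniz formula the determinant is a polynomial in the entries.\<close>
  then have "continuous_on I (\<lambda>t'. det (B t'))"
    unfolding det_def'[OF B] by (intro continuous_intros) auto
  moreover have "det (B t) \<noteq> 0"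
  proof -
    obtain c where c: "c > 0" "M t = (\<lambda>x. c * (case x of (x, y) \<Rightarrow> if x = y then 1 else 0))"
      using average_fixed[of n "conj_op S g (f t) (f t)", OF T.conj_op_delta conj_op_scale]
      unfolding M_def by blast
    have "B t = c \<cdot>\<^sub>m 1\<^sub>m N"
      using e by (auto simp: B_def c(2) bij_betw_def inj_on_def)
    then show ?thesis using c(1) by simp
  qed
  ultimately have "\<forall>\<^sub>F t' in at t within I. det (B t') \<noteq> 0"
    using t by (auto simp: continuous_on_def intro: tendsto_imp_eventually_ne)
  then obtain d where d: "d > 0" "\<And>t'. t' \<in> I \<Longrightarrow> \<bar>t' - t\<bar> < d \<Longrightarrow> det (B t') \<noteq> 0"
    using \<open>det (B t) \<noteq> 0\<close> unfolding eventually_at dist_real_def by metis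
  have "rep_iso n (S, sn_mat g (f t)) (S, sn_mat g (f t'))" if t': "t' \<in> I" "\<bar>t' - t\<bar> < d" for t'
  proof -
    interpret T': seminormal_system n S g "f t'" by (rule system[OF t'(1)])
    let ?L = "\<lambda>i. left_op (sn_op S g (f t) i)" and ?R = "\<lambda>i. right_op (sn_op S g (f t') i)"
    have rel: "D_relations n (conj_op S g (f t) (f t'))"
      unfolding conj_op_def[abs_def]
      by (rule D_relations_comp[where L = ?L and R = ?R, OF left_op_relations[OF T.op_relations] right_op_relations[OF T'.op_relations] left_right_commute])
    have inv: "?L i (M t') = ?R i (M t')" if i: "i \<in> gens n" for i
    proof -
      have "?L i (?R i (M t')) = M t'"
        unfolding M_def conj_op_def[symmetric] by (rule average_invariant[OF rel _ i]) (rule conj_op_sum)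
      \<comment> \<open>Invariance reads L (R M) = M; as L is an involution, R M = L M, which is the
        intertwining relation.\<close>
      then show ?thesis using D_relations.invol[OF left_op_relations[OF T.op_relations] i] by metis
    qed
    obtain Q where Q: "\<forall>x\<in>S. \<forall>x'\<in>S. (\<Sum>y\<in>S. M t' (x, y) * Q y x') = (if x = x' then 1 else 0)"
      "\<forall>x\<in>S. \<forall>x'\<in>S. (\<Sum>y\<in>S. Q x y * M t' (y, x')) = (if x = x' then 1 else 0)"
      using inverse_on_finite_set[OF e, of "\<lambda>x y. M t' (x, y)"] d(2)[OF t'] by (auto simp: B_def)
    show ?thesis
      unfolding rep_iso_def fst_conv snd_conv
    proof (rule exI[of _ "\<lambda>x y. M t' (x, y)"], rule exI[of _ Q], intro conjI ballI)
      fix i x y assume i: "i \<in> gens n" and xy: "x \<in> S" "y \<in> S"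
      show "(\<Sum>x'\<in>S. sn_mat g (f t) i x x' * M t' (x', y)) = (\<Sum>y'\<in>S. M t' (x, y') * sn_mat g (f t') i y' y)"
        unfolding T.sum_mat_left[OF i xy(1)] T'.sum_mat_right[OF i xy(2)]
        using inv[OF i, THEN fun_cong, of "(x, y)"] by (simp add: left_op_def right_op_def)
    qed (use Q in auto)
  qed
  then show ?thesis using d(1) by blast
qed

end

text \<open>Two points on either side of x and close to it are compared by passing through x;
  \<open>Bolzano\<close> chains these comparisons along the interval.\<close>

lemma seminormal_family_iso:
  fixes a b :: real
  assumes "a \<le> b" and fam: "seminormal_family n S g f {a..b}"
  shows "rep_iso n (S, sn_mat g (f a)) (S, sn_mat g (f b))"
proof -
  interpret seminormal_family n S g f "{a..b}" by (rule fam)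
  have fin: "finite S" using seminormal_system.finite_S[OF system[of a]] assms(1) by simp
  \<comment> \<open>The two guards are there because \<open>Bolzano\<close> also tests short
    intervals that stick out of \<open>{a..b}\<close>.\<close>
  define P where "P c d \<longleftrightarrow> (a \<le> c \<longrightarrow> d \<le> b \<longrightarrow> rep_iso n (S, sn_mat g (f c)) (S, sn_mat g (f d)))" for c d
  have "P a b"
    using assms(1)
  proof (induction rule: Bolzano)
    case (trans c d e)
    then show ?case unfolding P_def using rep_iso_trans fin by fastforce
  next
    case (local x)
    then obtain d where d: "d > 0"
      "\<And>t'. t' \<in> {a..b} \<Longrightarrow> \<bar>t' - x\<bar> < d \<Longrightarrow> rep_iso n (S, sn_mat g (f x)) (S, sn_mat g (f t'))"
      using locally_iso[of x] by auto
    show ?case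
    proof (intro exI[of _ d] conjI allI impI d(1))
      fix c e assume ce: "c \<le> x \<and> x \<le> e \<and> e - c < d"
      show "P c e"
        unfolding P_def
      proof (intro impI)
        assume "a \<le> c" "e \<le> b"
        then have 1: "rep_iso n (S, sn_mat g (f x)) (S, sn_mat g (f c))"
          and 2: "rep_iso n (S, sn_mat g (f x)) (S, sn_mat g (f e))"
          using ce local by (auto intro!: d(2))
        show "rep_iso n (S, sn_mat g (f c)) (S, sn_mat g (f e))"
          by (rule rep_iso_trans[OF rep_iso_sym[OF 1] 2]) (simp_all add: fin)
      qed
    qed
  qed
  then show ?thesis by (simp add: P_def)
qed

section \<open>Signed tableaux with shifted contents\<close>

lemma gen_minus: "gen i (- k) = - gen i k"
  using lo_hi[of i] by (auto simp: gen_swap)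

text \<open>Thanks to \<open>lo 0\<close> = -1 and \<open>hi 0\<close> = 2 the edge between 0 and 2
  has the same form as the edges of the chain, and the braid relations need no case i = 0.\<close>

lemma linked_iff: "linked i j \<longleftrightarrow> hi i = lo j \<or> hi j = lo i"
  by (auto simp: linked_def hi_def lo_def)

lemma hi_eq_lo:
  assumes "hi i = lo j"
  shows "\<bar>hi j\<bar> \<noteq> \<bar>lo i\<bar>" "\<bar>hi j\<bar> \<noteq> \<bar>hi i\<bar>" "\<bar>hi i\<bar> \<noteq> \<bar>lo i\<bar>"
  using assms by (auto simp: hi_def lo_def split: if_splits)

lemma abs_neq_iff: "\<bar>a\<bar> \<noteq> \<bar>b\<bar> \<longleftrightarrow> a \<noteq> b \<and> a \<noteq> - b \<and> - a \<noteq> b" for a b :: int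
  by auto

lemma gen_braid:
  assumes "hi i = lo j"
  shows "gen i (gen j (gen i k)) = gen j (gen i (gen j k))"
proof -
  define p q w where "p = lo i" and "q = hi i" and "w = hi j"
  have i: "lo i = p" "hi i = q" "lo j = q" "hi j = w" using assms by (auto simp: p_def q_def w_def)
  have d: "w \<noteq> p" "w \<noteq> - p" "- w \<noteq> p" "w \<noteq> q" "w \<noteq> - q" "- w \<noteq> q" "q \<noteq> p" "q \<noteq> - p" "- q \<noteq> p"
    using hi_eq_lo[OF assms] unfolding i abs_neq_iff by auto
  have nz: "p \<noteq> 0" "q \<noteq> 0" "w \<noteq> 0" using lo_hi[of i] lo_hi[of j] i by auto
  note d = d d[symmetric] nz
  consider "k = p" | "k = -p" | "k = q" | "k = -q" | "k = w" | "k = -w"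
    | "k \<noteq> p" "k \<noteq> -p" "k \<noteq> q" "k \<noteq> -q" "k \<noteq> w" "k \<noteq> -w" by blast
  then show ?thesis by cases (simp_all add: gen_swap i d)
qed

text \<open>The pair 0, 1 is excluded because these two generators commute although both move +-1
  and +-2.\<close>

lemma gen_disjoint:
  assumes "i \<noteq> j" "\<not> linked i j" "\<not> (i \<le> 1 \<and> j \<le> 1)"
  shows "\<bar>hi j\<bar> \<noteq> \<bar>lo i\<bar>" "\<bar>hi j\<bar> \<noteq> \<bar>hi i\<bar>" "\<bar>lo j\<bar> \<noteq> \<bar>lo i\<bar>" "\<bar>lo j\<bar> \<noteq> \<bar>hi i\<bar>"
  using assms by (cases "i = 0"; cases "j = 0"; force simp: linked_def hi_def lo_def)+

lemma gen_comm:
  assumes "\<not> linked i j"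
  shows "gen i (gen j k) = gen j (gen i k)"
proof (cases "i = j \<or> (i \<le> 1 \<and> j \<le> 1)")
  case True
  then consider "i = j" | "i = 0" "j = 1" | "i = 1" "j = 0" by linarith
  then show ?thesis by cases (simp_all add: gen_def)
next
  case False
  define p q u w where "p = lo i" and "q = hi i" and "u = lo j" and "w = hi j"
  note i = p_def[symmetric] q_def[symmetric] u_def[symmetric] w_def[symmetric]
  have d: "w \<noteq> p" "w \<noteq> - p" "- w \<noteq> p" "w \<noteq> q" "w \<noteq> - q" "- w \<noteq> q" "u \<noteq> p" "u \<noteq> - p" "- u \<noteq> p" "u \<noteq> q" "u \<noteq> - q" "- u \<noteq> q"
    using gen_disjoint[of i j] False assms unfolding i abs_neq_iff by auto
  have nz: "p \<noteq> 0" "q \<noteq> 0" "w \<noteq> 0" "u \<noteq> 0" "p \<noteq> q" "p \<noteq> - q" "- p \<noteq> q" "u \<noteq> w" "u \<noteq> - w" "- u \<noteq> w"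
    using lo_hi[of i] lo_hi[of j] i by auto
  note d = d nz d[symmetric] nz[symmetric]
  consider "k = p" | "k = -p" | "k = q" | "k = -q" | "k = w" | "k = -w" | "k = u" | "k = -u"
    | "k \<noteq> p" "k \<noteq> -p" "k \<noteq> q" "k \<noteq> -q" "k \<noteq> w" "k \<noteq> -w" "k \<noteq> u" "k \<noteq> -u" by blast
  then show ?thesis by cases (simp_all add: gen_swap i d)
qed

lemma act_relations: "D_relations n (\<lambda>i. act (gen i))"
proof
  fix i j v assume "linked i j"
  then have "gen i (gen j (gen i k)) = gen j (gen i (gen j k))" for k
    using gen_braid[of i j k] gen_braid[of j i k] unfolding linked_iff by auto
  then show "act (gen i) (act (gen j) (act (gen i) v)) = act (gen j) (act (gen i) (act (gen j) v))"
    by (simp add: act_def image_image)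
next
  fix i j v assume "\<not> linked i j"
  then have "gen i (gen j k) = gen j (gen i k)" for k by (rule gen_comm)
  then show "act (gen i) (act (gen j) v) = act (gen j) (act (gen i) v)"
    by (simp add: act_def image_image)
qed (simp add: act_def image_image gen_invol)

lemma gen_cases:
  obtains "k = lo i" "gen i k = hi i" | "k = hi i" "gen i k = lo i" | "k = - lo i" "gen i k = - hi i"
   | "k = - hi i" "gen i k = - lo i" | "k \<noteq> lo i" "k \<noteq> hi i" "k \<noteq> - lo i" "k \<noteq> - hi i" "gen i k = k"
  using lo_hi[of i] by (auto simp: gen_swap split: if_splits)

text \<open>Only i = 0 leaves a nonzero number in between: 1, lying between -1 and 2.\<close>

lemma lo_hi_between:
  assumes "lo i < k" "k < hi i" "k \<noteq> 0" 
  shows "\<bar>k\<bar> = \<bar>lo i\<bar>"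
  using assms by (auto simp: lo_def hi_def split: if_splits)

text \<open>Apart from 0 and \<open>- lo i\<close>, no number lies between \<open>lo i\<close> and
  \<open>hi i\<close>. So a generator can reverse only this pair or its negative, provided the two
  absolute values differ, as they do for entries of distinct boxes of a signed filling.\<close>

lemma gen_order:
  assumes xy: "x < y" and "\<bar>x\<bar> \<noteq> \<bar>y\<bar>" "x \<noteq> 0" "y \<noteq> 0" and ng: "\<not> gen i x < gen i y"
  shows "(x = lo i \<and> y = hi i) \<or> (x = - hi i \<and> y = - lo i)"
proof -
  have ne: "x \<noteq> - y" "- x \<noteq> y" using assms(2) by auto
  have lb: "lo i < hi i" using lo_hi by simp
  have b1: "lo i < k \<Longrightarrow> k < hi i \<Longrightarrow> k = lo i \<or> k = - lo i" if "k \<noteq> 0" for k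
    using lo_hi_between[of i k] that by arith
  have b2: "- hi i < k \<Longrightarrow> k < - lo i \<Longrightarrow> k = lo i \<or> k = - lo i" if "k \<noteq> 0" for k
    using b1[of "- k"] that by auto
  have lh: "lo i + hi i > 0" by (simp add: lo_def hi_def)
  note b = b1[OF assms(3)] b1[OF assms(4)] b2[OF assms(3)] b2[OF assms(4)]
  show ?thesis
  proof (cases x i rule: gen_cases[case_names 1 2 3 4 5])
    case 1
    then show ?thesis using b xy ng ne lb lh by (cases y i rule: gen_cases) auto
  next
    case 2
    then show ?thesis using b xy ng ne lb lh by (cases y i rule: gen_cases) auto
  next
    case 3
    then show ?thesis using b xy ng ne lb lh by (cases y i rule: gen_cases) auto
  next
    case 4
    then show ?thesis using b xy ng ne lb lh by (cases y i rule: gen_cases) auto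
  next
    case 5
    then show ?thesis using b xy ng ne lb lh by (cases y i rule: gen_cases) auto
  qed
qed

section \<open>Signed fillings, their contents and the action of the generators\<close>

definition signed_filling :: "box set \<Rightarrow> filling \<Rightarrow> bool" where
  "signed_filling D F \<longleftrightarrow> diagram F = D \<and> (\<forall>b\<in>D. \<exists>k. F b = {k}) \<and> (\<forall>b. F b \<subseteq> signed (card D)) \<and>
     (\<forall>i::int. 1 \<le> i \<and> i \<le> int (card D) \<longrightarrow> (\<exists>!b. F b \<inter> {i, - i} \<noteq> {}))"

definition signed_tableaux :: "box set \<Rightarrow> bool \<Rightarrow> filling set" where
  "signed_tableaux D s = {F. signed_filling D F \<and> is_standard F \<and> even (neg_count F D) = s}"

text \<open>Contents after moving the diagram along its rows by a real distance t.\<close>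

definition shifted_content :: "real \<Rightarrow> filling \<Rightarrow> int \<Rightarrow> real" where
  "shifted_content t F k = real_of_int (cvec F k) + (if \<exists>b. k \<in> F b then t else - t)"

definition shifted_fval :: "real \<Rightarrow> nat \<Rightarrow> filling \<Rightarrow> real" where
  "shifted_fval t i F = shifted_content t F (hi i) - shifted_content t F (lo i)"

lemma signed_filling_in: "signed_filling D F \<Longrightarrow> F b = {k} \<Longrightarrow> b \<in> D \<and> k \<in> signed (card D)"
  unfolding signed_filling_def diagram_def by blast

lemma signed_filling_single:
  assumes "signed_filling D F" "k \<in> F b"
  shows "F b = {k}"
proof -
  have "b \<in> D" using assms by (auto simp: signed_filling_def diagram_def)
  then obtain l where "F b = {l}" using assms by (auto simp: signed_filling_def)
  then show ?thesis using assms by simp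
qed

lemma signed_filling_unique:
  assumes F: "signed_filling D F" and b: "F b = {k}" "F b' = {l}" "\<bar>k\<bar> = \<bar>l\<bar>"
  shows "b = b'"
proof -
  have "k \<in> signed (card D)" using signed_filling_in[OF F b(1)] by simp
  then have "1 \<le> \<bar>k\<bar> \<and> \<bar>k\<bar> \<le> int (card D)" by (auto simp: signed_def)
  then have ex1: "\<exists>!b. F b \<inter> {\<bar>k\<bar>, - \<bar>k\<bar>} \<noteq> {}" using F unfolding signed_filling_def by blast
  have "F b \<inter> {\<bar>k\<bar>, - \<bar>k\<bar>} \<noteq> {}" "F b' \<inter> {\<bar>k\<bar>, - \<bar>k\<bar>} \<noteq> {}" using b by auto
  then show ?thesis using ex1 by blast
qed

lemma signed_filling_cases:
  assumes F: "signed_filling D F" and k: "k \<in> signed (card D)"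
  obtains b where "F b = {k}" | b where "F b = {- k}"
proof -
  have "1 \<le> \<bar>k\<bar> \<and> \<bar>k\<bar> \<le> int (card D)" using k by (auto simp: signed_def)
  then obtain b where "F b \<inter> {\<bar>k\<bar>, - \<bar>k\<bar>} \<noteq> {}" using F unfolding signed_filling_def by blast
  then have "k \<in> F b \<or> - k \<in> F b" by (auto simp: abs_if split: if_splits)
  then show ?thesis using signed_filling_single[OF F] that by blast
qed

lemma cvec_eq:
  assumes "k \<in> F b" "\<And>b'. k \<in> F b' \<Longrightarrow> b' = b"
  shows "cvec F k = content b"
proof -
  have "(THE b. k \<in> F b) = b" by (rule the_equality) (fact assms)+
  moreover have "\<exists>b. k \<in> F b" using assms(1) by blast
  ultimately show ?thesis by (simp add: cvec_def)
qed

lemma cvec_eq_minus: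
  assumes "- k \<in> F b" "\<And>b'. - k \<in> F b' \<Longrightarrow> b' = b" "\<And>b. k \<notin> F b"
  shows "cvec F k = - content b"
proof -
  have "(THE b. - k \<in> F b) = b" by (rule the_equality) (fact assms)+
  then show ?thesis using assms(3) by (simp add: cvec_def)
qed

lemma shifted_content_pos:
  assumes F: "signed_filling D F" and b: "F b = {k}"
  shows "shifted_content t F k = real_of_int (content b) + t"
proof -
  have "cvec F k = content b"
  proof (rule cvec_eq)
    fix b' assume "k \<in> F b'"
    then show "b' = b" using signed_filling_unique[OF F signed_filling_single[OF F] b] by blast
  qed (simp add: b)
  moreover have "\<exists>b. k \<in> F b" using b by blast
  ultimately show ?thesis by (simp add: shifted_content_def)
qed

lemma shifted_content_neg:
  assumes F: "signed_filling D F" and b: "F b = {- k}"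
  shows "shifted_content t F k = - (real_of_int (content b) + t)"
proof -
  have k: "k \<noteq> 0" using signed_filling_in[OF F b] by (auto simp: signed_def)
  have no: "k \<notin> F b'" for b'
  proof
    assume "k \<in> F b'"
    then have "F b' = {k}" using signed_filling_single[OF F] by blast
    then show False using signed_filling_unique[OF F _ b, of b' k] b k by auto
  qed
  have "cvec F k = - content b"
  proof (rule cvec_eq_minus)
    fix b' assume "- k \<in> F b'"
    then show "b' = b" using signed_filling_unique[OF F signed_filling_single[OF F] b] by blast
  qed (simp_all add: b no)
  then show ?thesis using no by (simp add: shifted_content_def)
qed

lemma shifted_content_minus:
  assumes F: "signed_filling D F" and k: "k \<in> signed (card D)"
  shows "shifted_content t F (- k) = - shifted_content t F k"
  using F k
proof (cases rule: signed_filling_cases)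
  case (1 b)
  then show ?thesis using shifted_content_pos[OF F, of b k t] shifted_content_neg[OF F, of b "- k" t] by simp
next
  case (2 b)
  then show ?thesis using shifted_content_pos[OF F, of b "- k" t] shifted_content_neg[OF F, of b k t] by simp
qed

lemma signed_filling_act:
  assumes F: "signed_filling D F" and i: "i \<in> gens (card D)"
  shows "signed_filling D (act (gen i) F)"
  unfolding signed_filling_def
proof (intro conjI ballI allI impI)
  show "diagram (act (gen i) F) = D" using F by (auto simp: signed_filling_def diagram_def act_def)
  show "\<exists>k. act (gen i) F b = {k}" if "b \<in> D" for b
    using F that by (fastforce simp: signed_filling_def act_def)
  show "act (gen i) F b \<subseteq> signed (card D)" for b
  proof -
    have "F b \<subseteq> signed (card D)" using F unfolding signed_filling_def by blast
    then show ?thesis using gen_signed[OF i] by (auto simp: act_def)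
  qed
  fix k :: int assume k: "1 \<le> k \<and> k \<le> int (card D)"
  then have "k \<in> signed (card D)" by (simp add: signed_def)
  then have gk: "gen i k \<in> signed (card D)" by (rule gen_signed[OF i])
  have eq: "act (gen i) F b \<inter> {k, - k} \<noteq> {} \<longleftrightarrow> gen i k \<in> F b \<or> - gen i k \<in> F b" for b
  proof -
    have "l \<in> gen i ` F b \<longleftrightarrow> gen i l \<in> F b" for l
      by (metis gen_invol imageE image_eqI)
    then show ?thesis by (auto simp: act_def gen_minus)
  qed
  obtain b where b: "F b = {gen i k} \<or> F b = {- gen i k}" using signed_filling_cases[OF F gk] by metis
  show "\<exists>!b. act (gen i) F b \<inter> {k, - k} \<noteq> {}"
    unfolding eq
  proof (rule ex1I[of _ b])
    fix b' assume "gen i k \<in> F b' \<or> - gen i k \<in> F b'"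
    then have "F b' = {gen i k} \<or> F b' = {- gen i k}" using signed_filling_single[OF F] by blast
    then show "b' = b" using b signed_filling_unique[OF F] by (metis abs_minus)
  qed (use b in auto)
qed

lemma act_singleton: "F b = {gen i k} \<Longrightarrow> act (gen i) F b = {k}"
  by (simp add: act_def gen_invol)

lemma shifted_content_act:
  assumes F: "signed_filling D F" and i: "i \<in> gens (card D)" and k: "k \<in> signed (card D)"
  shows "shifted_content t (act (gen i) F) k = shifted_content t F (gen i k)"
proof -
  note F' = signed_filling_act[OF F i]
  show ?thesis using F gen_signed[OF i k]
  proof (cases rule: signed_filling_cases)
    case (1 b)
    then show ?thesis using shifted_content_pos[OF F 1] shifted_content_pos[OF F' act_singleton[of F b i k]] by simp
  next
    case (2 b)
    then have "F b = {gen i (- k)}" by (simp add: gen_minus)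
    then show ?thesis using shifted_content_neg[OF F 2] shifted_content_neg[OF F' act_singleton[of F b i "- k"]] by simp
  qed
qed

text \<open>The generator 0 fits in because c_1 + c_2 = c_2 - c_{-1}.\<close>

lemma fval_shifted_fval:
  assumes F: "signed_filling D F" and i: "i \<in> gens (card D)"
  shows "fval F i = shifted_fval 0 i F"
proof -
  have c: "real_of_int (cvec F k) = shifted_content 0 F k" for k by (simp add: shifted_content_def)
  have "shifted_content 0 F (- 1) = - shifted_content 0 F 1"
    by (rule shifted_content_minus[OF F]) (use i in \<open>auto simp: gens_def signed_def split: if_splits\<close>)
  then show ?thesis by (auto simp: fval_def shifted_fval_def lo_def hi_def c)
qed

section \<open>Standard fillings of skew diagrams and the bound |f_i| >= 1\<close>

lemma std_less:
  assumes "is_standard F" "F b = {x}" "F b' = {y}"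
    "(fst b = fst b' \<and> snd b < snd b') \<or> (snd b = snd b' \<and> fst b < fst b')"
  shows "x < y"
proof -
  have "b \<in> diagram F" "b' \<in> diagram F" using assms by (auto simp: diagram_def)
  then have "Max (F b) < Min (F b')" using assms(1,4) unfolding is_standard_def by blast
  then show ?thesis using assms by simp
qed

lemma skew_between:
  assumes "is_skew_diagram D" "b \<in> D" "b' \<in> D" "fst b \<le> a" "a \<le> fst b'" "snd b \<le> c" "c \<le> snd b'"
  shows "(a, c) \<in> D"
proof -
  have "(fst b, snd b) \<in> D" "(fst b', snd b') \<in> D" using assms(2,3) by simp_all
  then show ?thesis using assms(1,4-) unfolding is_skew_diagram_def by blast
qed

text \<open>Go along the row to the box (r, j'), which convexity puts into \<open>D\<close>, and
  then down the column.\<close>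

lemma std_mono:
  assumes skew: "is_skew_diagram D" and F: "signed_filling D F" "is_standard F"
    and b: "F b = {x}" "F b' = {y}" and le: "fst b \<le> fst b'" "snd b \<le> snd b'" "b \<noteq> b'"
  shows "x < y"
proof -
  obtain r j r' j' where bb: "b = (r, j)" "b' = (r', j')" by (cases b, cases b')
  have bD: "b \<in> D" "b' \<in> D" using signed_filling_in[OF F(1)] b by auto
  then have "(r, j') \<in> D" using le bb by (intro skew_between[OF skew bD]) auto
  then obtain z where z: "F (r, j') = {z}" using F(1) unfolding signed_filling_def by blast
  have xz: "x < z" if "j < j'" using std_less[OF F(2) b(1) z] bb that by simp
  have zy: "z < y" if "r < r'" using std_less[OF F(2) z b(2)] bb that by simp
  have "x = z" if "j = j'" using b(1) z bb that by simp
  moreover have "z = y" if "r = r'" using b(2) z bb that by simp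
  moreover have "j < j' \<or> j = j'" "r < r' \<or> r = r'" "j \<noteq> j' \<or> r \<noteq> r'" using le bb by auto
  ultimately show ?thesis using xz zy by (metis order.strict_trans)
qed

lemma signed_filling_obtain:
  assumes "signed_filling D F" "b \<in> D"
  obtains k where "F b = {k}"
  using assms unfolding signed_filling_def by blast

text \<open>The smaller entry lies to the upper left; its neighbours to the right and below belong
  to \<open>D\<close> and carry two entries in between. Numbers with at most one admissible entry
  between them can therefore not share a diagonal.\<close>

lemma same_diagonal_between:
  assumes skew: "is_skew_diagram D" and F: "signed_filling D F" "is_standard F"
    and b: "F b = {x}" "F b' = {y}" "x < y" "content b = content b'"
  obtains c c' z z' where "F c = {z}" "F c' = {z'}" "z \<noteq> z'" "x < z" "z < y" "x < z'" "z' < y"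
proof -
  obtain r j r' j' where bb: "b = (r, j)" "b' = (r', j')" by (cases b, cases b')
  have eq: "j - r = j' - r'" using b(4) bb by (simp add: content_def)
  have bD: "b \<in> D" "b' \<in> D" using signed_filling_in[OF F(1)] b by auto
  have "r < r'"
  proof (rule ccontr)
    assume "\<not> r < r'"
    then have "fst b' \<le> fst b" "snd b' \<le> snd b" using bb eq by auto
    moreover have "b' \<noteq> b" using b by auto
    ultimately have "y < x" using std_mono[OF skew F b(2,1)] by simp
    then show False using b(3) by simp
  qed
  then have lt: "r < r'" "j < j'" using eq by auto
  have "(r, j + 1) \<in> D" "(r + 1, j) \<in> D" using lt bb by (auto intro: skew_between[OF skew bD])
  then obtain z z' where z: "F (r, j + 1) = {z}" "F (r + 1, j) = {z'}"
    using signed_filling_obtain[OF F(1)] by metis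
  have "z \<noteq> z'" using signed_filling_unique[OF F(1) z] by auto
  then show ?thesis
    using that[OF z] std_mono[OF skew F b(1) z(1)] std_mono[OF skew F z(1) b(2)]
      std_mono[OF skew F b(1) z(2)] std_mono[OF skew F z(2) b(2)] lt bb by auto
qed

text \<open>Two boxes on the diagonal of content 0 would, by convexity, enclose a box of negative
  content.\<close>

lemma zero_box_unique:
  assumes skew: "is_skew_diagram D" and nonneg: "\<And>b. b \<in> D \<Longrightarrow> 0 \<le> content b"
    and "b \<in> D" "b' \<in> D" "content b = 0" "content b' = 0"
  shows "b = b'"
proof -
  have *: "\<not> fst b < fst b'" if b: "b \<in> D" "b' \<in> D" "content b = 0" "content b' = 0" for b b'
  proof
    assume "fst b < fst b'"
    then have "(fst b', snd b) \<in> D"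
      using b by (intro skew_between[OF skew b(1,2)]) (auto simp: content_def)
    then show False using nonneg[of "(fst b', snd b)"] b \<open>fst b < fst b'\<close> by (auto simp: content_def)
  qed
  then have "fst b = fst b'" using assms(3-) by (metis linorder_neqE)
  then show ?thesis using assms by (auto simp: content_def prod_eq_iff)
qed

text \<open>If p and w occur with equal signs, t cancels and the two contents are distinct integers
  by \<open>same_diagonal_between\<close>. If they occur with opposite signs, the difference is, up
  to sign, a sum of two contents plus 2t, and at most one of these contents is 0. The assumption
  \<open>gap\<close> admits one entry in between, so that the lemma covers both f_i and f_i + f_j
  for linked i, j.\<close>

lemma content_gap:
  assumes skew: "is_skew_diagram D" and nonneg: "\<And>b. b \<in> D \<Longrightarrow> 0 \<le> content b"
    and F: "signed_filling D F" "is_standard F" and t: "0 \<le> t"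
    and pw: "p \<in> signed (card D)" "w \<in> signed (card D)" "p < w" "\<bar>p\<bar> \<noteq> \<bar>w\<bar>"
    and gap: "\<And>z z'. p < z \<Longrightarrow> z < w \<Longrightarrow> p < z' \<Longrightarrow> z' < w \<Longrightarrow> z \<noteq> 0 \<Longrightarrow> z' \<noteq> 0 \<Longrightarrow>
      \<bar>z\<bar> \<noteq> \<bar>p\<bar> \<Longrightarrow> \<bar>z\<bar> \<noteq> \<bar>w\<bar> \<Longrightarrow> \<bar>z'\<bar> \<noteq> \<bar>p\<bar> \<Longrightarrow> \<bar>z'\<bar> \<noteq> \<bar>w\<bar> \<Longrightarrow> z = z'"
  shows "1 \<le> \<bar>shifted_content t F w - shifted_content t F p\<bar>"
proof -
  have same: "1 \<le> \<bar>real_of_int (content b') - real_of_int (content b)\<bar>"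
    if b: "F b = {x}" "F b' = {y}" and xy: "x = p \<and> y = w \<or> x = - w \<and> y = - p" for b b' x y
  proof -
    have less: "x < y" using xy pw by auto
    have "content b \<noteq> content b'"
    proof
      assume eq: "content b = content b'"
      obtain c c' z z' where z: "F c = {z}" "F c' = {z'}" "z \<noteq> z'" "x < z" "z < y" "x < z'" "z' < y"
        by (rule same_diagonal_between[OF skew F b less eq])
      have nz: "z \<noteq> 0" "z' \<noteq> 0" using signed_filling_in[OF F(1)] z by (auto simp: signed_def)
      have ne: "\<bar>u\<bar> \<noteq> \<bar>v\<bar>" if "F d = {u}" "F e = {v}" "u \<noteq> v" for d e u v
        using signed_filling_unique[OF F(1) that(1,2)] that by auto
      have "\<bar>z\<bar> \<noteq> \<bar>x\<bar>" "\<bar>z\<bar> \<noteq> \<bar>y\<bar>" "\<bar>z'\<bar> \<noteq> \<bar>x\<bar>" "\<bar>z'\<bar> \<noteq> \<bar>y\<bar>"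
        using ne[OF z(1) b(1)] ne[OF z(1) b(2)] ne[OF z(2) b(1)] ne[OF z(2) b(2)] z by auto
      then show False using xy gap[of z z'] gap[of "- z" "- z'"] z nz by auto
    qed
    then show ?thesis by linarith
  qed
  have opp: "1 \<le> real_of_int (content b') + real_of_int (content b)"
    if b: "F b = {x}" "F b' = {y}" "\<bar>x\<bar> \<noteq> \<bar>y\<bar>" for b b' x y
  proof -
    have bD: "b \<in> D" "b' \<in> D" using signed_filling_in[OF F(1)] b by auto
    have "b \<noteq> b'" using b by auto
    then have "content b \<noteq> 0 \<or> content b' \<noteq> 0" using zero_box_unique[OF skew nonneg bD] by blast
    then show ?thesis using nonneg[OF bD(1)] nonneg[OF bD(2)] by linarith
  qed
  show ?thesis
    using F(1) pw(1)
  proof (cases rule: signed_filling_cases)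
    case p: (1 b)
    show ?thesis using F(1) pw(2)
    proof (cases rule: signed_filling_cases)
      case w: (1 b')
      then show ?thesis using same[OF p w] shifted_content_pos[OF F(1) p, of t] shifted_content_pos[OF F(1) w, of t] by simp
    next
      case w: (2 b')
      then show ?thesis
        using opp[OF p w] pw(4) t shifted_content_pos[OF F(1) p, of t] shifted_content_neg[OF F(1) w, of t] by simp
    qed
  next
    case p: (2 b)
    show ?thesis using F(1) pw(2)
    proof (cases rule: signed_filling_cases)
      case w: (1 b')
      then show ?thesis
        using opp[OF p w] pw(4) t shifted_content_neg[OF F(1) p, of t] shifted_content_pos[OF F(1) w, of t] by simp
    next
      case w: (2 b')
      then show ?thesis using same[OF w p] shifted_content_neg[OF F(1) p, of t] shifted_content_neg[OF F(1) w, of t] by simp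
    qed
  qed
qed

text \<open>By \<open>gen_order\<close> only entries \<open>lo i\<close>, \<open>hi i\<close> or
  their negatives, placed in one row or column, can lose their order. A box between them would need
  an entry between them, so the two boxes are adjacent. Having equal signs, the entries then give
  f_i = +-1 for every t.\<close>

lemma act_standard:
  assumes skew: "is_skew_diagram D" and F: "signed_filling D F" "is_standard F"
    and i: "i \<in> gens (card D)" and f: "\<bar>shifted_fval t i F\<bar> \<noteq> 1"
  shows "is_standard (act (gen i) F)"
  unfolding is_standard_def
proof (intro ballI impI)
  fix b b' assume bd: "b \<in> diagram (act (gen i) F)" "b' \<in> diagram (act (gen i) F)"
    and rel: "fst b = fst b' \<and> snd b < snd b' \<or> snd b = snd b' \<and> fst b < fst b'"
  have bD: "b \<in> D" "b' \<in> D" using bd F(1) by (auto simp: diagram_def act_def signed_filling_def)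
  then obtain x y where xy: "F b = {x}" "F b' = {y}" using signed_filling_obtain[OF F(1)] by metis
  have less: "x < y" using std_less[OF F(2) xy rel] .
  have ne: "\<bar>u\<bar> \<noteq> \<bar>v\<bar>" if "F d = {u}" "F e = {v}" "u \<noteq> v" for d e u v
    using signed_filling_unique[OF F(1) that(1,2)] that by auto
  have nz: "x \<noteq> 0" "y \<noteq> 0" using signed_filling_in[OF F(1)] xy by (auto simp: signed_def)
  have "gen i x < gen i y"
  proof (rule ccontr)
    assume "\<not> gen i x < gen i y"
    then have pq: "x = lo i \<and> y = hi i \<or> x = - hi i \<and> y = - lo i"
      using gen_order[OF less _ nz] ne[OF xy] less by auto
    have no: False if m: "m \<in> D" "(fst b = fst m \<and> snd b < snd m) \<or> (snd b = snd m \<and> fst b < fst m)"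
      "(fst m = fst b' \<and> snd m < snd b') \<or> (snd m = snd b' \<and> fst m < fst b')" for m
    proof -
      obtain z where z: "F m = {z}" using signed_filling_obtain[OF F(1) m(1)] .
      have "x < z" "z < y" using std_less[OF F(2) xy(1) z m(2)] std_less[OF F(2) z xy(2) m(3)] by auto
      moreover have "z \<noteq> 0" using signed_filling_in[OF F(1) z] by (auto simp: signed_def)
      ultimately show False
        using pq ne[OF z xy(1)] ne[OF z xy(2)] lo_hi_between[of i z] lo_hi_between[of i "- z"] by auto
    qed
    have adj: "content b' - content b = 1 \<or> content b' - content b = - 1"
    proof (cases "fst b = fst b'")
      case True
      have "snd b' = snd b + 1"
      proof (rule ccontr)
        assume "snd b' \<noteq> snd b + 1"
        then have lt: "snd b + 1 < snd b'" using rel True by auto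
        then have "(fst b, snd b + 1) \<in> D" using True by (intro skew_between[OF skew bD]) auto
        then show False using no[of "(fst b, snd b + 1)"] True lt by auto
      qed
      then show ?thesis using True by (simp add: content_def)
    next
      case False
      have "fst b' = fst b + 1"
      proof (rule ccontr)
        assume "fst b' \<noteq> fst b + 1"
        then have lt: "fst b + 1 < fst b'" using rel False by auto
        then have "(fst b + 1, snd b) \<in> D" using rel False by (intro skew_between[OF skew bD]) auto
        then show False using no[of "(fst b + 1, snd b)"] rel False lt by auto
      qed
      then show ?thesis using rel False by (simp add: content_def)
    qed
    have "shifted_fval t i F = real_of_int (content b' - content b)"
      using pq
    proof
      assume e: "x = lo i \<and> y = hi i"
      show ?thesis
        using shifted_content_pos[OF F(1) xy(1), of t] shifted_content_pos[OF F(1) xy(2), of t] e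
        by (simp add: shifted_fval_def)
    next
      assume e: "x = - hi i \<and> y = - lo i"
      show ?thesis
        using shifted_content_neg[OF F(1), of b "hi i" t] shifted_content_neg[OF F(1), of b' "lo i" t] e xy
        by (simp add: shifted_fval_def)
    qed
    then show False using f adj by auto
  qed
  then show "Max (act (gen i) F b) < Min (act (gen i) F b')" using xy by (simp add: act_def)
qed

text \<open>For i > 0 the generator preserves signs. For i = 0 it changes the signs of the two
  entries with absolute values 1 and 2, so a negative ones among these become 2 - a.\<close>

lemma act_neg_count:
  assumes F: "signed_filling D F" and i: "i \<in> gens (card D)"
  shows "even (neg_count (act (gen i) F) D) = even (neg_count F D)"
proof -
  define E where "E = {k. \<exists>b\<in>D. k \<in> F b}"
  have mem: "k \<in> act (gen i) F b \<longleftrightarrow> gen i k \<in> F b" for k b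
    unfolding act_def by (metis gen_invol imageE image_eqI)
  have n1: "neg_count F D = card {k. k < 0 \<and> k \<in> E}" by (simp add: neg_count_def E_def)
  have n2: "neg_count (act (gen i) F) D = card {k. k < 0 \<and> gen i k \<in> E}"
    by (simp add: neg_count_def E_def mem)
  have "E \<subseteq> signed (card D)" using F unfolding E_def signed_filling_def by blast
  then have fin: "finite E" using finite_signed finite_subset by blast
  have flip: "- k \<in> E \<longleftrightarrow> k \<notin> E" if k: "k \<in> signed (card D)" for k
  proof -
    have "\<not> (k \<in> E \<and> - k \<in> E)"
    proof
      assume "k \<in> E \<and> - k \<in> E"
      then obtain b b' where "F b = {k}" "F b' = {- k}"
        unfolding E_def using signed_filling_single[OF F] by blast
      then show False using signed_filling_unique[OF F, of b k b' "- k"] k by (auto simp: signed_def)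
    qed
    moreover have "k \<in> E \<or> - k \<in> E"
      using F k
    proof (cases rule: signed_filling_cases)
      case (1 b)
      then show ?thesis using signed_filling_in[OF F 1] by (auto simp: E_def)
    next
      case (2 b)
      then show ?thesis using signed_filling_in[OF F 2] by (auto simp: E_def)
    qed
    ultimately show ?thesis by blast
  qed
  show ?thesis
  proof (cases "i = 0")
    case False
    have sgn: "gen i k < 0 \<longleftrightarrow> k < 0" for k
      by (cases k i rule: gen_cases) (use False in \<open>auto simp: lo_def hi_def\<close>)
    have "{k. k < 0 \<and> gen i k \<in> E} = gen i ` {k. k < 0 \<and> k \<in> E}"
    proof safe
      fix k assume "k < 0" "gen i k \<in> E"
      then show "k \<in> gen i ` {k. k < 0 \<and> k \<in> E}"
        by (intro image_eqI[of _ _ "gen i k"]) (auto simp: gen_invol sgn)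
    qed (auto simp: gen_invol sgn)
    moreover have "inj_on (gen i) {k. k < 0 \<and> k \<in> E}" by (metis gen_invol inj_onI)
    ultimately show ?thesis unfolding n1 n2 by (simp add: card_image)
  next
    case True
    define R where "R = {k. k < -2 \<and> k \<in> E}"
    have R: "finite R" "-1 \<notin> R" "-2 \<notin> R" using fin by (auto simp: R_def)
    have s12: "1 \<in> signed (card D)" "2 \<in> signed (card D)" using i by (auto simp: gens_def signed_def split: if_splits)
    note f1 = flip[OF s12(1)] and f2 = flip[OF s12(2)]
    have neg: "k < 0 \<longleftrightarrow> k < -2 \<or> k = -1 \<or> k = -2" for k :: int by presburger
    have g: "gen i (-1) = 2" "gen i (-2) = 1" and g': "\<And>k. k < -2 \<Longrightarrow> gen i k = k"
      using True by (simp_all add: gen_def)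
    have e1: "{k. k < 0 \<and> k \<in> E} = R \<union> (if -1 \<in> E then {-1} else {}) \<union> (if -2 \<in> E then {-2} else {})"
      unfolding R_def neg by auto
    have e2: "{k. k < 0 \<and> gen i k \<in> E} = R \<union> (if 2 \<in> E then {-1} else {}) \<union> (if 1 \<in> E then {-2} else {})"
      unfolding R_def neg using g g' by auto
    show ?thesis unfolding n1 n2 e1 e2 f1 f2 using R by (cases "1 \<in> E"; cases "2 \<in> E") auto
  qed
qed

lemma finite_signed_tableaux:
  assumes "finite D"
  shows "finite (signed_tableaux D s)"
proof (rule finite_subset)
  show "signed_tableaux D s \<subseteq> {F. \<forall>b. (b \<in> D \<longrightarrow> F b \<in> Pow (signed (card D))) \<and> (b \<notin> D \<longrightarrow> F b = {})}"
    unfolding signed_tableaux_def signed_filling_def diagram_def by blast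
  show "finite \<dots>" by (rule finite_set_of_finite_funs) (use assms finite_signed in auto)
qed

lemma tableaux_seminormal_system:
  assumes skew: "is_skew_diagram D" and nonneg: "\<And>b. b \<in> D \<Longrightarrow> 0 \<le> content b" and t: "0 \<le> t"
  shows "seminormal_system (card D) (signed_tableaux D s) (\<lambda>i. act (gen i)) (shifted_fval t)"
proof (rule seminormal_system.intro)
  let ?n = "card D" and ?S = "signed_tableaux D s" and ?f = "shifted_fval t"
  show "finite ?S" using skew by (intro finite_signed_tableaux) (simp add: is_skew_diagram_def)
  show "D_relations ?n (\<lambda>i. act (gen i))" by (rule act_relations)
  have F: "signed_filling D T" "is_standard T" if "T \<in> ?S" for T using that by (auto simp: signed_tableaux_def)
  have act: "?f j (act (gen i) T) = shifted_content t T (gen i (hi j)) - shifted_content t T (gen i (lo j))"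
    if "i \<in> gens ?n" "j \<in> gens ?n" "T \<in> ?S" for i j T
    unfolding shifted_fval_def using F(1)[OF that(3)] that by (simp add: shifted_content_act lo_hi_signed)
  have minus: "shifted_content t T (- k) = - shifted_content t T k" if "k \<in> signed ?n" "T \<in> ?S" for k T
    using shifted_content_minus F(1) that by blast
  show "1 \<le> \<bar>?f i T\<bar>" if i: "i \<in> gens ?n" and T: "T \<in> ?S" for i T
    unfolding shifted_fval_def
    by (rule content_gap[OF skew nonneg F[OF T] t lo_hi_signed[OF i]])
      (use lo_hi[of i] lo_hi_between in auto)
  show "act (gen i) T \<in> ?S" if "i \<in> gens ?n" "T \<in> ?S" "\<bar>?f i T\<bar> \<noteq> 1" for i T
    using that F[OF that(2)] act_standard[OF skew F[OF that(2)] that(1,3)] act_neg_count[OF F(1)[OF that(2)] that(1)]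
    by (simp add: signed_tableaux_def signed_filling_act)
  show "?f i (act (gen i) T) = - ?f i T" if i: "i \<in> gens ?n" and T: "T \<in> ?S" for i T
    using act[OF i i T] by (simp add: gen_swap shifted_fval_def)
  show "?f j (act (gen i) T) = ?f j T"
    if i: "i \<in> gens ?n" and j: "j \<in> gens ?n" and ij: "i \<noteq> j" "\<not> linked i j" and T: "T \<in> ?S" for i j T
  \<comment> \<open>The generators 0 and 1 move the same numbers; here f_0 = c_2 + c_1 and f_1 = c_2
    - c_1 are preserved only because c_{-k} = -c_k.\<close>
  proof (cases "i \<le> 1 \<and> j \<le> 1")
    case True
    have s: "1 \<in> signed ?n" "2 \<in> signed ?n" using i by (auto simp: gens_def signed_def split: if_splits)
    have "i = 0 \<and> j = 1 \<or> i = 1 \<and> j = 0" using True ij(1) by auto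
    then show ?thesis
    proof (elim disjE conjE)
      assume e: "i = 0" "j = 1"
      have "gen i (hi j) = - 1" "gen i (lo j) = - 2" by (simp_all add: e gen_def hi_def lo_def)
      then show ?thesis unfolding act[OF i j T]
        by (simp add: minus[OF s(1) T] minus[OF s(2) T] shifted_fval_def) (simp add: e hi_def lo_def)
    next
      assume e: "i = 1" "j = 0"
      have "gen i (hi j) = 1" "gen i (lo j) = - 2" by (simp_all add: e gen_def hi_def lo_def)
      then show ?thesis unfolding act[OF i j T]
        by (simp add: minus[OF s(2) T] shifted_fval_def) (simp add: e hi_def lo_def minus[OF s(1) T])
    qed
  next
    case False
    have "gen i (hi j) = hi j" "gen i (lo j) = lo j"
      using gen_disjoint[OF ij False] unfolding abs_neq_iff by (auto simp: gen_swap)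
    then show ?thesis unfolding act[OF i j T] unfolding shifted_fval_def by simp
  qed
  \<comment> \<open>f_i + f_j telescopes to a difference of the contents of \<open>hi j\<close> and
    \<open>lo i\<close>. The only admissible entry between these two is \<open>hi i\<close>, so
    \<open>content_gap\<close> still applies.\<close>
  have link: "?f j (act (gen i) T) = ?f i T + ?f j T" "?f i (act (gen j) T) = ?f i T + ?f j T" "?f i T + ?f j T \<noteq> 0"
    if i: "i \<in> gens ?n" and j: "j \<in> gens ?n" and ij: "hi i = lo j" and T: "T \<in> ?S" for i j T
  proof -
    have sum: "?f i T + ?f j T = shifted_content t T (hi j) - shifted_content t T (lo i)"
      by (simp add: shifted_fval_def ij)
    have d: "hi j \<noteq> lo i" "hi j \<noteq> - lo i" "- hi j \<noteq> lo i" "hi j \<noteq> hi i" "hi j \<noteq> - hi i" "- hi j \<noteq> hi i"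
        "hi i \<noteq> lo i" "hi i \<noteq> - lo i" "- hi i \<noteq> lo i"
      using hi_eq_lo[OF ij] unfolding abs_neq_iff by auto
    have g1: "gen i (hi j) = hi j" "gen i (lo j) = lo i"
      using d ij by (auto simp: gen_swap)
    have g2: "gen j (hi i) = hi j" "gen j (lo i) = lo i"
      using d ij by (auto simp: gen_swap)
    show "?f j (act (gen i) T) = ?f i T + ?f j T" unfolding act[OF i j T] sum g1 ..
    show "?f i (act (gen j) T) = ?f i T + ?f j T" unfolding act[OF j i T] sum g2 ..
    have "1 \<le> \<bar>shifted_content t T (hi j) - shifted_content t T (lo i)\<bar>"
    proof (rule content_gap[OF skew nonneg F[OF T] t lo_hi_signed(1)[OF i] lo_hi_signed(2)[OF j]])
      show "lo i < hi j" using lo_hi[of i] lo_hi[of j] ij by simp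
      show "\<bar>lo i\<bar> \<noteq> \<bar>hi j\<bar>" using hi_eq_lo[OF ij] by simp
      have *: "z = hi i" if "lo i < z" "z < hi j" "z \<noteq> 0" "\<bar>z\<bar> \<noteq> \<bar>lo i\<bar>" for z
        using that ij by (auto simp: lo_def hi_def split: if_splits)
      show "z = z'" if "lo i < z" "z < hi j" "lo i < z'" "z' < hi j" "z \<noteq> 0" "z' \<noteq> 0" "\<bar>z\<bar> \<noteq> \<bar>lo i\<bar>" "\<bar>z'\<bar> \<noteq> \<bar>lo i\<bar>" for z z'
        using *[of z] *[of z'] that by simp
    qed
    then show "?f i T + ?f j T \<noteq> 0" unfolding sum by auto
  qed
  fix i j T assume i: "i \<in> gens ?n" and j: "j \<in> gens ?n" and ij: "linked i j" and T: "T \<in> ?S"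
  show "?f j (act (gen i) T) = ?f i T + ?f j T"
    using ij unfolding linked_iff using link(1)[OF i j _ T] link(2)[OF j i _ T] by (auto simp: add.commute)
  show "?f i T + ?f j T \<noteq> 0"
    using ij unfolding linked_iff using link(3)[OF i j _ T] link(3)[OF j i _ T] by (auto simp: add.commute)
qed

lemma tableaux_rep_iso:
  assumes "is_skew_diagram D" and "\<And>b. b \<in> D \<Longrightarrow> 0 \<le> content b" and t: "0 \<le> t"
  shows "rep_iso (card D) (signed_tableaux D s, sn_mat (\<lambda>i. act (gen i)) (shifted_fval 0))
    (signed_tableaux D s, sn_mat (\<lambda>i. act (gen i)) (shifted_fval t))"
proof (rule seminormal_family_iso[OF t])
  show "seminormal_family (card D) (signed_tableaux D s) (\<lambda>i. act (gen i)) shifted_fval {0..t}"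
  proof (rule seminormal_family.intro)
    fix u i T assume "u \<in> {0..t}"
    then show "seminormal_system (card D) (signed_tableaux D s) (\<lambda>i. act (gen i)) (shifted_fval u)"
      by (intro tableaux_seminormal_system assms) auto
  next
    fix i T
    have "continuous_on {0..t} (\<lambda>u. shifted_content u T k)" for k
      by (cases "\<exists>b. k \<in> T b") (auto simp: shifted_content_def intro!: continuous_intros)
    then show "continuous_on {0..t} (\<lambda>u. shifted_fval u i T)"
      unfolding shifted_fval_def by (intro continuous_intros)
  qed
qed

section \<open>Translation of diagrams\<close>

definition translate :: "int \<Rightarrow> box \<Rightarrow> box" where
  "translate m b = (fst b, snd b + m)"

definition translate_filling :: "int \<Rightarrow> filling \<Rightarrow> filling" where
  "translate_filling m F = (\<lambda>b. F (translate (- m) b))"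

lemma translate_simps [simp]:
  "translate (- m) (translate m b) = b" "translate m (translate (- m) b) = b"
  "fst (translate m b) = fst b" "snd (translate m b) = snd b + m" "content (translate m b) = content b + m"
  by (simp_all add: translate_def content_def)

lemma translate_filling_inverse [simp]:
  "translate_filling (- m) (translate_filling m F) = F" "translate_filling m (translate_filling (- m) F) = F"
  using translate_simps(1)[of "- m"] by (simp_all add: translate_filling_def)

lemma translate_mem: "b \<in> translate m ` D \<longleftrightarrow> translate (- m) b \<in> D"
  by (metis imageE image_eqI translate_simps(1,2))

lemma inj_translate: "inj_on (translate m) D"
  by (metis inj_onI translate_simps(1))

lemma signed_filling_translate:
  assumes F: "signed_filling D F"
  shows "signed_filling (translate m ` D) (translate_filling m F)"
proof -
  have card: "card (translate m ` D) = card D" by (rule card_image[OF inj_translate])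
  have ex1: "\<exists>!b. translate_filling m F b \<inter> K \<noteq> {}" if "\<exists>!b. F b \<inter> K \<noteq> {}" for K
  proof -
    from that obtain b where b: "F b \<inter> K \<noteq> {}" "\<forall>b'. F b' \<inter> K \<noteq> {} \<longrightarrow> b' = b"
      unfolding Ex1_def by (elim exE conjE)
    show ?thesis
    proof (rule ex1I[of _ "translate m b"])
      show "translate_filling m F (translate m b) \<inter> K \<noteq> {}" using b(1) by (simp add: translate_filling_def)
      fix b' assume "translate_filling m F b' \<inter> K \<noteq> {}"
      then have "translate (- m) b' = b" using b(2)[rule_format, of "translate (- m) b'"] by (simp add: translate_filling_def)
      then show "b' = translate m b" by (metis translate_simps(2))
    qed
  qed
  have "diagram (translate_filling m F) = translate m ` D"
    using F by (auto simp: signed_filling_def diagram_def translate_filling_def translate_mem)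
  moreover have "\<exists>k. translate_filling m F b = {k}" if "b \<in> translate m ` D" for b
  proof -
    have "translate (- m) b \<in> D" using that by (simp add: translate_mem)
    then show ?thesis unfolding translate_filling_def by (rule signed_filling_obtain[OF F]) (rule exI)
  qed
  moreover have "translate_filling m F b \<subseteq> signed (card D)" for b
    using F unfolding signed_filling_def translate_filling_def by blast
  moreover have "\<exists>!b. translate_filling m F b \<inter> {i, - i} \<noteq> {}" if "1 \<le> i \<and> i \<le> int (card D)" for i
    using F that unfolding signed_filling_def by (intro ex1) (elim conjE, drule spec, erule mp, intro conjI)
  ultimately show ?thesis
    unfolding signed_filling_def card by simp
qed

lemma translate_tableaux:
  assumes "F \<in> signed_tableaux D s"
  shows "translate_filling m F \<in> signed_tableaux (translate m ` D) s"
proof -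
  have F: "signed_filling D F" "is_standard F" "even (neg_count F D) = s"
    using assms by (auto simp: signed_tableaux_def)
  have "is_standard (translate_filling m F)"
    unfolding is_standard_def
  proof (intro ballI impI)
    fix b b' assume "b \<in> diagram (translate_filling m F)" "b' \<in> diagram (translate_filling m F)"
      and "fst b = fst b' \<and> snd b < snd b' \<or> snd b = snd b' \<and> fst b < fst b'"
    then show "Max (translate_filling m F b) < Min (translate_filling m F b')"
      using F(2)[unfolded is_standard_def, rule_format, of "translate (- m) b" "translate (- m) b'"]
      by (simp add: translate_filling_def diagram_def)
  qed
  moreover have "neg_count (translate_filling m F) (translate m ` D) = neg_count F D"
    by (simp add: neg_count_def translate_filling_def)
  ultimately show ?thesis using F signed_filling_translate[OF F(1)] by (simp add: signed_tableaux_def)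
qed

lemma bij_betw_translate_tableaux:
  "bij_betw (translate_filling m) (signed_tableaux D s) (signed_tableaux (translate m ` D) s)"
proof (rule bij_betw_byWitness[where f' = "translate_filling (- m)"])
  have "translate (- m) ` translate m ` D = D" by (simp add: image_image)
  then show "translate_filling (- m) ` signed_tableaux (translate m ` D) s \<subseteq> signed_tableaux D s"
    using translate_tableaux[of _ "translate m ` D" s "- m"] by auto
  show "translate_filling m ` signed_tableaux D s \<subseteq> signed_tableaux (translate m ` D) s"
    using translate_tableaux by blast
qed simp_all

text \<open>An integral shift is realised by moving the diagram; this identifies the member t = m of
  the family with an honest set of tableaux.\<close>

lemma shifted_fval_translate:
  assumes F: "signed_filling D F" and i: "i \<in> gens (card D)"
  shows "shifted_fval 0 i (translate_filling m F) = shifted_fval (real_of_int m) i F"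
proof -
  have *: "shifted_content 0 (translate_filling m F) k = shifted_content (real_of_int m) F k"
    if "k \<in> signed (card D)" for k
    using F that
  proof (cases rule: signed_filling_cases)
    case (1 b)
    have "translate_filling m F (translate m b) = {k}" using 1 by (simp add: translate_filling_def)
    then show ?thesis
      using shifted_content_pos[OF F 1] shifted_content_pos[OF signed_filling_translate[OF F], of m "translate m b" k 0] by simp
  next
    case (2 b)
    have "translate_filling m F (translate m b) = {- k}" using 2 by (simp add: translate_filling_def)
    then show ?thesis
      using shifted_content_neg[OF F 2] shifted_content_neg[OF signed_filling_translate[OF F], of m "translate m b" k 0] by simp
  qed
  show ?thesis unfolding shifted_fval_def using *[OF lo_hi_signed(1)[OF i]] *[OF lo_hi_signed(2)[OF i]] by simp
qed

lemma place_translate: "place lam c = translate (c - min_content lam) ` lam"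
  unfolding place_def translate_def by (rule image_cong) auto

lemma card_place: "card (place lam c) = card lam"
  unfolding place_translate by (rule card_image[OF inj_translate])

lemma skew_place:
  assumes "is_skew_diagram lam"
  shows "is_skew_diagram (place lam c)"
  unfolding is_skew_diagram_def
proof (intro conjI allI impI)
  show "finite (place lam c)" using assms by (simp add: place_def is_skew_diagram_def)
  fix r j r' j' a d
  let ?m = "c - min_content lam"
  assume "(r, j) \<in> place lam c \<and> (r', j') \<in> place lam c \<and> r \<le> a \<and> a \<le> r' \<and> j \<le> d \<and> d \<le> j'"
  then have "(a, d - ?m) \<in> lam"
    unfolding place_translate translate_mem
    by (intro skew_between[OF assms, of "translate (- ?m) (r, j)" "translate (- ?m) (r', j')"]) auto
  then show "(a, d) \<in> place lam c"
    unfolding place_translate translate_mem by (simp add: translate_def algebra_simps)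
qed

lemma place_content_ge:
  assumes "is_skew_diagram lam" "b \<in> place lam c"
  shows "c \<le> content b"
proof -
  obtain b' where b': "b' \<in> lam" "b = translate (c - min_content lam) b'" using assms(2) unfolding place_translate by blast
  have "min_content lam \<le> content b'"
    unfolding min_content_def using assms(1) b'(1) by (intro Min_le) (auto simp: is_skew_diagram_def)
  then show ?thesis using b'(2) by simp
qed

lemma place_content_eq:
  assumes "is_skew_diagram lam" "lam \<noteq> {}"
  shows "\<exists>b\<in>place lam c. content b = c"
proof -
  have "min_content lam \<in> content ` lam"
    unfolding min_content_def using assms by (intro Min_in) (auto simp: is_skew_diagram_def)
  then obtain b where "b \<in> lam" "content b = min_content lam" by auto
  then show ?thesis unfolding place_translate by (intro bexI[of _ "translate (c - min_content lam) b"]) auto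
qed

lemma T_m_eq: "T_m lam m s = signed_tableaux (place lam m) s"
  unfolding T_m_def signed_tableaux_def signed_filling_def card_place by auto

lemma seminormal_sn_mat: "seminormal i T T' = sn_mat (\<lambda>i. act (gen i)) (\<lambda>i F. fval F i) i T T'"
  by (simp add: seminormal_def sn_mat_def off_diag_def)

lemma seminormal_sn_mat_0:
  assumes "signed_filling D T" "i \<in> gens (card D)"
  shows "seminormal i T T' = sn_mat (\<lambda>i. act (gen i)) (shifted_fval 0) i T T'"
  unfolding seminormal_sn_mat using fval_shifted_fval[OF assms] by (simp add: sn_mat_def)

text \<open>\<open>T_m lam 0\<close> does not occur in the theorem; it is the auxiliary starting
  point t = 0 of the family, made of signed fillings whose corner box of content 0 carries a single
  signed entry.\<close>

lemma T_m_rep_iso: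
  assumes skew: "is_skew_diagram lam"
  shows "rep_iso (card lam) (rho (T_m lam 0 s)) (rho (T_m lam (int m) s))"
proof -
  define D where "D = place lam 0"
  have cD: "card lam = card D" by (simp add: D_def card_place)
  have skewD: "is_skew_diagram D" unfolding D_def by (rule skew_place[OF skew])
  have fin: "finite (signed_tableaux D s)"
    using skewD by (intro finite_signed_tableaux) (simp add: is_skew_diagram_def)
  have Dm: "place lam (int m) = translate (int m) ` D"
    unfolding D_def place_translate image_image by (rule image_cong) (auto simp: translate_def)
  let ?A = "\<lambda>t. (signed_tableaux D s, sn_mat (\<lambda>i. act (gen i)) (shifted_fval t))"
  have F: "signed_filling D T" if "T \<in> signed_tableaux D s" for T using that by (simp add: signed_tableaux_def)
  have 1: "rep_iso (card D) (rho (signed_tableaux D s)) (?A 0)"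
    by (rule rep_iso_bij[where h = id]) (auto simp: rho_def fin seminormal_sn_mat_0[OF F])
  have 2: "rep_iso (card D) (?A 0) (?A (real m))"
    by (rule tableaux_rep_iso[OF skewD]) (use place_content_ge[OF skew] in \<open>auto simp: D_def\<close>)
  have 3: "rep_iso (card D) (?A (real m)) (rho (signed_tableaux (translate (int m) ` D) s))"
  proof (rule rep_iso_bij[where h = "translate_filling (int m)"])
    fix i T T' assume i: "i \<in> gens (card D)" and "T \<in> fst (?A (real m))" "T' \<in> fst (?A (real m))"
    then have T: "T \<in> signed_tableaux D s" by simp
    have "card (translate (int m) ` D) = card D" by (rule card_image[OF inj_translate])
    then have "seminormal i (translate_filling m T) (translate_filling m T') =
      sn_mat (\<lambda>i. act (gen i)) (shifted_fval 0) i (translate_filling m T) (translate_filling m T')"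
      using seminormal_sn_mat_0[OF signed_filling_translate[OF F[OF T]]] i by simp
    moreover have "translate_filling m T = translate_filling m T' \<longleftrightarrow> T = T'" for T T'
      by (metis translate_filling_inverse(1))
    moreover have "act (gen i) (translate_filling m T) = translate_filling m (act (gen i) T)"
      by (simp add: act_def translate_filling_def)
    ultimately show "snd (?A (real m)) i T T' =
        snd (rho (signed_tableaux (translate (int m) ` D) s)) i (translate_filling m T) (translate_filling m T')"
      by (simp add: rho_def sn_mat_def shifted_fval_translate[OF F[OF T] i])
  qed (use bij_betw_translate_tableaux fin in \<open>auto simp: rho_def\<close>)
  show ?thesis
    unfolding T_m_eq Dm D_def[symmetric] cD
    by (rule rep_iso_trans[OF rep_iso_trans[OF 1 2] 3]) (simp_all add: fin)
qed

section \<open>The degeneration at shift zero\<close>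

text \<open>Completes the nonnegative part of a tableau by its point reflection; when the corner box is its own
  mirror image, its entry k becomes the pair k, -k.\<close>

definition double :: "int \<Rightarrow> filling \<Rightarrow> filling" where
  "double q F b = F b \<union> uminus ` F (refl q b)"

lemma refl_simps [simp]:
  "refl q (refl q b) = b" "fst (refl q b) = q - fst b" "snd (refl q b) = q - snd b"
  "content (refl q b) = - content b"
  by (simp_all add: refl_def content_def)

lemma refl_mem: "b \<in> refl q ` D \<longleftrightarrow> refl q b \<in> D"
  by (metis imageE image_eqI refl_simps(1))

lemma double_mem: "k \<in> double q F b \<longleftrightarrow> k \<in> F b \<or> - k \<in> F (refl q b)"
proof -
  have "k \<in> uminus ` A \<longleftrightarrow> - k \<in> A" for A :: "int set" by (metis imageE image_eqI minus_minus)
  then show ?thesis by (simp add: double_def)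
qed

lemma double_refl: "double q F (refl q b) = uminus ` double q F b"
  by (auto simp: double_def image_Un image_image)

lemma double_act: "double q (act (gen i) F) = act (gen i) (double q F)"
  by (rule ext) (simp add: double_def act_def image_Un image_image gen_minus)

text \<open>By \<open>gen_order\<close> a reversed pair consists of \<open>lo i\<close> and
  \<open>hi i\<close>, or of their negatives. The numbers u and v need not both be entries of F:
  later u is the opposite of the corner entry.\<close>

lemma swap_fval:
  assumes F: "signed_filling D F" and i: "i \<in> gens (card D)"
    and u: "u \<in> signed (card D)" and v: "v \<in> signed (card D)" and uv: "\<bar>u\<bar> \<noteq> \<bar>v\<bar>"
    and change: "(u < v) \<noteq> (gen i u < gen i v)"
  shows "\<bar>shifted_fval t i F\<bar> = \<bar>shifted_content t F u - shifted_content t F v\<bar>"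
proof -
  have *: "\<bar>shifted_fval t i F\<bar> = \<bar>shifted_content t F u - shifted_content t F v\<bar>" if uv: "u < v" "\<not> gen i u < gen i v" "u \<in> signed (card D)" "v \<in> signed (card D)" "\<bar>u\<bar> \<noteq> \<bar>v\<bar>" for u v
  proof -
    have "u \<noteq> 0" "v \<noteq> 0" using uv by (auto simp: signed_def)
    then have "u = lo i \<and> v = hi i \<or> u = - hi i \<and> v = - lo i" using gen_order[OF uv(1,5) _ _ uv(2)] by blast
    then show ?thesis
      using shifted_content_minus[OF F lo_hi_signed(1)[OF i], of t] shifted_content_minus[OF F lo_hi_signed(2)[OF i], of t]
      by (auto simp: shifted_fval_def)
  qed
  have "gen i u \<noteq> gen i v" using uv by (metis gen_invol)
  then show ?thesis
    using *[of u v] *[of v u] assms by (cases "u < v") (auto simp: abs_minus_commute)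
qed

text \<open>The two signs in the corner have opposite parities, so exactly one of them is compatible
  with a prescribed parity.\<close>

lemma neg_count_flip:
  assumes T: "signed_filling D T" and T': "signed_filling D T'"
    and same: "\<And>b. b \<noteq> b0 \<Longrightarrow> T b = T' b" and b0: "T b0 = {k}" "T' b0 = {- k}"
  shows "even (neg_count T D) \<noteq> even (neg_count T' D)"
proof -
  have *: "neg_count T' D = Suc (neg_count T D)"
    if k: "0 < k" and T: "signed_filling D T" and T': "signed_filling D T'"
      and same: "\<And>b. b \<noteq> b0 \<Longrightarrow> T b = T' b" and b0: "T b0 = {k}" "T' b0 = {- k}" for T T' k
  proof -
    let ?N = "{j. j < 0 \<and> (\<exists>b\<in>D. j \<in> T b)}"
    have b0D: "b0 \<in> D" using signed_filling_in[OF T b0(1)] by simp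
    have "{j. j < 0 \<and> (\<exists>b\<in>D. j \<in> T' b)} = insert (- k) ?N"
    proof (intro equalityI subsetI)
      fix j assume "j \<in> {j. j < 0 \<and> (\<exists>b\<in>D. j \<in> T' b)}"
      then obtain b where "j < 0" "b \<in> D" "j \<in> T' b" by blast
      then show "j \<in> insert (- k) ?N" using same[of b] b0 by (cases "b = b0") auto
    next
      fix j assume "j \<in> insert (- k) ?N"
      then consider "j = - k" | b where "j < 0" "b \<in> D" "j \<in> T b" by blast
      then show "j \<in> {j. j < 0 \<and> (\<exists>b\<in>D. j \<in> T' b)}"
      proof cases
        case 1
        then show ?thesis using k b0 b0D by auto
      next
        case (2 b)
        have "b \<noteq> b0" using 2 b0 k by auto
        then show ?thesis using 2 same[of b] by auto
      qed
    qed
    moreover have "- k \<notin> ?N"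
    proof
      assume "- k \<in> ?N"
      then obtain b where "- k \<in> T b" by blast
      then have "T b = {- k}" by (rule signed_filling_single[OF T])
      then show False using signed_filling_unique[OF T b0(1), of b "- k"] b0 k by auto
    qed
    moreover have "?N \<subseteq> signed (card D)" using T unfolding signed_filling_def by blast
    then have "finite ?N" using finite_signed finite_subset by blast
    ultimately show ?thesis by (simp add: neg_count_def)
  qed
  have "k \<noteq> 0" using signed_filling_in[OF T b0(1)] by (auto simp: signed_def)
  then consider "0 < k" | "0 < - k" by linarith
  then show ?thesis
  proof cases
    case 1
    then show ?thesis using *[OF 1 T T' same b0] by simp
  next
    case 2
    have "neg_count T D = Suc (neg_count T' D)"
      by (rule *[OF 2 T' T]) (use same b0 in auto)
    then show ?thesis by simp
  qed
qed

section \<open>Diagrams with a corner on the diagonal of content 0, and their doubles\<close>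

locale corner_diagram =
  fixes D :: "box set" and r :: int
  assumes skew: "is_skew_diagram D" and nonneg: "\<And>b. b \<in> D \<Longrightarrow> 0 \<le> content b" and corner: "(r, r) \<in> D"
begin

text \<open>A box outside the quadrant to the upper right of the corner would, together with the
  corner, span a box of negative content.\<close>

lemma bounds:
  assumes "b \<in> D"
  shows "fst b \<le> r" "r \<le> snd b"
proof -
  have c: "fst b \<le> snd b" using nonneg[OF assms] by (simp add: content_def)
  show 1: "fst b \<le> r"
  proof (rule ccontr)
    assume "\<not> fst b \<le> r"
    then have "(fst b, r) \<in> D" using c by (intro skew_between[OF skew corner assms]) auto
    then show False using nonneg \<open>\<not> fst b \<le> r\<close> by (fastforce simp: content_def)
  qed
  show "r \<le> snd b"
  proof (rule ccontr)
    assume "\<not> r \<le> snd b"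
    then have "(r, snd b) \<in> D" using 1 by (intro skew_between[OF skew assms corner]) auto
    then show False using nonneg \<open>\<not> r \<le> snd b\<close> by (fastforce simp: content_def)
  qed
qed

lemma zero_box: "b \<in> D \<Longrightarrow> content b = 0 \<Longrightarrow> b = (r, r)"
  using zero_box_unique[OF skew nonneg _ corner] by (simp add: content_def)

text \<open>\<open>refl q\<close> sends the corner to (q - r, q - r): to its upper left neighbour on
  the diagonal, to itself, or to its lower right neighbour. Only in the second case does
  \<open>D\<close> meet its mirror image, and then only in the corner.\<close>

lemma refl_in_D:
  assumes q: "q \<in> {2*r - 1, 2*r, 2*r + 1}" and "b \<in> D" "refl q b \<in> D"
  shows "q = 2*r \<and> b = (r, r)"
  using bounds[OF assms(2)] bounds[OF assms(3)] q by (auto simp: prod_eq_iff)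

text \<open>The type of a signed tableau tells into which summand it degenerates: the reflected corner box, with entry
  -k, fits to the upper left of the corner (vertical cut), to its lower right (horizontal cut), or the two
  corners have to be merged.\<close>

definition up_type :: "filling \<Rightarrow> bool" where
  "up_type T \<longleftrightarrow> (\<exists>k x. T (r, r) = {k} \<and> T (r - 1, r) = {x} \<and> - k < x)"

definition right_type :: "filling \<Rightarrow> bool" where
  "right_type T \<longleftrightarrow> (\<exists>k x. T (r, r) = {k} \<and> T (r, r + 1) = {x} \<and> x < - k)"

text \<open>If the corner and its mirror image are distinct, convexity of the union demands the two
  boxes completing their 2 x 2 square; one of these is named here and the other one is its
  reflection.\<close>

definition admissible :: "int \<Rightarrow> bool" where
  "admissible q \<longleftrightarrow> q = 2*r \<or> (q = 2*r - 1 \<and> (r - 1, r) \<in> D) \<or> (q = 2*r + 1 \<and> (r, r + 1) \<in> D)"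

lemma double_diagram:
  assumes q: "admissible q"
  shows "is_skew_diagram (D \<union> refl q ` D)"
  unfolding is_skew_diagram_def
proof (intro conjI allI impI)
  show "finite (D \<union> refl q ` D)" using skew by (simp add: is_skew_diagram_def)
  fix a c a' c' \<alpha> \<gamma>
  assume A: "(a, c) \<in> D \<union> refl q ` D \<and> (a', c') \<in> D \<union> refl q ` D \<and> a \<le> \<alpha> \<and> \<alpha> \<le> a' \<and> c \<le> \<gamma> \<and> \<gamma> \<le> c'"
  then have le: "a \<le> \<alpha>" "\<alpha> \<le> a'" "c \<le> \<gamma>" "\<gamma> \<le> c'" by auto
  have btw: "(\<alpha>, \<gamma>) \<in> D" if "(x, y) \<in> D" "(x', y') \<in> D" "x \<le> \<alpha>" "\<alpha> \<le> x'" "y \<le> \<gamma>" "\<gamma> \<le> y'" for x y x' y'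
    by (rule skew_between[OF skew that(1,2)]) (use that in auto)
  have btw': "(\<alpha>, \<gamma>) \<in> refl q ` D"
    if "(x, y) \<in> D" "(x', y') \<in> D" "x \<le> q - \<alpha>" "q - \<alpha> \<le> x'" "y \<le> q - \<gamma>" "q - \<gamma> \<le> y'" for x y x' y'
    unfolding refl_mem refl_def by (rule skew_between[OF skew that(1,2)]) (use that in auto)
  consider (DD) "(a, c) \<in> D" "(a', c') \<in> D" | (NN) "(q - a, q - c) \<in> D" "(q - a', q - c') \<in> D"
    | (DN) "(a, c) \<in> D" "(q - a', q - c') \<in> D" | (ND) "(q - a, q - c) \<in> D" "(a', c') \<in> D"
    using A unfolding Un_iff refl_mem by (auto simp: refl_def)
  then show "(\<alpha>, \<gamma>) \<in> D \<union> refl q ` D"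
  proof cases
    case DD
    then show ?thesis using btw le by blast
  next
    case NN
    then show ?thesis using btw'[OF NN(2,1)] le by simp
  next
    case DN
    \<comment> \<open>The bounds confine \<gamma> to the columns from r to q - r. The rows up to r
      then belong to \<open>D\<close> and the lower ones to its mirror image; the case
      \<open>ND\<close> is analogous, with rows and columns exchanged.\<close>
    note b = bounds[OF DN(1)] bounds[OF DN(2)]
    consider "q = 2*r" | "q = 2*r + 1" "(r, r + 1) \<in> D" using q b le by (auto simp: admissible_def)
    then show ?thesis
    proof cases
      case 1
      show ?thesis
      proof (cases "\<alpha> \<le> r")
        case True
        then have "(\<alpha>, \<gamma>) \<in> D" using btw[OF DN(1) corner] b le 1 by simp
        then show ?thesis by simp
      next
        case False
        then have "(\<alpha>, \<gamma>) \<in> refl q ` D" using btw'[OF DN(2) corner] b le 1 by simp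
        then show ?thesis by simp
      qed
    next
      case 2
      show ?thesis
      proof (cases "\<alpha> \<le> r")
        case True
        then have "(\<alpha>, \<gamma>) \<in> D" using btw[OF DN(1) 2(2)] b le 2 by simp
        then show ?thesis by simp
      next
        case False
        then have "(\<alpha>, \<gamma>) \<in> refl q ` D" using btw'[OF DN(2) 2(2)] b le 2 by simp
        then show ?thesis by simp
      qed
    qed
  next
    case ND
    note b = bounds[OF ND(1)] bounds[OF ND(2)]
    consider "q = 2*r" | "q = 2*r - 1" "(r - 1, r) \<in> D" using q b le by (auto simp: admissible_def)
    then show ?thesis
    proof cases
      case 1
      show ?thesis
      proof (cases "r \<le> \<gamma>")
        case True
        then have "(\<alpha>, \<gamma>) \<in> D" using btw[OF corner ND(2)] b le 1 by simp
        then show ?thesis by simp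
      next
        case False
        then have "(\<alpha>, \<gamma>) \<in> refl q ` D" using btw'[OF corner ND(1)] b le 1 by simp
        then show ?thesis by simp
      qed
    next
      case 2
      show ?thesis
      proof (cases "r \<le> \<gamma>")
        case True
        then have "(\<alpha>, \<gamma>) \<in> D" using btw[OF 2(2) ND(2)] b le 2 by simp
        then show ?thesis by simp
      next
        case False
        then have "(\<alpha>, \<gamma>) \<in> refl q ` D" using btw'[OF 2(2) ND(1)] b le 2 by simp
        then show ?thesis by simp
      qed
    qed
  qed
qed

context
  fixes T q
  assumes T: "signed_filling D T" and q: "q \<in> {2*r - 1, 2*r, 2*r + 1}"
begin

lemma T_outside: "b \<notin> D \<Longrightarrow> T b = {}"
  using T by (auto simp: signed_filling_def diagram_def)

lemma T_inside: "b \<in> D \<Longrightarrow> T b \<noteq> {}"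
  using T by (auto simp: signed_filling_def diagram_def)

lemma double_inside: "b \<in> D \<Longrightarrow> q \<noteq> 2*r \<or> b \<noteq> (r, r) \<Longrightarrow> double q T b = T b"
  using refl_in_D[OF q, of b] T_outside[of "refl q b"] by (cases "refl q b \<in> D") (simp_all add: double_def)

lemma double_corner: "q = 2*r \<Longrightarrow> T (r, r) = {k} \<Longrightarrow> double q T (r, r) = {k, - k}"
  by (auto simp: double_def refl_def)

lemma diagram_double: "diagram (double q T) = D \<union> refl q ` D"
proof -
  have "double q T b \<noteq> {} \<longleftrightarrow> b \<in> D \<or> refl q b \<in> D" for b
    using T_outside[of b] T_inside[of b] T_outside[of "refl q b"] T_inside[of "refl q b"]
    by (cases "b \<in> D"; cases "refl q b \<in> D") (simp_all add: double_def)
  then show ?thesis unfolding diagram_def by (simp add: refl_mem[symmetric] Collect_disj_eq)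
qed

lemma double_unique:
  assumes "T b = {k}"
  shows "k \<in> double q T c \<longleftrightarrow> c = b" "- k \<in> double q T c \<longleftrightarrow> c = refl q b"
proof -
  have k: "k \<noteq> 0" using signed_filling_in[OF T assms] by (auto simp: signed_def)
  have pos: "k \<in> T c \<longleftrightarrow> c = b" for c
  proof
    assume "k \<in> T c"
    then show "c = b" using signed_filling_unique[OF T signed_filling_single[OF T] assms] by simp
  qed (simp add: assms)
  have neg: "- k \<notin> T c" for c
  proof
    assume "- k \<in> T c"
    then have c: "T c = {- k}" by (rule signed_filling_single[OF T])
    then show False using signed_filling_unique[OF T c assms] assms k by auto
  qed
  show "k \<in> double q T c \<longleftrightarrow> c = b" using pos neg by (simp add: double_mem)
  show "- k \<in> double q T c \<longleftrightarrow> c = refl q b"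
    using pos neg by (simp add: double_mem) (metis refl_simps(1))
qed

lemma cvec_double:
  assumes k: "k \<in> signed (card D)"
  shows "real_of_int (cvec (double q T) k) = shifted_content 0 T k"
  using T k
proof (cases rule: signed_filling_cases)
  case (1 b)
  have "cvec (double q T) k = content b" by (rule cvec_eq) (simp_all add: double_unique[OF 1])
  then show ?thesis using shifted_content_pos[OF T 1, of 0] by simp
next
  case (2 b)
  have "cvec (double q T) k = content (refl q b)"
    using double_unique(2)[OF 2] by (intro cvec_eq) auto
  then show ?thesis using shifted_content_neg[OF T 2, of 0] by simp
qed

lemma fval_double:
  assumes i: "i \<in> gens (card D)"
  shows "fval (double q T) i = fval T i"
proof -
  have s: "1 \<in> signed (card D)" "2 \<in> signed (card D)" "i \<noteq> 0 \<Longrightarrow> int i \<in> signed (card D)" "int i + 1 \<in> signed (card D)"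
    using i by (auto simp: gens_def signed_def split: if_splits)
  have c: "cvec (double q T) k = cvec T k" if "k \<in> signed (card D)" for k
    using cvec_double[OF that] by (simp add: shifted_content_def split: if_splits)
  show ?thesis using s by (simp add: fval_def c)
qed

lemma double_DYoung:
  assumes "admissible q"
  shows "is_DYoung (card D) (double q T)"
  unfolding is_DYoung_def
proof (intro conjI allI ballI)
  show "is_skew_diagram (diagram (double q T))" unfolding diagram_double by (rule double_diagram[OF assms])
  have sub: "T b \<subseteq> signed (card D)" for b using T unfolding signed_filling_def by blast
  show "double q T b \<subseteq> signed (card D)" for b
  proof
    fix k assume "k \<in> double q T b"
    then have "k \<in> T b \<or> - k \<in> T (refl q b)" by (simp add: double_mem)
    then have "k \<in> signed (card D) \<or> - k \<in> signed (card D)" using sub by blast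
    then show "k \<in> signed (card D)" by (simp add: signed_minus)
  qed
  show "\<exists>!b. k \<in> double q T b" if "k \<in> signed (card D)" for k
    using T that
  proof (cases rule: signed_filling_cases)
    case (1 b)
    then show ?thesis by (simp add: double_unique[OF 1])
  next
    case (2 b)
    then show ?thesis using double_unique(2)[OF 2] by simp
  qed
  show "card (double q T b) = 1 \<or> (content b = 0 \<and> (\<exists>i>0. double q T b = {i, - i}))" if "b \<in> diagram (double q T)" for b
  proof -
    have *: "card (double q T b) = 1 \<or> (content b = 0 \<and> (\<exists>i>0. double q T b = {i, - i}))" if "b \<in> D" for b
    proof (cases "q = 2*r \<and> b = (r, r)")
      case True
      obtain k where k: "T (r, r) = {k}" by (rule signed_filling_obtain[OF T corner])
      have "k \<noteq> 0" using signed_filling_in[OF T k] by (auto simp: signed_def)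
      then have "\<bar>k\<bar> > 0" "{k, - k} = {\<bar>k\<bar>, - \<bar>k\<bar>}" by (auto simp: abs_if)
      moreover have "double q T b = {k, - k}" using double_corner[OF conjunct1[OF True] k] True by simp
      moreover have "content b = 0" using True by (simp add: content_def)
      ultimately show ?thesis by metis
    next
      case False
      note bD = that
      obtain k where k: "T b = {k}" by (rule signed_filling_obtain[OF T bD])
      then show ?thesis using double_inside[OF bD] False by auto
    qed
    show ?thesis
    proof (cases "b \<in> D")
      case True
      then show ?thesis by (rule *)
    next
      case False
      then have "b \<in> refl q ` D" using that unfolding diagram_double by blast
      then have b: "refl q b \<in> D" by (simp only: refl_mem)
      have e: "double q T b = uminus ` double q T (refl q b)" using double_refl[of q T "refl q b"] by simp
      have "card (uminus ` A) = card A" for A :: "int set" by (rule card_image) simp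
      moreover have "\<exists>i>0. uminus ` A = {i, - i}" if "\<exists>i>0. A = {i, - i}" for A :: "int set"
        using that by auto
      ultimately show ?thesis using *[OF b] unfolding e by (simp, blast)
    qed
  qed
  show "cvec (double q T) (- k) = - cvec (double q T) k" if k: "k \<in> signed (card D)" for k
  proof -
    have "- k \<in> signed (card D)" using k by (simp add: signed_minus)
    from cvec_double[OF this] cvec_double[OF k] shifted_content_minus[OF T k, of 0]
    have "real_of_int (cvec (double q T) (- k)) = real_of_int (- cvec (double q T) k)" by simp
    then show ?thesis by linarith
  qed
  show "\<exists>q'. \<forall>b. double q T (refl q' b) = uminus ` double q T b" using double_refl by blast
qed

end

end

section \<open>Standardness of doubled fillings\<close>

abbreviation before :: "box \<Rightarrow> box \<Rightarrow> bool" where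
  "before b b' \<equiv> (fst b = fst b' \<and> snd b < snd b') \<or> (snd b = snd b' \<and> fst b < fst b')"

text \<open>Turns the Max/Min convention for a pair into a comparison of all entries, so that a
  merged corner needs no separate treatment.\<close>

lemma standard_iff:
  assumes fin: "\<And>b. finite (F b)"
  shows "is_standard F \<longleftrightarrow> (\<forall>b b'. before b b' \<longrightarrow> (\<forall>x\<in>F b. \<forall>y\<in>F b'. x < y))"
proof (intro iffI allI impI ballI)
  fix b b' x y assume S: "is_standard F" and bb: "before b b'" and xy: "x \<in> F b" "y \<in> F b'"
  have "b \<in> diagram F" "b' \<in> diagram F" using xy by (auto simp: diagram_def)
  then have "Max (F b) < Min (F b')" using S bb unfolding is_standard_def by blast
  then show "x < y" using Max_ge[OF fin xy(1)] Min_le[OF fin xy(2)] by linarith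
next
  assume R: "\<forall>b b'. before b b' \<longrightarrow> (\<forall>x\<in>F b. \<forall>y\<in>F b'. x < y)"
  show "is_standard F"
    unfolding is_standard_def
  proof (intro ballI impI)
    fix b b' assume b: "b \<in> diagram F" "b' \<in> diagram F" "before b b'"
    then have "Max (F b) \<in> F b" "Min (F b') \<in> F b'" using fin by (auto simp: diagram_def)
    then show "Max (F b) < Min (F b')" using R b(3) by blast
  qed
qed

lemma signed_filling_finite: "signed_filling D T \<Longrightarrow> finite (T b)"
  by (rule finite_subset[OF _ finite_signed[of "card D"]]) (unfold signed_filling_def, blast)

text \<open>Comparisons within \<open>D\<close> or within the mirror image are inherited from T. A
  mirror entry has the form -z with z an entry of T, so the mixed comparisons become the signs of x
  + z.\<close>

lemma double_standardI:
  assumes T: "signed_filling D T" "is_standard T"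
    and DN: "\<And>b c x z. T b = {x} \<Longrightarrow> T c = {z} \<Longrightarrow> before b (refl q c) \<Longrightarrow> x + z < 0"
    and ND: "\<And>b c y z. T b = {y} \<Longrightarrow> T c = {z} \<Longrightarrow> before (refl q c) b \<Longrightarrow> 0 < y + z"
  shows "is_standard (double q T)"
proof -
  have fin: "finite (T b)" for b by (rule signed_filling_finite[OF T(1)])
  then have fin': "finite (double q T b)" for b by (simp add: double_def)
  have std: "x < y" if "before b b'" "x \<in> T b" "y \<in> T b'" for b b' x y
    using T(2) that unfolding standard_iff[OF fin] by blast
  show ?thesis
    unfolding standard_iff[OF fin']
  proof (intro allI impI ballI)
    fix b b' x y assume b: "before b b'" and xy: "x \<in> double q T b" "y \<in> double q T b'"
    have b': "before (refl q b') (refl q b)" using b by auto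
    note single = signed_filling_single[OF T(1)]
    consider "x \<in> T b" "y \<in> T b'" | "- x \<in> T (refl q b)" "- y \<in> T (refl q b')"
      | "x \<in> T b" "- y \<in> T (refl q b')" | "- x \<in> T (refl q b)" "y \<in> T b'"
      using xy unfolding double_mem by blast
    then show "x < y"
    proof cases
      case 1
      then show ?thesis using std b by blast
    next
      case 2
      then show ?thesis using std[OF b'] by fastforce
    next
      case 3
      then show ?thesis using DN[OF single single, of x b "- y" "refl q b'"] b by simp
    next
      case 4
      then show ?thesis using ND[OF single single, of y b' "- x" "refl q b"] b by simp
    qed
  qed
qed

context corner_diagram
begin

lemma std_le:
  assumes "signed_filling D T" "is_standard T" "T b = {x}" "T b' = {y}" "fst b \<le> fst b'" "snd b \<le> snd b'"
  shows "x \<le> y"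
proof (cases "b = b'")
  case False
  then show ?thesis using std_mono[OF skew assms] by simp
qed (use assms in simp)

text \<open>\<open>D\<close> and its mirror image occupy disjoint sets of columns and share only the
  rows r - 1 and r. Entries of \<open>D\<close> in these rows are at least u and k respectively, and
  k + u > 0.\<close>

lemma up_standard:
  assumes T: "signed_filling D T" "is_standard T" and "up_type T"
  shows "is_standard (double (2*r - 1) T)"
proof -
  obtain k u where k: "T (r, r) = {k}" and u: "T (r - 1, r) = {u}" and ku: "- k < u"
    using assms(3) unfolding up_type_def by blast
  show ?thesis
  proof (rule double_standardI[OF T])
    fix b c x z assume b: "T b = {x}" and c: "T c = {z}" and rel: "before b (refl (2*r - 1) c)"
    have "b \<in> D" "c \<in> D" using signed_filling_in[OF T(1)] b c by auto
    then show "x + z < 0" using bounds[of b] bounds[of c] rel by auto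
  next
    fix b c x z assume b: "T b = {x}" and c: "T c = {z}" and rel: "before (refl (2*r - 1) c) b"
    have bc: "b \<in> D" "c \<in> D" using signed_filling_in[OF T(1)] b c by auto
    have "fst b = 2*r - 1 - fst c" using bounds[OF bc(1)] bounds[OF bc(2)] rel by auto
    then have "fst b = r \<and> fst c = r - 1 \<or> fst b = r - 1 \<and> fst c = r"
      using bounds[OF bc(1)] bounds[OF bc(2)] by linarith
    then show "0 < x + z"
    proof
      assume e: "fst b = r \<and> fst c = r - 1"
      have "k \<le> x" by (rule std_le[OF T k b]) (use e bounds[OF bc(1)] in auto)
      moreover have "u \<le> z" by (rule std_le[OF T u c]) (use e bounds[OF bc(2)] in auto)
      ultimately show ?thesis using ku by linarith
    next
      assume e: "fst b = r - 1 \<and> fst c = r"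
      have "u \<le> x" by (rule std_le[OF T u b]) (use e bounds[OF bc(1)] in auto)
      moreover have "k \<le> z" by (rule std_le[OF T k c]) (use e bounds[OF bc(2)] in auto)
      ultimately show ?thesis using ku by linarith
    qed
  qed
qed

text \<open>Now only the columns r and r + 1 are shared; the entries of \<open>D\<close> in them are
  at most k and u respectively, and k + u < 0.\<close>

lemma right_standard:
  assumes T: "signed_filling D T" "is_standard T" and "right_type T"
  shows "is_standard (double (2*r + 1) T)"
proof -
  obtain k u where k: "T (r, r) = {k}" and u: "T (r, r + 1) = {u}" and ku: "u < - k"
    using assms(3) unfolding right_type_def by blast
  show ?thesis
  proof (rule double_standardI[OF T])
    fix b c x z assume b: "T b = {x}" and c: "T c = {z}" and rel: "before (refl (2*r + 1) c) b"
    have "b \<in> D" "c \<in> D" using signed_filling_in[OF T(1)] b c by auto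
    then show "0 < x + z" using bounds[of b] bounds[of c] rel by auto
  next
    fix b c x z assume b: "T b = {x}" and c: "T c = {z}" and rel: "before b (refl (2*r + 1) c)"
    have bc: "b \<in> D" "c \<in> D" using signed_filling_in[OF T(1)] b c by auto
    have "snd b = 2*r + 1 - snd c" using bounds[OF bc(1)] bounds[OF bc(2)] rel by auto
    then have "snd b = r \<and> snd c = r + 1 \<or> snd b = r + 1 \<and> snd c = r"
      using bounds[OF bc(1)] bounds[OF bc(2)] by linarith
    then show "x + z < 0"
    proof
      assume e: "snd b = r \<and> snd c = r + 1"
      have "x \<le> k" by (rule std_le[OF T b k]) (use e bounds[OF bc(1)] in auto)
      moreover have "z \<le> u" by (rule std_le[OF T c u]) (use e bounds[OF bc(2)] in auto)
      ultimately show ?thesis using ku by linarith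
    next
      assume e: "snd b = r + 1 \<and> snd c = r"
      have "x \<le> u" by (rule std_le[OF T b u]) (use e bounds[OF bc(1)] in auto)
      moreover have "z \<le> k" by (rule std_le[OF T c k]) (use e bounds[OF bc(2)] in auto)
      ultimately show ?thesis using ku by linarith
    qed
  qed
qed

text \<open>When both types fail, the entry above the corner is below k and -k, and the entry to its
  right is above both; equality with -k is impossible since distinct boxes have distinct absolute
  values. This is just what the pair in the merged corner requires.\<close>

lemma box_standard:
  assumes T: "signed_filling D T" "is_standard T" and nup: "\<not> up_type T" and nright: "\<not> right_type T"
  shows "is_standard (double (2*r) T)"
proof -
  obtain k where k: "T (r, r) = {k}" by (rule signed_filling_obtain[OF T(1) corner])
  have col: "x < k \<and> x < - k" if b: "T b = {x}" "snd b = r" "b \<noteq> (r, r)" for b x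
  proof -
    have bD: "b \<in> D" using signed_filling_in[OF T(1) b(1)] by simp
    have lt: "fst b < r" using bounds[OF bD] b(2,3) by (cases b) auto
    then have uD: "(r - 1, r) \<in> D" using b(2) by (intro skew_between[OF skew bD corner]) auto
    then obtain u where u: "T (r - 1, r) = {u}" by (rule signed_filling_obtain[OF T(1)])
    have "u < k" by (rule std_less[OF T(2) u k]) simp
    moreover have "u \<noteq> - k" using signed_filling_unique[OF T(1) u k] by auto
    then have "u < - k" using nup k u unfolding up_type_def by force
    moreover have "x \<le> u" by (rule std_le[OF T b(1) u]) (use lt b(2) in auto)
    ultimately show ?thesis by linarith
  qed
  have row: "k < x \<and> - k < x" if b: "T b = {x}" "fst b = r" "b \<noteq> (r, r)" for b x
  proof -
    have bD: "b \<in> D" using signed_filling_in[OF T(1) b(1)] by simp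
    have lt: "r < snd b" using bounds[OF bD] b(2,3) by (cases b) auto
    then have uD: "(r, r + 1) \<in> D" using b(2) by (intro skew_between[OF skew corner bD]) auto
    then obtain u where u: "T (r, r + 1) = {u}" by (rule signed_filling_obtain[OF T(1)])
    have "k < u" by (rule std_less[OF T(2) k u]) simp
    moreover have "u \<noteq> - k" using signed_filling_unique[OF T(1) u k] by auto
    then have "- k < u" using nright k u unfolding right_type_def by force
    moreover have "u \<le> x" by (rule std_le[OF T u b(1)]) (use lt b(2) in auto)
    ultimately show ?thesis by linarith
  qed
  show ?thesis
  proof (rule double_standardI[OF T])
    fix b c x z assume b: "T b = {x}" and c: "T c = {z}" and rel: "before b (refl (2*r) c)"
    have bc: "b \<in> D" "c \<in> D" using signed_filling_in[OF T(1)] b c by auto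
    have e: "snd b = r" "snd c = r" "b \<noteq> (r, r) \<or> c \<noteq> (r, r)"
      using bounds[OF bc(1)] bounds[OF bc(2)] rel by (cases b; cases c; auto)+
    have "b = (r, r) \<Longrightarrow> x = k" "c = (r, r) \<Longrightarrow> z = k" using b c k by auto
    then show "x + z < 0" using col[OF b e(1)] col[OF c e(2)] e(3) by (cases "b = (r, r)"; cases "c = (r, r)") auto
  next
    fix b c x z assume b: "T b = {x}" and c: "T c = {z}" and rel: "before (refl (2*r) c) b"
    have bc: "b \<in> D" "c \<in> D" using signed_filling_in[OF T(1)] b c by auto
    have e: "fst b = r" "fst c = r" "b \<noteq> (r, r) \<or> c \<noteq> (r, r)"
      using bounds[OF bc(1)] bounds[OF bc(2)] rel by (cases b; cases c; auto)+
    have "b = (r, r) \<Longrightarrow> x = k" "c = (r, r) \<Longrightarrow> z = k" using b c k by auto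
    then show "0 < x + z" using row[OF b e(1)] row[OF c e(2)] e(3) by (cases "b = (r, r)"; cases "c = (r, r)") auto
  qed
qed

lemma not_up_and_right:
  assumes "signed_filling D T" "is_standard T"
  shows "\<not> (up_type T \<and> right_type T)"
proof
  assume "up_type T \<and> right_type T"
  then obtain k u v where k: "T (r, r) = {k}" and u: "T (r - 1, r) = {u}" "- k < u" and v: "T (r, r + 1) = {v}" "v < - k"
    unfolding up_type_def right_type_def by force
  have "u < k" by (rule std_less[OF assms(2) u(1) k]) simp
  moreover have "k < v" by (rule std_less[OF assms(2) k v(1)]) simp
  ultimately show False using u(2) v(2) by linarith
qed

lemma zero_boxes_double:
  assumes T: "signed_filling D T" and q: "q \<in> {2*r - 1, 2*r, 2*r + 1}"
  shows "zero_boxes (double q T) = {(r, r), (q - r, q - r)}"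
proof (intro equalityI subsetI)
  fix b assume "b \<in> zero_boxes (double q T)"
  then have b: "b \<in> D \<or> refl q b \<in> D" "content b = 0"
    unfolding zero_boxes_def diagram_double[OF T q] Un_iff refl_mem by auto
  then have "b = (r, r) \<or> refl q b = (r, r)" using zero_box[of b] zero_box[of "refl q b"] by auto
  then show "b \<in> {(r, r), (q - r, q - r)}" by (auto simp: refl_def prod_eq_iff)
next
  fix b assume "b \<in> {(r, r), (q - r, q - r)}"
  then show "b \<in> zero_boxes (double q T)"
    unfolding zero_boxes_def diagram_double[OF T q] Un_iff refl_mem using corner
    by (auto simp: refl_def content_def)
qed

text \<open>The inverse of doubling. \<open>split\<close> compares \<open>F\<close> with the double
  of T because a merged corner keeps only one sign in T. If i and -i occur in boxes b and b' of T,
  then i also lies in the mirror image of b', which is therefore b; so both boxes are the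
  corner.\<close>

lemma restrict_filling:
  assumes q: "q \<in> {2*r - 1, 2*r, 2*r + 1}"
    and sub: "\<And>b. F b \<subseteq> signed (card D)" and uniq: "\<And>k. k \<in> signed (card D) \<Longrightarrow> \<exists>!b. k \<in> F b"
    and sym: "\<And>b. F (refl q b) = uminus ` F b"
    and cover: "\<And>b. F b \<noteq> {} \<Longrightarrow> b \<notin> D \<Longrightarrow> refl q b \<in> D"
    and inside: "\<And>b. b \<in> D \<Longrightarrow> \<exists>x. T b = {x}" and outside: "\<And>b. b \<notin> D \<Longrightarrow> T b = {}"
    and split: "\<And>b. b \<in> D \<Longrightarrow> F b = double q T b"
  shows "signed_filling D T" "F = double q T" "is_standard F \<Longrightarrow> is_standard T"
proof -
  show eq: "F = double q T"
  proof
    fix b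
    show "F b = double q T b"
    proof (cases "b \<in> D")
      case False
      show ?thesis
      proof (cases "refl q b \<in> D")
        case True
        then show ?thesis using split[OF True] sym[of "refl q b"] double_refl[of q T "refl q b"] by simp
      next
        case False
        then show ?thesis using \<open>b \<notin> D\<close> cover[of b] outside by (auto simp: double_def)
      qed
    qed (rule split)
  qed
  have TF: "x \<in> T b \<Longrightarrow> x \<in> F b" for x b unfolding eq double_mem by simp
  have TD: "x \<in> T b \<Longrightarrow> b \<in> D" for x b using outside[of b] by auto
  have same: "b = b'" if "k \<in> signed (card D)" "k \<in> F b" "k \<in> F b'" for k b b'
    using uniq[OF that(1)] that by blast
  show "signed_filling D T"
    unfolding signed_filling_def
  proof (intro conjI ballI allI impI)
    show "diagram T = D" unfolding diagram_def using inside outside by blast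
    show "\<exists>k. T b = {k}" if "b \<in> D" for b by (rule inside[OF that])
    show "T b \<subseteq> signed (card D)" for b using TF sub by blast
    fix i :: int assume i: "1 \<le> i \<and> i \<le> int (card D)"
    then have i: "i \<in> signed (card D)" "- i \<in> signed (card D)" by (auto simp: signed_def)
    have mixed: "b = b'" if "i \<in> T b" "- i \<in> T b'" for b b'
    proof -
      have "i \<in> F (refl q b')" unfolding sym using TF[OF that(2)] by force
      then have "b = refl q b'" using same[OF i(1) TF[OF that(1)]] by simp
      then show ?thesis using refl_in_D[OF q TD[OF that(2)]] TD[OF that(1)] by (auto simp: refl_def)
    qed
    obtain b where "i \<in> F b" using uniq[OF i(1)] by blast
    then have "\<exists>b. i \<in> T b \<or> - i \<in> T b" unfolding eq double_mem by blast
    then obtain b where b: "i \<in> T b \<or> - i \<in> T b" by blast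
    show "\<exists>!b. T b \<inter> {i, - i} \<noteq> {}"
    proof (rule ex1I[of _ b])
      show "T b \<inter> {i, - i} \<noteq> {}" using b by blast
      fix b' assume "T b' \<inter> {i, - i} \<noteq> {}"
      then have b': "i \<in> T b' \<or> - i \<in> T b'" by blast
      then show "b' = b" using b mixed[of b b'] mixed[of b' b] same[OF i(1)] same[OF i(2)] TF by metis
    qed
  qed
  show "is_standard T" if "is_standard F"
  proof -
    have fin: "finite (F b)" "finite (T b)" for b
      using finite_subset[OF sub finite_signed] inside[of b] outside[of b] by (auto, cases "b \<in> D", auto)
    show ?thesis using that TF unfolding standard_iff[OF fin(1)] standard_iff[OF fin(2)] by blast
  qed
qed

end

section \<open>Doubling maps the three types of signed tableaux onto the three summands\<close>

lemma DYoung_facts: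
  assumes "is_DYoung n F"
  shows "is_skew_diagram (diagram F)" "F b \<subseteq> signed n" "k \<in> signed n \<Longrightarrow> \<exists>!b. k \<in> F b"
    "b \<in> diagram F \<Longrightarrow> card (F b) = 1 \<or> (content b = 0 \<and> (\<exists>i>0. F b = {i, - i}))"
    "\<exists>q. \<forall>b. F (refl q b) = uminus ` F b"
proof -
  note c1 = assms[unfolded is_DYoung_def]
  note c2 = conjunct2[OF c1]
  note c3 = conjunct2[OF c2]
  note c4 = conjunct2[OF c3]
  show "is_skew_diagram (diagram F)" by (rule conjunct1[OF c1])
  show "F b \<subseteq> signed n" by (rule spec[OF conjunct1[OF c2]])
  show "k \<in> signed n \<Longrightarrow> \<exists>!b. k \<in> F b" by (rule bspec[OF conjunct1[OF c3]])
  show "b \<in> diagram F \<Longrightarrow> card (F b) = 1 \<or> (content b = 0 \<and> (\<exists>i>0. F b = {i, - i}))"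
    by (rule bspec[OF conjunct1[OF c4]])
  show "\<exists>q. \<forall>b. F (refl q b) = uminus ` F b" by (rule conjunct2[OF conjunct2[OF c4]])
qed

lemma neg_count_cong: "(\<And>b. b \<in> P \<Longrightarrow> F b = F' b) \<Longrightarrow> neg_count F P = neg_count F' P"
  by (simp add: neg_count_def)

lemma Collect_separate:
  "(\<And>b. b \<in> A \<Longrightarrow> P b) \<Longrightarrow> (\<And>b. b \<in> B \<Longrightarrow> \<not> P b) \<Longrightarrow> A = {b \<in> A \<union> B. P b}"
  "(\<And>b. b \<in> A \<Longrightarrow> \<not> P b) \<Longrightarrow> (\<And>b. b \<in> B \<Longrightarrow> P b) \<Longrightarrow> B = {b \<in> A \<union> B. P b}"
  by blast+

context corner_diagram
begin

lemma type_admissible: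
  assumes "signed_filling D T"
  shows "up_type T \<Longrightarrow> admissible (2*r - 1)" "right_type T \<Longrightarrow> admissible (2*r + 1)" "admissible (2*r)"
  using signed_filling_in[OF assms, of "(r - 1, r)"] signed_filling_in[OF assms, of "(r, r + 1)"]
  unfolding admissible_def up_type_def right_type_def by blast+

context
  fixes lam :: "box set"
  assumes lam: "place lam 0 = D"
begin

lemma card_lam: "card lam = card D"
  using card_place[of lam 0] lam by simp

lemma double_in_T_box:
  assumes "T \<in> signed_tableaux D s" "\<not> up_type T" "\<not> right_type T"
  shows "double (2*r) T \<in> T_box lam"
proof -
  have T: "signed_filling D T" "is_standard T" using assms(1) by (auto simp: signed_tableaux_def)
  have q: "2*r \<in> {2*r - 1, 2*r, 2*r + 1}" by simp
  have "nonneg_part (double (2*r) T) = D"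
  proof (intro equalityI subsetI)
    fix b assume "b \<in> nonneg_part (double (2*r) T)"
    then have b: "b \<in> D \<or> refl (2*r) b \<in> D" "0 \<le> content b"
      unfolding nonneg_part_def diagram_double[OF T(1) q] Un_iff refl_mem by auto
    show "b \<in> D"
    proof (rule ccontr)
      assume n: "b \<notin> D"
      then have rb: "refl (2*r) b \<in> D" using b by simp
      then have "content (refl (2*r) b) = 0" using nonneg[OF rb] b(2) by simp
      then have "refl (2*r) b = (r, r)" using zero_box[OF rb] by simp
      then have "b = (r, r)" by (auto simp: refl_def prod_eq_iff)
      then show False using n corner by simp
    qed
  next
    fix b assume "b \<in> D"
    then show "b \<in> nonneg_part (double (2*r) T)"
      unfolding nonneg_part_def diagram_double[OF T(1) q] using nonneg by auto
  qed
  moreover have "card (zero_boxes (double (2*r) T)) = 1" unfolding zero_boxes_double[OF T(1) q] by simp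
  ultimately show ?thesis
    using double_DYoung[OF T(1) q type_admissible(3)[OF T(1)]] box_standard[OF T assms(2,3)]
    by (simp add: T_box_def lam card_lam)
qed

text \<open>The reflection fixes the only box of content 0, which forces q = 2 r and a pair in that
  box. Either sign of the pair restores F, and the parity s selects one of them; hence the same set
  \<open>T_box lam\<close> occurs for both parities.\<close>

lemma T_box_double:
  assumes "F \<in> T_box lam"
  shows "\<exists>T\<in>signed_tableaux D s. \<not> up_type T \<and> \<not> right_type T \<and> F = double (2*r) T"
proof -
  have F: "is_DYoung (card D) F" "is_standard F" "card (zero_boxes F) = 1" "nonneg_part F = D"
    using assms by (auto simp: T_box_def lam card_lam)
  note sub = DYoung_facts(2)[OF F(1)] and uniq = DYoung_facts(3)[OF F(1)] and pair = DYoung_facts(4)[OF F(1)]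
  obtain q where "\<forall>b. F (refl q b) = uminus ` F b" using DYoung_facts(5)[OF F(1)] ..
  then have sym: "F (refl q b) = uminus ` F b" for b by (rule spec)
  have refl_dia: "refl q b \<in> diagram F \<longleftrightarrow> b \<in> diagram F" for b by (simp add: diagram_def sym)
  have D: "b \<in> D \<longleftrightarrow> b \<in> diagram F \<and> 0 \<le> content b" for b using F(4) by (auto simp: nonneg_part_def)
  have dia: "(r, r) \<in> diagram F" using corner D by blast
  have z0: "(r, r) \<in> zero_boxes F" using dia by (simp add: zero_boxes_def content_def)
  moreover have "refl q (r, r) \<in> zero_boxes F" using dia refl_dia[of "(r, r)"] by (simp add: zero_boxes_def content_def)
  ultimately have "refl q (r, r) = (r, r)" using F(3) by (metis card_1_singletonE singletonD)
  then have q2: "q = 2*r" by (simp add: refl_def)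
  then have q: "q \<in> {2*r - 1, 2*r, 2*r + 1}" by simp
  have "F (r, r) = uminus ` F (r, r)" using sym[of "(r, r)"] by (simp add: refl_def q2)
  moreover have "0 \<notin> F (r, r)" using sub[of "(r, r)"] by (auto simp: signed_def)
  ultimately have "F (r, r) \<noteq> {x}" for x by auto
  then have "card (F (r, r)) \<noteq> 1" by (metis card_1_singletonE)
  then obtain i where i: "0 < i" "F (r, r) = {i, - i}" using pair[OF dia] by blast
  define R where "R k b = (if b = (r, r) then {k} else if b \<in> D then F b else {})" for k b
  have R: "signed_filling D (R k)" "F = double q (R k)" "is_standard (R k)" if k: "k = i \<or> k = - i" for k
  proof -
    have cover: "refl q b \<in> D" if "F b \<noteq> {}" "b \<notin> D" for b
    proof -
      have "b \<in> diagram F" using that by (simp add: diagram_def)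
      then show ?thesis using that D[of b] D[of "refl q b"] refl_dia[of b] by auto
    qed
    have inside: "\<exists>x. R k b = {x}" if "b \<in> D" for b
    proof (cases "b = (r, r)")
      case False
      then have "content b \<noteq> 0" using zero_box[OF that] by auto
      then have "card (F b) = 1" using pair[of b] that D by blast
      then obtain x where "F b = {x}" by (rule card_1_singletonE)
      then show ?thesis using False that by (simp add: R_def)
    qed (simp add: R_def)
    have outside: "R k b = {}" if "b \<notin> D" for b using that corner by (auto simp: R_def)
    have split: "F b = double q (R k) b" if "b \<in> D" for b
    proof (cases "b = (r, r)")
      case True
      have "refl q (r, r) = (r, r)" by (simp add: q2 refl_def)
      then have "double q (R k) (r, r) = {k, - k}" unfolding double_def by (auto simp: R_def)
      moreover have "{k, - k} = {i, - i}" using k by auto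
      ultimately show ?thesis using True i(2) by simp
    next
      case False
      then have "refl q b \<notin> D" using refl_in_D[OF q that] by blast
      then show ?thesis using False that outside[of "refl q b"] by (simp add: double_def R_def[of k b])
    qed
    note res = restrict_filling[OF q sub uniq sym cover inside outside split]
    show "signed_filling D (R k)" "F = double q (R k)" "is_standard (R k)" using res F(2) by blast+
  qed
  have "even (neg_count (R i) D) \<noteq> even (neg_count (R (- i)) D)"
    by (rule neg_count_flip[where ?b0.0 = "(r, r)" and k = i]) (use R in \<open>auto simp: R_def\<close>)
  then obtain k where k: "k = i \<or> k = - i" "even (neg_count (R k) D) = s" by metis
  have fin: "finite (F b)" for b using finite_subset[OF sub finite_signed] .
  have lt: "x < y" if "before b b'" "x \<in> F b" "y \<in> F b'" for b b' x y
    using F(2) that unfolding standard_iff[OF fin] by blast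
  have RF: "x \<in> R k b \<Longrightarrow> x \<in> F b" for x b using k(1) i by (auto simp: R_def split: if_splits)
  have kk: "R k (r, r) = {k}" "- k \<in> F (r, r)" using k(1) i by (auto simp: R_def)
  have "\<not> up_type (R k)"
  proof
    assume "up_type (R k)"
    then obtain x where x: "x \<in> R k (r - 1, r)" "- k < x" using kk(1) unfolding up_type_def by auto
    have "x < - k" by (rule lt[OF _ RF[OF x(1)] kk(2)]) simp
    then show False using x(2) by simp
  qed
  moreover have "\<not> right_type (R k)"
  proof
    assume "right_type (R k)"
    then obtain x where x: "x \<in> R k (r, r + 1)" "x < - k" using kk(1) unfolding right_type_def by auto
    have "- k < x" by (rule lt[OF _ kk(2) RF[OF x(1)]]) simp
    then show False using x(2) by simp
  qed
  ultimately show ?thesis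
    using R[OF k(1)] k(2) q2 by (intro bexI[of _ "R k"]) (auto simp: signed_tableaux_def)
qed

lemma double_in_T_two:
  assumes "T \<in> signed_tableaux D s" "if vert then up_type T else right_type T"
  shows "double (if vert then 2*r - 1 else 2*r + 1) T \<in> T_two vert lam s"
proof -
  have T: "signed_filling D T" "is_standard T" "even (neg_count T D) = s"
    using assms(1) by (auto simp: signed_tableaux_def)
  define q where "q = (if vert then 2*r - 1 else 2*r + 1)"
  have q: "q \<in> {2*r - 1, 2*r, 2*r + 1}" "q \<noteq> 2*r" by (auto simp: q_def)
  have adm: "admissible q" using type_admissible[OF T(1)] assms(2) by (auto simp: q_def split: if_splits)
  have std: "is_standard (double q T)"
    using up_standard[OF T(1,2)] right_standard[OF T(1,2)] assms(2) by (auto simp: q_def split: if_splits)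
  have card2: "card (zero_boxes (double q T)) = 2"
    unfolding zero_boxes_double[OF T(1) q(1)] using q(2) by simp
  have cN: "card (refl q ` D) = card D" by (rule card_image) (metis inj_onI refl_simps(1))
  have neg: "even (neg_count (double q T) D) = s"
    using T(3) neg_count_cong[of D "double q T" T] double_inside[OF T(1) q(1)] q(2) by simp
  have N: "content b \<le> 0" if "b \<in> refl q ` D" for b using nonneg that by auto
  have "split_ok vert lam s (double q T)"
  proof (cases vert)
    case True
    then have q': "q = 2*r - 1" by (simp add: q_def)
    have bD: "r - 1 < snd b" if "b \<in> D" for b using bounds[OF that] by simp
    have bN: "snd b \<le> r - 1" if "b \<in> refl q ` D" for b using bounds[OF that[unfolded refl_mem]] q' by simp
    have 1: "D = {b \<in> D \<union> refl q ` D. r - 1 < snd b}" and 2: "refl q ` D = {b \<in> D \<union> refl q ` D. snd b \<le> r - 1}"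
      by (rule Collect_separate(1), erule bD, drule bN, simp)
        (rule Collect_separate(2), drule bD, simp, erule bN)
    show ?thesis
      unfolding split_ok_def Let_def diagram_double[OF T(1) q(1)] card_lam lam
    \<comment> \<open>The vertical cut runs between the columns r - 1 and r, with \<open>D\<close>
      on the right.\<close>
    proof (rule exI[of _ "r - 1"], rule exI[of _ D], rule exI[of _ "refl q ` D"], intro conjI)
      show "(D = {b \<in> D \<union> refl q ` D. (if vert then snd b else fst b) \<le> r - 1} \<and>
          refl q ` D = {b \<in> D \<union> refl q ` D. r - 1 < (if vert then snd b else fst b)}) \<or>
        (D = {b \<in> D \<union> refl q ` D. r - 1 < (if vert then snd b else fst b)} \<and>
          refl q ` D = {b \<in> D \<union> refl q ` D. (if vert then snd b else fst b) \<le> r - 1})"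
        unfolding if_P[OF True] by (rule disjI2[OF conjI[OF 1 2]])
    qed (use cN N neg nonneg in blast)+
  next
    case False
    then have q': "q = 2*r + 1" by (simp add: q_def)
    have bD: "fst b \<le> r" if "b \<in> D" for b using bounds[OF that] by simp
    have bN: "r < fst b" if "b \<in> refl q ` D" for b using bounds[OF that[unfolded refl_mem]] q' by simp
    have 1: "D = {b \<in> D \<union> refl q ` D. fst b \<le> r}" and 2: "refl q ` D = {b \<in> D \<union> refl q ` D. r < fst b}"
      by (rule Collect_separate(1), erule bD, drule bN, simp)
        (rule Collect_separate(2), drule bD, simp, erule bN)
    show ?thesis
      unfolding split_ok_def Let_def diagram_double[OF T(1) q(1)] card_lam lam
    \<comment> \<open>The horizontal cut runs below row r, with \<open>D\<close> on top.\<close>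
    proof (rule exI[of _ r], rule exI[of _ D], rule exI[of _ "refl q ` D"], intro conjI)
      show "(D = {b \<in> D \<union> refl q ` D. (if vert then snd b else fst b) \<le> r} \<and>
          refl q ` D = {b \<in> D \<union> refl q ` D. r < (if vert then snd b else fst b)}) \<or>
        (D = {b \<in> D \<union> refl q ` D. r < (if vert then snd b else fst b)} \<and>
          refl q ` D = {b \<in> D \<union> refl q ` D. (if vert then snd b else fst b) \<le> r})"
        unfolding if_not_P[OF False] by (rule disjI1[OF conjI[OF 1 2]])
    qed (use cN N neg nonneg in blast)+
  qed
  then show ?thesis
    using double_DYoung[OF T(1) q(1) adm] std card2 unfolding q_def[symmetric] by (simp add: T_two_def card_lam)
qed

text \<open>Convexity fills the diagonal between the two boxes (r, r) and (w, w) of content 0, so w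
  = r - 1 or w = r + 1. The remaining boxes of their 2 x 2 square have contents 1 and -1 and lie on
  different sides of the cut; a vertical cut cannot separate boxes of one column, nor a horizontal
  one boxes of one row, and this decides the sign.\<close>

lemma T_two_double:
  assumes "F \<in> T_two vert lam s"
  shows "\<exists>T\<in>signed_tableaux D s. (if vert then up_type T else right_type T) \<and>
    F = double (if vert then 2*r - 1 else 2*r + 1) T"
proof -
  have F: "is_DYoung (card D) F" "is_standard F" "card (zero_boxes F) = 2" "split_ok vert lam s F"
    using assms by (auto simp: T_two_def card_lam)
  note skewF = DYoung_facts(1)[OF F(1)]
  note sub = DYoung_facts(2)[OF F(1)] and uniq = DYoung_facts(3)[OF F(1)] and pair = DYoung_facts(4)[OF F(1)]
  obtain q where "\<forall>b. F (refl q b) = uminus ` F b" using DYoung_facts(5)[OF F(1)] ..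
  then have sym: "F (refl q b) = uminus ` F b" for b by (rule spec)
  have refl_dia: "refl q b \<in> diagram F \<longleftrightarrow> b \<in> diagram F" for b by (simp add: diagram_def sym)
  define \<kappa> where "\<kappa> b = (if vert then snd b else fst b)" for b :: box
  obtain a N where PN: "D = {b\<in>diagram F. \<kappa> b \<le> a} \<and> N = {b\<in>diagram F. a < \<kappa> b} \<or>
      D = {b\<in>diagram F. a < \<kappa> b} \<and> N = {b\<in>diagram F. \<kappa> b \<le> a}"
    and N: "\<forall>b\<in>N. content b \<le> 0" and even: "even (neg_count F D) = s"
    using F(4) unfolding split_ok_def Let_def lam \<kappa>_def by blast
  have dia: "b \<in> diagram F \<longleftrightarrow> b \<in> D \<or> b \<in> N" for b using PN by auto
  have sep: "\<kappa> b \<noteq> \<kappa> b'" if "b \<in> D" "b' \<in> N" for b b' using PN that by auto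
  have posD: "b \<in> D" if "b \<in> diagram F" "0 < content b" for b using that dia[of b] bspec[OF N, of b] by auto
  have negN: "b \<in> N" if "b \<in> diagram F" "content b < 0" for b using that dia[of b] nonneg[of b] by auto
  have b0: "(r, r) \<in> zero_boxes F" using corner dia by (simp add: zero_boxes_def content_def)
  have zrefl: "refl q b \<in> zero_boxes F" if "b \<in> zero_boxes F" for b
    using that refl_dia[of b] by (simp add: zero_boxes_def)
  have diag: "snd b = fst b" if "b \<in> zero_boxes F" for b using that by (simp add: zero_boxes_def content_def)
  obtain b1 where Z: "zero_boxes F = {(r, r), b1}" "b1 \<noteq> (r, r)"
  proof -
    obtain x y where xy: "zero_boxes F = {x, y}" "x \<noteq> y" using F(3) unfolding card_2_iff by blast
    then have "x = (r, r) \<or> y = (r, r)" using b0 by auto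
    then show thesis
    proof
      assume "x = (r, r)"
      then show thesis using that[of y] xy by simp
    next
      assume "y = (r, r)"
      then show thesis using that[of x] xy insert_commute[of x y "{}"] by simp
    qed
  qed
  define w where "w = fst b1"
  have b1: "b1 = (w, w)" using diag[of b1] Z by (simp add: w_def prod_eq_iff)
  have wr: "w \<noteq> r" using Z b1 by auto
  have "refl q (r, r) \<in> {(r, r), (w, w)}" "refl q (w, w) \<in> {(r, r), (w, w)}"
    using zrefl[of "(r, r)"] zrefl[of b1] Z(1) b1 by auto
  \<comment> \<open>A point reflection fixes at most one box, so it exchanges the two boxes of
    content 0.\<close>
  then have qw: "q = r + w" using wr by (auto simp: refl_def)
  have rD: "(r, r) \<in> diagram F" "(w, w) \<in> diagram F" using b0 Z b1 by (auto simp: zero_boxes_def)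
  have between: "v \<in> {r, w}" if "(v, v) \<in> diagram F" for v
  proof -
    have "(v, v) \<in> zero_boxes F" using that by (simp add: zero_boxes_def content_def)
    then show ?thesis using Z(1) b1 by auto
  qed
  have adj: "w = (if vert then r - 1 else r + 1) \<and> (if vert then (r - 1, r) \<in> D else (r, r + 1) \<in> D)"
  proof (cases "r < w")
    case True
    have "(r + 1, r + 1) \<in> diagram F" using True by (intro skew_between[OF skewF rD]) auto
    then have w: "w = r + 1" using between[of "r + 1"] by auto
    have "(r, r + 1) \<in> diagram F" "(r + 1, r) \<in> diagram F"
      using w by (auto intro!: skew_between[OF skewF rD])
    then have "(r, r + 1) \<in> D" "(r + 1, r) \<in> N" using posD negN by (auto simp: content_def)
    then show ?thesis using w sep[OF corner, of "(r + 1, r)"] by (cases vert) (auto simp: \<kappa>_def)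
  next
    case False
    then have lt: "w < r" using wr by simp
    have "(r - 1, r - 1) \<in> diagram F" using lt by (intro skew_between[OF skewF rD(2,1)]) auto
    then have w: "w = r - 1" using between[of "r - 1"] by auto
    have "(r - 1, r) \<in> diagram F" "(r, r - 1) \<in> diagram F"
      using w by (auto intro!: skew_between[OF skewF rD(2,1)])
    then have "(r - 1, r) \<in> D" "(r, r - 1) \<in> N" using posD negN by (auto simp: content_def)
    then show ?thesis using w sep[OF corner, of "(r, r - 1)"] by (cases vert) (auto simp: \<kappa>_def)
  qed
  then have qeq: "q = (if vert then 2*r - 1 else 2*r + 1)" using qw by auto
  then have q: "q \<in> {2*r - 1, 2*r, 2*r + 1}" "q \<noteq> 2*r" by auto
  define R where "R b = (if b \<in> D then F b else {})" for b
  have cover: "refl q b \<in> D" if "F b \<noteq> {}" "b \<notin> D" for b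
  proof -
    have b: "b \<in> diagram F" using that by (simp add: diagram_def)
    then have c: "content b \<le> 0" using that dia N by blast
    show ?thesis
    proof (cases "content b = 0")
      case True
      then have "b \<in> zero_boxes F" using b by (simp add: zero_boxes_def)
      then have "b = (w, w)" using Z(1) b1 that(2) corner by auto
      then show ?thesis using corner by (simp add: refl_def qw)
    next
      case False
      then show ?thesis using c b posD[of "refl q b"] refl_dia[of b] by simp
    qed
  qed
  have notD: "refl q b \<notin> D" if "b \<in> D" for b using refl_in_D[OF q(1) that] q(2) by blast
  have inside: "\<exists>x. R b = {x}" if "b \<in> D" for b
  proof -
    \<comment> \<open>A pair would reappear in the mirror box, which is a different box since the
      reflection has no fixed box in \<open>D\<close>.\<close>
    have "card (F b) = 1"
    proof (rule ccontr)
      assume "card (F b) \<noteq> 1"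
      moreover have "b \<in> diagram F" using that dia by blast
      ultimately obtain i where i: "0 < i" "F b = {i, - i}" using pair[of b] by blast
      have "F (refl q b) = {i, - i}" using sym[of b] i by auto
      moreover have "i \<in> signed (card D)" using i sub[of b] by simp
      ultimately have "refl q b = b" using uniq[of i] i(2) by blast
      then show False using notD[OF that] that by simp
    qed
    then obtain x where "F b = {x}" by (rule card_1_singletonE)
    then show ?thesis using that by (simp add: R_def)
  qed
  have outside: "R b = {}" if "b \<notin> D" for b using that by (simp add: R_def)
  have split: "F b = double q R b" if "b \<in> D" for b
    using that notD[OF that] by (simp add: double_def R_def)
  note res = restrict_filling[OF q(1) sub uniq sym cover inside outside split]
  have RD: "signed_filling D R" "F = double q R" "is_standard R" using res F(2) by blast+
  have "neg_count R D = neg_count F D" by (rule neg_count_cong) (simp add: R_def)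
  then have RS: "R \<in> signed_tableaux D s" using RD even by (simp add: signed_tableaux_def)
  obtain k where k: "R (r, r) = {k}" by (rule signed_filling_obtain[OF RD(1) corner])
  have fin: "finite (F b)" for b using finite_subset[OF sub finite_signed] .
  have lt: "x < y" if "before b b'" "x \<in> F b" "y \<in> F b'" for b b' x y
    using F(2) that unfolding standard_iff[OF fin] by blast
  have "k \<in> F (r, r)" using k corner by (simp add: R_def)
  moreover have "refl q (r, r) = (w, w)" by (simp add: refl_def qw)
  ultimately have mk: "- k \<in> F (w, w)" using sym[of "(r, r)"] by auto
  have "if vert then up_type R else right_type R"
  proof (cases vert)
    case True
    then have uD: "(r - 1, r) \<in> D" and w: "w = r - 1" using adj by auto
    obtain u where u: "R (r - 1, r) = {u}" by (rule signed_filling_obtain[OF RD(1) uD])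
    then have "u \<in> F (r - 1, r)" using uD by (simp add: R_def)
    then have "- k < u" using lt[of "(w, w)" "(r - 1, r)" "- k" u] mk w by simp
    then show ?thesis using True k u by (auto simp: up_type_def)
  next
    case False
    then have uD: "(r, r + 1) \<in> D" and w: "w = r + 1" using adj by auto
    obtain u where u: "R (r, r + 1) = {u}" by (rule signed_filling_obtain[OF RD(1) uD])
    then have "u \<in> F (r, r + 1)" using uD by (simp add: R_def)
    then have "u < - k" using lt[of "(r, r + 1)" "(w, w)" u "- k"] mk w by simp
    then show ?thesis using False k u by (auto simp: right_type_def)
  qed
  then show ?thesis using RS RD(2) qeq by blast
qed

text \<open>Doubling forgets at most the sign of the corner entry, and the parity recovers
  it.\<close>

lemma double_inj:
  assumes T: "signed_filling D T" "signed_filling D T'" and par: "even (neg_count T D) = even (neg_count T' D)"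
    and q: "q \<in> {2*r - 1, 2*r, 2*r + 1}" and eq: "double q T = double q T'"
  shows "T = T'"
proof -
  obtain k k' where k: "T (r, r) = {k}" "T' (r, r) = {k'}"
    using signed_filling_obtain[OF T(1) corner] signed_filling_obtain[OF T(2) corner] by metis
  have same: "T b = T' b" if "q \<noteq> 2*r \<or> b \<noteq> (r, r)" for b
  proof (cases "b \<in> D")
    case True
    then show ?thesis using double_inside[OF T(1) q True that] double_inside[OF T(2) q True that] eq by simp
  next
    case False
    then show ?thesis using T_outside[OF T(1) q False] T_outside[OF T(2) q False] by simp
  qed
  have "T (r, r) = T' (r, r)"
  proof (cases "q = 2*r")
    case True
    have "{k, - k} = {k', - k'}"
      using double_corner[OF T(1) q True k(1)] double_corner[OF T(2) q True k(2)] eq by simp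
    then have "k' = k \<or> k' = - k" by auto
    moreover have "k' \<noteq> - k"
    proof
      assume "k' = - k"
      then have "even (neg_count T D) \<noteq> even (neg_count T' D)"
        using neg_count_flip[OF T, of "(r, r)" k] same k by simp
      then show False using par by simp
    qed
    ultimately show ?thesis using k by simp
  qed (simp add: same)
  then show ?thesis using same by (intro ext) metis
qed

text \<open>The source of the block structure: the type is the order of -k, of content 0, and an
  entry in a box of content 1. A generator reversing this order has, by \<open>swap_fval\<close>,
  the absolute value 1 - 0 for f_i.\<close>

lemma type_change:
  assumes T: "signed_filling D T" and i: "i \<in> gens (card D)"
    and change: "up_type T \<noteq> up_type (act (gen i) T) \<or> right_type T \<noteq> right_type (act (gen i) T)"
  shows "\<bar>fval T i\<bar> = 1"
proof -
  obtain k where k: "T (r, r) = {k}" by (rule signed_filling_obtain[OF T corner])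
  have ks: "- k \<in> signed (card D)" using signed_filling_in[OF T k] by (simp add: signed_minus)
  have ck: "shifted_content 0 T (- k) = 0" using shifted_content_neg[OF T, of "(r, r)" "- k" 0] k by (simp add: content_def)
  have gk: "act (gen i) T (r, r) = {gen i k}" using k by (simp add: act_def)
  have *: "\<bar>fval T i\<bar> = 1" if x: "T b = {x}" "content b = 1" "(- k < x) \<noteq> (gen i (- k) < gen i x)" for b x
  proof -
    have "\<bar>- k\<bar> \<noteq> \<bar>x\<bar>" using signed_filling_unique[OF T k x(1)] x(2) by (auto simp: content_def)
    then have "\<bar>shifted_fval 0 i T\<bar> = \<bar>shifted_content 0 T (- k) - shifted_content 0 T x\<bar>"
      using swap_fval[OF T i ks _ _ x(3)] signed_filling_in[OF T x(1)] by blast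
    then show ?thesis using ck shifted_content_pos[OF T x(1), of 0] x(2) fval_shifted_fval[OF T i] by simp
  qed
  have im: "(act (gen i) T b = {y}) \<longleftrightarrow> (T b = {gen i y})" for b y
  proof
    assume "act (gen i) T b = {y}"
    then have "gen i ` gen i ` T b = {gen i y}" by (simp add: act_def)
    then show "T b = {gen i y}" by (simp add: image_image gen_invol)
  qed (simp add: act_def gen_invol)
  show ?thesis using change
  proof
    assume ch: "up_type T \<noteq> up_type (act (gen i) T)"
    then obtain x where x: "T (r - 1, r) = {x}" using im unfolding up_type_def by metis
    then have "act (gen i) T (r - 1, r) = {gen i x}" by (simp add: act_def)
    then have "(- k < x) \<noteq> (gen i (- k) < gen i x)" using ch k gk x by (auto simp: up_type_def gen_minus)
    then show ?thesis using *[OF x] by (simp add: content_def)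
  next
    assume ch: "right_type T \<noteq> right_type (act (gen i) T)"
    then obtain x where x: "T (r, r + 1) = {x}" using im unfolding right_type_def by metis
    have ne: "x \<noteq> - k" using signed_filling_unique[OF T k x] by auto
    then have ne': "gen i x \<noteq> gen i (- k)" by (metis gen_invol)
    have "act (gen i) T (r, r + 1) = {gen i x}" using x by (simp add: act_def)
    then have "(x < - k) \<noteq> (gen i x < gen i (- k))" using ch k gk x by (auto simp: right_type_def gen_minus)
    then have "(- k < x) \<noteq> (gen i (- k) < gen i x)" using ne ne' by auto
    then show ?thesis using *[OF x] by (simp add: content_def)
  qed
qed

text \<open>No change of basis is needed beyond the relabelling \<open>h\<close>: within a block the
  entries agree because doubling commutes with the generators and preserves f_i, and between blocks
  they vanish by \<open>type_change\<close>.\<close>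

lemma limit_rep_iso:
  "rep_iso (card D) (rep_dsum (rho (T_box lam)) (rep_dsum (rho (T_two True lam s)) (rho (T_two False lam s))))
     (rho (signed_tableaux D s))" (is "rep_iso _ ?X ?Y")
proof -
  let ?S = "signed_tableaux D s"
  define h where "h T = (if up_type T then Inr (Inl (double (2*r - 1) T))
      else if right_type T then Inr (Inr (double (2*r + 1) T)) else Inl (double (2*r) T))" for T
  have fS: "finite ?S" using skew by (intro finite_signed_tableaux) (simp add: is_skew_diagram_def)
  have T: "signed_filling D T" "is_standard T" "even (neg_count T D) = s" if "T \<in> ?S" for T
    using that by (auto simp: signed_tableaux_def)
  have inj: "double q T' = double q T \<longleftrightarrow> T' = T"
    if "signed_filling D T" "even (neg_count T D) = s" "T' \<in> ?S" "q \<in> {2*r - 1, 2*r, 2*r + 1}" for q T T'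
    using double_inj[OF T(1)[OF that(3)] that(1) _ that(4)] T(3)[OF that(3)] that(2) by auto
  have img: "h ` ?S = fst ?X"
  proof (intro equalityI subsetI)
    fix z assume "z \<in> h ` ?S"
    then obtain U where U: "U \<in> ?S" "z = h U" by blast
    show "z \<in> fst ?X"
      using double_in_T_box[OF U(1)] double_in_T_two[OF U(1), of True] double_in_T_two[OF U(1), of False] U(2)
      by (auto simp: h_def rep_dsum_def rho_def)
  next
    fix z assume "z \<in> fst ?X"
    then consider F where "z = Inl F" "F \<in> T_box lam" | F where "z = Inr (Inl F)" "F \<in> T_two True lam s"
      | F where "z = Inr (Inr F)" "F \<in> T_two False lam s"
      by (auto simp: rep_dsum_def rho_def)
    then show "z \<in> h ` ?S"
    proof cases
      case (1 F)
      obtain U where "U \<in> ?S" "\<not> up_type U" "\<not> right_type U" "F = double (2*r) U"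
        using T_box_double[OF 1(2), of s] by blast
      then show ?thesis using 1 by (intro image_eqI[of _ _ U]) (auto simp: h_def)
    next
      case (2 F)
      obtain U where "U \<in> ?S" "up_type U" "F = double (2*r - 1) U"
        using T_two_double[OF 2(2)] by auto
      then show ?thesis using 2 by (intro image_eqI[of _ _ U]) (auto simp: h_def)
    next
      case (3 F)
      obtain U where U: "U \<in> ?S" "right_type U" "F = double (2*r + 1) U"
        using T_two_double[OF 3(2)] by auto
      then have "\<not> up_type U" using not_up_and_right[OF T(1,2)[OF U(1)]] by blast
      then show ?thesis using 3 U by (intro image_eqI[of _ _ U]) (auto simp: h_def)
    qed
  qed
  have "inj_on h ?S"
  proof (rule inj_onI)
    fix U V assume U: "U \<in> ?S" and V: "V \<in> ?S" and e: "h U = h V"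
    then show "U = V" using inj[OF T(1,3)[OF V] U] by (auto simp: h_def split: if_splits)
  qed
  then have bij: "bij_betw h ?S (fst ?X)" using img by (simp add: bij_betw_def)
  have "rep_iso (card D) ?Y ?X"
  proof (rule rep_iso_bij[where h = h])
    fix i U V assume i: "i \<in> gens (card D)" and "U \<in> fst ?Y" "V \<in> fst ?Y"
    then have U: "U \<in> ?S" and V: "V \<in> ?S" by (auto simp: rho_def)
    have same: "seminormal i (double q U) (double q V) = seminormal i U V" if q: "q \<in> {2*r - 1, 2*r, 2*r + 1}" for q
    proof -
      have "double q V = act (gen i) (double q U) \<longleftrightarrow> V = act (gen i) U"
        unfolding double_act[symmetric]
        by (rule inj[OF signed_filling_act[OF T(1)[OF U] i] _ V q]) (use act_neg_count[OF T(1)[OF U] i] T(3)[OF U] in simp)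
      then show ?thesis
        unfolding seminormal_def using fval_double[OF T(1)[OF U] q i] inj[OF T(1,3)[OF U] V q] by simp
    qed
    have diff: "seminormal i U V = 0" if "up_type U \<noteq> up_type V \<or> right_type U \<noteq> right_type V"
    proof -
      have "V \<noteq> U" using that by auto
      moreover have "sqrt (1 - 1 / (fval U i)\<^sup>2) = 0" if "V = act (gen i) U"
      proof -
        have "\<bar>fval U i\<bar> = 1" by (rule type_change[OF T(1)[OF U] i]) (use that \<open>up_type U \<noteq> up_type V \<or> right_type U \<noteq> right_type V\<close> in simp)
        then show ?thesis using off_diag_one unfolding off_diag_def by blast
      qed
      ultimately show ?thesis by (simp add: seminormal_def)
    qed
    have nU: "\<not> (up_type U \<and> right_type U)" and nV: "\<not> (up_type V \<and> right_type V)"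
      using not_up_and_right[OF T(1,2)[OF U]] not_up_and_right[OF T(1,2)[OF V]] by blast+
    show "snd ?Y i U V = snd ?X i (h U) (h V)"
      using same diff nU nV by (auto simp: rho_def rep_dsum_def h_def)
  qed (use bij fS in \<open>simp_all add: rho_def\<close>)
  then show ?thesis
    by (rule rep_iso_sym) (use bij bij_betw_finite fS in \<open>auto simp: rho_def\<close>)
qed

end

end

theorem theorem5p11:
  fixes lam :: "box set" and m :: nat
  assumes "is_skew_diagram lam" and "lam \<noteq> {}" and "1 \<le> m"
  shows "rep_iso (card lam)
           (rep_dsum (rho (T_box lam)) (rep_dsum (rho (T_two True lam True)) (rho (T_two False lam True))))
           (rho (T_m lam (int m) True)) \<and>
         rep_iso (card lam)
           (rep_dsum (rho (T_box lam)) (rep_dsum (rho (T_two True lam False)) (rho (T_two False lam False))))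
           (rho (T_m lam (int m) False))"
proof -
  \<comment> \<open>A nonempty diagram attains its minimal content, and \<open>place lam 0\<close>
    moves that content to 0; the box found is the corner.\<close>
  obtain b where b: "b \<in> place lam 0" "content b = 0" using place_content_eq[OF assms(1,2)] by blast
  then have corner: "(fst b, fst b) \<in> place lam 0" by (cases b) (simp add: content_def)
  interpret corner_diagram "place lam 0" "fst b"
    by unfold_locales (rule skew_place[OF assms(1)], erule place_content_ge[OF assms(1)], rule corner)
  have "rep_iso (card lam)
      (rep_dsum (rho (T_box lam)) (rep_dsum (rho (T_two True lam s)) (rho (T_two False lam s))))
      (rho (T_m lam (int m) s))" for s
  proof (rule rep_iso_trans[OF _ T_m_rep_iso[OF assms(1)]])
    show "rep_iso (card lam)
      (rep_dsum (rho (T_box lam)) (rep_dsum (rho (T_two True lam s)) (rho (T_two False lam s)))) (rho (T_m lam 0 s))"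
      using limit_rep_iso[of lam s] by (simp add: T_m_eq card_place)
    have "finite (place lam 0)" using skew by (simp add: is_skew_diagram_def)
    then show "finite (fst (rho (T_m lam 0 s)))" by (simp add: rho_def T_m_eq finite_signed_tableaux)
  qed
  then show ?thesis by blast
qed

end
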